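(* Consider the stochastic energy exchange model $\mathbf{E}_t$ on $\mathbb{R}^N_+$ with transition kernel $P^t$ described in the context. For any $\gamma>0$ there exists $\eta>0$ such that for any probability measures $\mu,\nu\in\mathcal{M}_\eta$, $$\lim_{t\to\infty} t^{2-\gamma}\,\|\mu P^t-\nu P^t\|_{TV}=0,$$ where $\|\cdot\|_{TV}$ is the total variation norm.
   Context: Fix an integer $N\ge1$, bath temperatures $T_L,T_R>0$ and a sufficiently large constant $K$ ($K\gg T_L,T_R$). Let $R(a,b)=\min\{K,\sqrt{\min(a,b)}\}$. The stochastic energy exchange model is the Markov jump process $\mathbf{E}_t=(E_1(t),\dots,E_N(t))$ on $\mathbb{R}^N_+$ defined as follows: for each $i=1,\dots,N-1$ an exponential clock with rate $R(E_i,E_{i+1})$ is attached to sites $i,i+1$; when it rings, $(E_i,E_{i+1})$ is replaced by $(p(E_i+E_{i+1}),(1-p)(E_i+E_{i+1}))$ with $p$ uniform on $(0,1)$. A clock of rate $R(T_L,E_1)$ (resp. $R(E_N,T_R)$) is attached to site $1$ and the left bath (resp. site $N$ and the right bath); when it rings, $E_1$ is replaced by $p(E_1+X_L)$ (resp. $E_N$ by $p(E_N+X_R)$), with $p$ uniform on $(0,1)$ and $X_L$ (resp. $X_R$) exponential with mean $T_L$ (resp. $T_R$). All clocks and random variables are independent. $P^t(\mathbf{E},\cdot)$ is its transition kernel and $(\mu P^t)(B)=\int P^t(\mathbf{E},B)\,\mu(d\mathbf{E})$. Let $W(\mathbf{E})=\sum_{i=1}^N E_i$, $a_m=1-\frac{2^{m-1}-1}{2^N-1}$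 for $m=1,\dots,N$, and for $0<\eta\ll1$ let $V_\eta(\mathbf{E})=\sum_{m=1}^N\sum_{i=1}^{N-m+1}\big(\sum_{j=0}^{m-1}E_{i+j}\big)^{a_m\eta-1}$. $\mathcal{M}_\eta$ is the set of probability measures $\mu$ on $\mathbb{R}^N_+$ with $\int (W+V_\eta)\,d\mu<\infty$. *)

theory Defs
  imports "HOL-Probability.Probability"
begin

text \<open>States are vectors E = (E_0,...,E_{N-1}) (0-based indexing of the sites 1..N),
  represented as extensional functions nat \<Rightarrow> real on {..<N} with positive entries.\<close>

definition state_space :: "nat \<Rightarrow> (nat \<Rightarrow> real) measure" where
  "state_space N = PiM {..<N} (\<lambda>_. restrict_space borel {0<..})"

definition rate :: "real \<Rightarrow> real \<Rightarrow> real \<Rightarrow> real" where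
  "rate K a b = min K (sqrt (min a b))"

definition total_rate :: "nat \<Rightarrow> real \<Rightarrow> real \<Rightarrow> real \<Rightarrow> (nat \<Rightarrow> real) \<Rightarrow> real" where
  "total_rate N K TL TR E =
     (\<Sum>i<N-1. rate K (E i) (E (Suc i))) + rate K TL (E 0) + rate K (E (N-1)) TR"

text \<open>One step of the uniformized jump chain (uniformization constant (N+1)K, an upper
  bound for the total rate), acting on nonnegative functions: (Q f)(E) = int f(y) Q(E,dy).
  p is uniform on (0,1); X_L, X_R are exponential with means TL, TR.\<close>
definition jump_step ::
  "nat \<Rightarrow> real \<Rightarrow> real \<Rightarrow> real \<Rightarrow> ((nat \<Rightarrow> real) \<Rightarrow> ennreal) \<Rightarrow> (nat \<Rightarrow> real) \<Rightarrow> ennreal" where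
  "jump_step N K TL TR f E =
    (let L = real (N + 1) * K in
      (\<Sum>i<N-1. ennreal (rate K (E i) (E (Suc i)) / L) *
         (\<integral>\<^sup>+ p. indicator {0<..<1} p *
             f (E(i := p * (E i + E (Suc i)), Suc i := (1 - p) * (E i + E (Suc i)))) \<partial>lborel))
    + ennreal (rate K TL (E 0) / L) *
         (\<integral>\<^sup>+ p. indicator {0<..<1} p *
            (\<integral>\<^sup>+ x. indicator {0..} x * ennreal (exp (- x / TL) / TL) *
                f (E(0 := p * (E 0 + x))) \<partial>lborel) \<partial>lborel)
    + ennreal (rate K (E (N-1)) TR / L) *
         (\<integral>\<^sup>+ p. indicator {0<..<1} p *
            (\<integral>\<^sup>+ x. indicator {0..} x * ennreal (exp (- x / TR) / TR) *
                f (E(N-1 := p * (E (N-1) + x))) \<partial>lborel) \<partial>lborel)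
    + ennreal (1 - total_rate N K TL TR E / L) * f E)"

text \<open>Transition kernel P^t(E,A) of the Markov jump process, via uniformization:
  P^t = sum_n e^{-Lt} (Lt)^n / n! Q^n.\<close>
definition trans_kernel ::
  "nat \<Rightarrow> real \<Rightarrow> real \<Rightarrow> real \<Rightarrow> real \<Rightarrow> (nat \<Rightarrow> real) \<Rightarrow> (nat \<Rightarrow> real) set \<Rightarrow> ennreal" where
  "trans_kernel N K TL TR t E A =
    (let L = real (N + 1) * K in
      (\<Sum>n. ennreal (exp (- L * t) * (L * t) ^ n / fact n) *
            ((jump_step N K TL TR ^^ n) (indicator A) E)))"

definition evolve ::
  "nat \<Rightarrow> real \<Rightarrow> real \<Rightarrow> real \<Rightarrow> (nat \<Rightarrow> real) measure \<Rightarrow> real \<Rightarrow> (nat \<Rightarrow> real) set \<Rightarrow> real" where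
  "evolve N K TL TR \<mu> t B = enn2real (\<integral>\<^sup>+ E. trans_kernel N K TL TR t E B \<partial>\<mu>)"

text \<open>Total variation norm of the signed measure f - g on the measurable space M:
  |f - g|(Omega) = sup_A [(f-g)(A) - (f-g)(Omega - A)].\<close>
definition tv_norm :: "'a measure \<Rightarrow> ('a set \<Rightarrow> real) \<Rightarrow> ('a set \<Rightarrow> real) \<Rightarrow> real" where
  "tv_norm M f g = (SUP A\<in>sets M. \<bar>(f A - g A) - (f (space M - A) - g (space M - A))\<bar>)"

definition W_fun :: "nat \<Rightarrow> (nat \<Rightarrow> real) \<Rightarrow> real" where
  "W_fun N E = (\<Sum>i<N. E i)"

definition a_coef :: "nat \<Rightarrow> nat \<Rightarrow> real" where
  "a_coef N m = 1 - (2 ^ (m - 1) - 1) / (2 ^ N - 1)"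

definition V_fun :: "nat \<Rightarrow> real \<Rightarrow> (nat \<Rightarrow> real) \<Rightarrow> real" where
  "V_fun N \<eta> E = (\<Sum>m\<in>{1..N}. \<Sum>i\<in>{0..N-m}. (\<Sum>j<m. E (i + j)) powr (a_coef N m * \<eta> - 1))"

definition M_eta :: "nat \<Rightarrow> real \<Rightarrow> (nat \<Rightarrow> real) measure set" where
  "M_eta N \<eta> = {\<mu>. prob_space \<mu> \<and> sets \<mu> = sets (state_space N) \<and>
      (\<integral>\<^sup>+ E. ennreal (W_fun N E + V_fun N \<eta> E) \<partial>\<mu>) < \<infinity>}"

end

theory Submission
  imports Defs
begin

text \<open>
  The uniformized jump chain \<open>Q\<close> has, for every \<open>\<beta> < 2\<close>, a Lyapunov function \<open>V \<ge> 1\<close> with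
  \<open>Q V \<le> V - c V powr (1 - 1/\<beta>) + b\<close>.  It is a sum of three parts.  The first is a weighted sum of the
  powers \<open>-\<beta>/2\<close> of the energies of blocks of consecutive sites: a block loses energy slowly only if it
  has itself low energy, and what a block gains from an exchange at its boundary is controlled by
  the block that is larger by one site.  The second part penalizes sites of low energy that have much
  energy on their right, with exponents that decrease to the left.  The third is a small power of a
  linear functional with concave weights, which the exchanges decrease as long as high-energy sites
  are not adjacent to low-energy ones.  Refreshing the sites one after the other gives a minorization
  on the sublevel sets of \<open>V\<close>.

  No coupling is needed for the rate: for a test function \<open>f\<close> the oscillation of \<open>(Q ^^ n) f\<close> is bounded
  by \<open>(t + (V x + V y) powr (1/\<beta>)) powr \<beta>\<close> up to a factor.  This is a concave function of
  \<open>V x + V y\<close>, so one may apply \<open>Q\<close> to its tangent line; the drift (for large \<open>V\<close>) and the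
  minorization (for small \<open>V\<close>) each decrease \<open>t\<close> by a constant.  Averaging over the Poisson number of
  jumps turns \<open>n powr -\<beta>\<close> into \<open>t powr -\<beta>\<close>.
\<close>

subsection \<open>Markov operators\<close>

text \<open>The limit 2 for the exponent comes from low energies. An exchange of total energy s
  leaves a site below \<epsilon> with probability of order \<epsilon> / s, and its clocks then have
  rate at most sqrt \<epsilon>, so waiting times have a tail of order t powr -2. Correspondingly z
  powr -(\<beta>/2) stays integrable under a uniform fraction as long as \<beta> < 2, and sqrt z * z
  powr -(\<beta>/2) is its power 1 - 1/\<beta>, which is the exponent in the drift condition. The
  main obstacle is at high energies. The rate of an edge is governed by its poorer site, so a rich
  site next to a poor one is blocked and no functional of the high energies alone has negative
  drift. The blocked configurations are charged to the second part, whose dissipation must dominate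
  what the third part gains there. The third part is a power so small that this gain is a small
  power of the energy to the right of the poor site, and the second part in turn leaves errors in
  negative powers of the rates that the first part absorbs. The three parts are therefore weighted
  in this order, each one paying for those of the parts above it.\<close>

locale markov_operator =
  fixes M :: "'a measure" and Q :: "('a \<Rightarrow> ennreal) \<Rightarrow> 'a \<Rightarrow> ennreal"
  assumes measurable_op [measurable (raw)]:
      "f \<in> borel_measurable M \<Longrightarrow> Q f \<in> borel_measurable M"
    and op_add: "\<lbrakk>f \<in> borel_measurable M; g \<in> borel_measurable M; x \<in> space M\<rbrakk>
      \<Longrightarrow> Q (\<lambda>y. f y + g y) x = Q f x + Q g x"
    and op_cmult: "\<lbrakk>f \<in> borel_measurable M; x \<in> space M\<rbrakk> \<Longrightarrow> Q (\<lambda>y. c * f y) x = c * Q f x"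
    and op_one: "x \<in> space M \<Longrightarrow> Q (\<lambda>_. 1) x = 1"
    and op_mono: "\<lbrakk>f \<in> borel_measurable M; g \<in> borel_measurable M; x \<in> space M;
      \<And>y. y \<in> space M \<Longrightarrow> f y \<le> g y\<rbrakk> \<Longrightarrow> Q f x \<le> Q g x"
begin

lemma op_const: "x \<in> space M \<Longrightarrow> Q (\<lambda>_. c) x = c"
  using op_cmult[of "\<lambda>_. 1" x c] op_one[of x] by simp

lemma op_cong:
  assumes "f \<in> borel_measurable M" "g \<in> borel_measurable M" "x \<in> space M"
    and "\<And>y. y \<in> space M \<Longrightarrow> f y = g y"
  shows "Q f x = Q g x"
  by (intro antisym op_mono assms) (auto simp: assms)

lemma op_le_one:
  assumes "f \<in> borel_measurable M" "x \<in> space M" "\<And>y. y \<in> space M \<Longrightarrow> f y \<le> 1"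
  shows "Q f x \<le> 1"
  using op_mono[of f "\<lambda>_. 1" x] assms op_one by simp

lemma affine_op:
  assumes [measurable]: "f \<in> borel_measurable M" "g \<in> borel_measurable M" and x: "x \<in> space M"
  shows "Q (\<lambda>y. a + f y + c * g y) x = a + Q f x + c * Q g x"
proof -
  have "Q (\<lambda>y. a + f y + c * g y) x = Q (\<lambda>y. a + f y) x + Q (\<lambda>y. c * g y) x"
    by (rule op_add) (use x in auto)
  then show ?thesis
    using op_add[of "\<lambda>_. a" f x] op_cmult[of g x c] op_const[of x a] x by simp
qed

lemma markov_operator_comp:
  assumes "markov_operator M P"
  shows "markov_operator M (\<lambda>f. P (Q f))"
proof -
  interpret P: markov_operator M P by fact
  show ?thesis
  proof
    fix f g :: "'a \<Rightarrow> ennreal" and x c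
    assume m: "f \<in> borel_measurable M"
    then show "P (Q f) \<in> borel_measurable M" by simp
    assume x: "x \<in> space M"
    show "P (Q (\<lambda>y. c * f y)) x = c * P (Q f) x"
      using m x by (subst P.op_cmult[symmetric]) (auto intro!: P.op_cong simp: op_cmult)
    assume m2: "g \<in> borel_measurable M"
    show "P (Q (\<lambda>y. f y + g y)) x = P (Q f) x + P (Q g) x"
      using m m2 x by (subst P.op_add[symmetric]) (auto intro!: P.op_cong simp: op_add)
    assume "\<And>y. y \<in> space M \<Longrightarrow> f y \<le> g y"
    then show "P (Q f) x \<le> P (Q g) x"
      using m m2 x by (intro P.op_mono) (auto intro!: op_mono)
  next
    fix x assume x: "x \<in> space M"
    have "P (Q (\<lambda>_. 1)) x = P (\<lambda>_. 1) x"
      by (rule P.op_cong) (use x op_one in auto)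
    then show "P (Q (\<lambda>_. 1)) x = 1" using P.op_one x by simp
  qed
qed

lemma markov_operator_power: "markov_operator M (Q ^^ n)"
proof (induction n)
  case 0
  show ?case by standard auto
next
  case (Suc n)
  interpret P: markov_operator M "Q ^^ n" by fact
  have "markov_operator M Q" by unfold_locales
  from P.markov_operator_comp[OF this] show ?case by (simp add: comp_def)
qed

text \<open>The bound is integrated against the product of the two one-step laws, one variable at a
  time: with the other argument frozen, the right-hand side is affine in \<open>V\<close>, and
  \<open>affine_op\<close> evaluates it exactly.\<close>

lemma osc_step:
  assumes [measurable]: "g \<in> borel_measurable M" "V \<in> borel_measurable M"
    and sp: "x \<in> space M" "y \<in> space M"
    and osc: "\<And>x y. \<lbrakk>x \<in> space M; y \<in> space M\<rbrakk> \<Longrightarrow> g x \<le> g y + a + l * V x + l * V y"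
  shows "Q g x \<le> Q g y + a + l * Q V x + l * Q V y"
proof -
  have 1: "Q g x \<le> (a + l * Q V x) + g z + l * V z" if z: "z \<in> space M" for z
  proof -
    have "Q g x \<le> Q (\<lambda>x. (g z + a + l * V z) + l * V x) x"
      using osc z by (intro op_mono sp) (auto simp: algebra_simps)
    also have "\<dots> = (g z + a + l * V z) + l * Q V x"
      using affine_op[of "\<lambda>_. 0" V x "g z + a + l * V z" l] sp op_const[of x 0] by simp
    finally show ?thesis by (simp add: algebra_simps)
  qed
  have "Q g x = Q (\<lambda>_. Q g x) y" using op_const sp by simp
  also have "\<dots> \<le> Q (\<lambda>z. (a + l * Q V x) + g z + l * V z) y"
    by (intro op_mono sp 1) auto
  also have "\<dots> = (a + l * Q V x) + Q g y + l * Q V y"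
    by (intro affine_op sp) auto
  finally show ?thesis by (simp add: algebra_simps)
qed

text \<open>\<open>Q - e T\<close> is a positive functional; the inequality is kept free of subtraction.\<close>
lemma minorized_mono:
  assumes [measurable]: "f \<in> borel_measurable M" "g \<in> borel_measurable M" and x: "x \<in> space M"
    and T: "markov_operator M T"
    and minor: "\<And>f. f \<in> borel_measurable M \<Longrightarrow> e * T f x \<le> Q f x"
    and le: "\<And>y. y \<in> space M \<Longrightarrow> f y \<le> g y"
  shows "Q f x + e * T g x \<le> Q g x + e * T f x"
proof -
  interpret T: markov_operator M T by fact
  define k where "k y = g y - f y" for y
  have [measurable]: "k \<in> borel_measurable M" unfolding k_def by simp
  have g: "g y = f y + k y" if "y \<in> space M" for y
    using le[OF that] by (simp add: k_def add_diff_inverse_ennreal)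
  have 1: "Q g x = Q f x + Q k x"
    using op_cong[of g "\<lambda>y. f y + k y" x] x g op_add[of f k x] by simp
  have 2: "T g x = T f x + T k x"
    using T.op_cong[of g "\<lambda>y. f y + k y" x] x g T.op_add[of f k x] by simp
  have "e * T k x \<le> Q k x" by (rule minor) simp
  then show ?thesis
    unfolding 1 2 by (simp add: algebra_simps add_left_mono)
qed

text \<open>The residual functionals \<open>Q - e T\<close>, of mass \<open>1 - e\<close>, are
  applied in both variables; after division by \<open>1 - e\<close> one factor \<open>1 - e\<close>
  is left on the constant \<open>a\<close>. The removed parts cancel because
  \<open>T f x = T f y\<close>. The bounds \<open>g \<le> 1\<close>, \<open>vx\<close> and
  \<open>vy\<close> make all values finite, so that the last rearrangement can be done with real
  subtraction.\<close>

lemma osc_step_minorized: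
  fixes V :: "'a \<Rightarrow> real" and e a l :: real
  assumes [measurable]: "g \<in> borel_measurable M" "V \<in> borel_measurable M"
    and sp: "x \<in> space M" "y \<in> space M"
    and e: "0 < e" "e < 1" and nn: "a \<ge> 0" "l \<ge> 0" "\<And>x. x \<in> space M \<Longrightarrow> V x \<ge> 0"
    and g1: "\<And>x. x \<in> space M \<Longrightarrow> g x \<le> 1"
    and T: "markov_operator M T"
    and minor: "\<And>f. f \<in> borel_measurable M \<Longrightarrow> ennreal e * T f x \<le> Q f x"
               "\<And>f. f \<in> borel_measurable M \<Longrightarrow> ennreal e * T f y \<le> Q f y"
    and Txy: "\<And>f. f \<in> borel_measurable M \<Longrightarrow> T f x = T f y"
    and vx: "Q (\<lambda>z. ennreal (V z)) x \<le> ennreal vx" and vy: "Q (\<lambda>z. ennreal (V z)) y \<le> ennreal vy"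
    and osc: "\<And>x y. \<lbrakk>x \<in> space M; y \<in> space M\<rbrakk>
      \<Longrightarrow> g x \<le> g y + ennreal a + ennreal l * ennreal (V x) + ennreal l * ennreal (V y)"
  shows "Q g x \<le> Q g y + ennreal ((1 - e) * a) + ennreal l * Q (\<lambda>z. ennreal (V z)) x
           + ennreal l * Q (\<lambda>z. ennreal (V z)) y"
proof -
  interpret T: markov_operator M T by fact
  define W where "W z = ennreal (V z)" for z
  have [measurable]: "W \<in> borel_measurable M" unfolding W_def by simp
  define X where "X = ennreal l * Q W x + ennreal e * T g x"
  define c where "c z = g z + ennreal a + ennreal l * W z" for z
  have [measurable]: "c \<in> borel_measurable M" unfolding c_def by simp
  \<comment> \<open>First variable, with \<open>z\<close> in the place of the second. The term with
    \<open>T W\<close> is dropped, and \<open>X\<close> collects what does not depend on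
    \<open>z\<close>.\<close>
  have 1: "Q g x + ennreal e * c z \<le> c z + X" if z: "z \<in> space M" for z
  proof -
    have "Q g x + ennreal e * T (\<lambda>x. c z + 0 + ennreal l * W x) x
        \<le> Q (\<lambda>x. c z + 0 + ennreal l * W x) x + ennreal e * T g x"
      using osc z by (intro minorized_mono minor sp T) (auto simp: algebra_simps c_def W_def)
    also have "Q (\<lambda>x. c z + 0 + ennreal l * W x) x = c z + ennreal l * Q W x"
      using affine_op[of "\<lambda>_. 0" W x "c z" "ennreal l"] sp op_const[of x 0] by simp
    also have "T (\<lambda>x. c z + 0 + ennreal l * W x) x = c z + ennreal l * T W x"
      using T.affine_op[of "\<lambda>_. 0" W x "c z" "ennreal l"] sp T.op_const[of x 0] by simp
    finally have "Q g x + ennreal e * (c z + ennreal l * T W x) \<le> c z + X"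
      by (simp add: X_def algebra_simps)
    moreover have "Q g x + ennreal e * c z \<le> Q g x + ennreal e * (c z + ennreal l * T W x)"
      by (intro add_left_mono mult_left_mono) auto
    ultimately show ?thesis by (rule order_trans[rotated])
  qed
  \<comment> \<open>Second variable: \<open>1\<close> is an inequality between functions of
    \<open>z\<close>, now pushed through the residual functional at \<open>y\<close>.\<close>
  have *: "Q (\<lambda>z. Q g x + 0 + ennreal e * c z) y + ennreal e * T (\<lambda>z. X + 0 + 1 * c z) y
      \<le> Q (\<lambda>z. X + 0 + 1 * c z) y + ennreal e * T (\<lambda>z. Q g x + 0 + ennreal e * c z) y"
    using 1 by (intro minorized_mono minor sp T) (auto simp: algebra_simps)
  have c': "c = (\<lambda>z. ennreal a + g z + ennreal l * W z)" by (auto simp: c_def algebra_simps)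
  have Qc: "Q c y = ennreal a + Q g y + ennreal l * Q W y"
    unfolding c' by (rule affine_op) (use sp in auto)
  have Tc: "T c y = ennreal a + T g y + ennreal l * T W y"
    unfolding c' by (rule T.affine_op) (use sp in auto)
  have "Q g x + ennreal e * Q c y + ennreal e * (X + T c y) \<le> X + Q c y + ennreal e * (Q g x + ennreal e * T c y)"
    using * affine_op[of "\<lambda>_. 0" c y "Q g x" "ennreal e"] affine_op[of "\<lambda>_. 0" c y X 1]
      T.affine_op[of "\<lambda>_. 0" c y "Q g x" "ennreal e"] T.affine_op[of "\<lambda>_. 0" c y X 1] op_const[of y 0] T.op_const[of y 0] sp
    by simp
  moreover obtain A where A: "Q g x = ennreal A" "A \<ge> 0"
    using op_le_one[of g x] g1 sp by (cases "Q g x") (auto simp: top_unique)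
  moreover obtain B where B: "Q g y = ennreal B" "B \<ge> 0"
    using op_le_one[of g y] g1 sp by (cases "Q g y") (auto simp: top_unique)
  moreover obtain t where t: "T g y = ennreal t" "t \<ge> 0"
    using T.op_le_one[of g y] g1 sp by (cases "T g y") (auto simp: top_unique)
  moreover obtain w1 where w1: "Q W x = ennreal w1" "w1 \<ge> 0"
    using vx unfolding W_def[symmetric] by (cases "Q W x") (auto simp: top_unique)
  moreover obtain w2 where w2: "Q W y = ennreal w2" "w2 \<ge> 0"
    using vy unfolding W_def[symmetric] by (cases "Q W y") (auto simp: top_unique)
  \<comment> \<open>Finite because the minorization bounds \<open>e * T W y\<close> by
    \<open>Q W y\<close> and \<open>e\<close> is positive.\<close>
  moreover obtain w3 where w3: "T W y = ennreal w3" "w3 \<ge> 0"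
    using minor(2)[of W] w2 e by (cases "T W y") (auto simp: top_unique ennreal_mult_top)
  ultimately have "ennreal (A + e * (a + B + l * w2) + e * ((l * w1 + e * t) + (a + t + l * w3)))
     \<le> ennreal ((l * w1 + e * t) + (a + B + l * w2) + e * (A + e * (a + t + l * w3)))"
    unfolding Qc Tc X_def using Txy[of g] nn e
    by (simp flip: ennreal_plus ennreal_mult)
  then have le: "A + e * (a + B + l * w2) + e * ((l * w1 + e * t) + (a + t + l * w3))
     \<le> (l * w1 + e * t) + (a + B + l * w2) + e * (A + e * (a + t + l * w3))"
    using nn e A B t w1 w2 w3 by (subst (asm) ennreal_le_iff) (auto intro!: add_nonneg_nonneg)
  have "(1 - e) * A \<le> (1 - e) * (B + (1 - e) * a + l * w1 + l * w2 - e * (l * w3))"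
    using le by (simp add: algebra_simps)
  then have "A \<le> B + (1 - e) * a + l * w1 + l * w2 - e * (l * w3)"
    using e by simp
  also have "\<dots> \<le> B + (1 - e) * a + l * w1 + l * w2" using e nn w3 by simp
  finally have "ennreal A \<le> ennreal (B + (1 - e) * a + l * w1 + l * w2)" by (rule ennreal_leI)
  then show ?thesis
    using A B w1 w2 nn e by (simp add: W_def[symmetric] ennreal_plus ennreal_mult add_ac)
qed

end

subsection \<open>Polynomial contraction\<close>

text \<open>The solution at time \<beta> * t / c of v' = c * v powr (1 - 1/\<beta>) started at
  \<open>v\<close>, that is, the flow reversing the drift. It is concave in \<open>v\<close>, and
  running time backwards amounts to lowering \<open>t\<close>.\<close>

definition hfun :: "real \<Rightarrow> real \<Rightarrow> real \<Rightarrow> real" where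
  "hfun \<beta> t v = (t + v powr (1 / \<beta>)) powr \<beta>"

text \<open>The right-hand side is the tangent line at \<open>a\<close>. The inequality is convexity
  of the power \<beta>, applied to \<open>t + z\<close> as the mean of \<open>t + u\<close> and
  \<open>z * ((t + u) / u)\<close> with weights t / (t + u) and u / (t + u), where
  \<open>z = v powr (1 / \<beta>)\<close>.\<close>

lemma hfun_tangent:
  fixes \<beta> t a v :: real
  assumes "\<beta> \<ge> 1" "t \<ge> 0" "a > 0" "v > 0"
  defines "u \<equiv> a powr (1 / \<beta>)"
  shows "hfun \<beta> t v \<le> t * (t + u) powr (\<beta> - 1) + ((t + u) / u) powr (\<beta> - 1) * v"
proof -
  define z where "z = v powr (1 / \<beta>)"
  have u: "u > 0" and z: "z > 0" using assms by (auto simp: u_def z_def)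
  have v: "v = z powr \<beta>" using assms by (simp add: z_def powr_powr)
  have tu: "t + u > 0" using u assms(2) by simp
  define p where "p = u / (t + u)"
  have p: "0 \<le> p" "p \<le> 1" using u assms(1-4) by (auto simp: p_def)
  have "((1 - p) *\<^sub>R (t + u) + p *\<^sub>R (z * ((t + u) / u))) powr \<beta>
      \<le> (1 - p) * (t + u) powr \<beta> + p * (z * ((t + u) / u)) powr \<beta>"
    using powr_convex[of \<beta>] assms(1-4) u z p
    by (intro convex_onD) (auto intro!: mult_pos_pos divide_pos_pos add_nonneg_pos)
  also have "(1 - p) *\<^sub>R (t + u) + p *\<^sub>R (z * ((t + u) / u)) = t + z"
    using u tu by (simp add: p_def divide_simps)
  also have "(1 - p) * (t + u) powr \<beta> = t * (t + u) powr (\<beta> - 1)"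
    using u tu by (simp add: p_def powr_diff field_simps)
  also have "p * (z * ((t + u) / u)) powr \<beta> = ((t + u) / u) powr (\<beta> - 1) * v"
  proof -
    have "(z * ((t + u) / u)) powr \<beta> = v * ((t + u) / u) powr \<beta>"
      using u z tu by (simp add: v powr_mult flip: times_divide_eq_right)
    moreover have "((t + u) / u) powr \<beta> = ((t + u) / u) * ((t + u) / u) powr (\<beta> - 1)"
      using u tu by (simp add: powr_diff)
    ultimately show ?thesis using u tu by (simp add: p_def)
  qed
  finally show ?thesis by (simp add: hfun_def z_def)
qed

lemma hfun_tangent_eq:
  fixes \<beta> t a :: real
  assumes "\<beta> \<ge> 1" "t \<ge> 0" "a > 0"
  defines "u \<equiv> a powr (1 / \<beta>)"
  shows "t * (t + u) powr (\<beta> - 1) + ((t + u) / u) powr (\<beta> - 1) * a = hfun \<beta> t a"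
proof -
  have u: "u > 0" using assms by (auto simp: u_def)
  have a: "a = u powr \<beta>" using assms by (simp add: u_def powr_powr)
  have "((t + u) / u) powr (\<beta> - 1) * u powr \<beta> = u * (t + u) powr (\<beta> - 1)"
    using u assms(2) by (simp add: powr_divide powr_diff)
  then have "((t + u) / u) powr (\<beta> - 1) * a = u * (t + u) powr (\<beta> - 1)"
    unfolding a[symmetric] .
  moreover have "(t + u) powr \<beta> = (t + u) * (t + u) powr (\<beta> - 1)"
    using u assms(2) by (simp add: powr_diff)
  ultimately show ?thesis using u_def by (simp add: hfun_def algebra_simps)
qed

lemma one_minus_powr_le:
  fixes z p :: real
  assumes "0 < p" "p < 1" "z < 1"
  shows "(1 - z) powr p \<le> 1 - p * z"
  using Youngs_inequality_0[of p "1 - p" "1 - z" 1] assms by (simp add: algebra_simps)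

lemma powr_add_le:
  fixes x y p :: real
  assumes "0 < p" "p \<le> 1" "0 \<le> x" "0 \<le> y"
  shows "(x + y) powr p \<le> x powr p + y powr p"
proof (cases "x = 0 \<or> y = 0")
  case True
  then show ?thesis by auto
next
  case False
  then have pos: "0 < x" "0 < y" using assms by auto
  have *: "x / (x + y) \<le> (x / (x + y)) powr p" "y / (x + y) \<le> (y / (x + y)) powr p"
    using assms pos powr_mono'[of p 1 "x / (x + y)"] powr_mono'[of p 1 "y / (x + y)"]
    by (auto simp: powr_one)
  have "1 = x / (x + y) + y / (x + y)" using pos by (simp flip: add_divide_distrib)
  also have "\<dots> \<le> (x / (x + y)) powr p + (y / (x + y)) powr p" using * by simp
  also have "\<dots> = (x powr p + y powr p) / (x + y) powr p"
    using pos by (simp add: powr_divide add_divide_distrib)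
  finally show ?thesis using pos by (simp add: field_simps)
qed

text \<open>By Bernoulli's inequality one step of the drift lowers
  \<open>v powr (1 / \<beta>)\<close> by at least \<open>c / \<beta>\<close>; inside
  \<open>hfun\<close> this may equally be subtracted from \<open>t\<close>.\<close>

lemma hfun_decrease:
  fixes \<beta> t v c :: real
  assumes b: "\<beta> > 1" and t: "t \<ge> c / \<beta>" and v: "v \<ge> 1" and c: "0 < c" "c < 1"
  shows "hfun \<beta> t (v - c * v powr (1 - 1 / \<beta>)) \<le> hfun \<beta> (t - c / \<beta>) v"
proof -
  define u where "u = v powr (1 / \<beta>)"
  have u: "u \<ge> 1" using assms by (auto simp: u_def ge_one_powr_ge_zero)
  have cu: "c / u < 1" "c / u > 0" using u c by (auto simp: field_simps)
  have "v - c * v powr (1 - 1 / \<beta>) = v * (1 - c / u)"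
    using v by (simp add: u_def powr_diff field_simps)
  then have "(v - c * v powr (1 - 1 / \<beta>)) powr (1 / \<beta>) = u * (1 - c / u) powr (1 / \<beta>)"
    using v cu by (simp add: powr_mult u_def)
  also have "\<dots> \<le> u * (1 - 1 / \<beta> * (c / u))"
    using u b cu by (intro mult_left_mono one_minus_powr_le) auto
  also have "\<dots> = u - c / \<beta>" using u by (simp add: field_simps)
  finally show ?thesis
    unfolding hfun_def using assms u
    by (intro powr_mono2) (auto simp: u_def intro!: add_nonneg_nonneg order_trans[OF _ t])
qed

context markov_operator
begin

text \<open>Both claims apply the one-step bounds to the tangent line at a point \<open>a\<close>
  that is free to choose. In the near case \<open>a\<close> is taken with room \<open>1 - e\<close>,
  so that the slope term receives the same factor that the minorization puts on the intercept, and
  the two recombine to \<open>(1 - e) * hfun \<beta> t a\<close>.\<close>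

lemma
  fixes V :: "'a \<Rightarrow> real"
  assumes [measurable]: "g \<in> borel_measurable M" "V \<in> borel_measurable M"
    and sp: "x \<in> space M" "y \<in> space M"
    and par: "\<beta> > 1" "t \<ge> 0" "D \<ge> 0" "a > 0" and V: "\<And>x. x \<in> space M \<Longrightarrow> V x \<ge> 1"
    and osc: "\<And>x y. \<lbrakk>x \<in> space M; y \<in> space M\<rbrakk>
      \<Longrightarrow> g x \<le> g y + ennreal (hfun \<beta> t (V x + V y) * D)"
  shows hfun_osc_step_far: "Q (\<lambda>z. ennreal (V z)) x + Q (\<lambda>z. ennreal (V z)) y \<le> ennreal a \<Longrightarrow>
           Q g x \<le> Q g y + ennreal (hfun \<beta> t a * D)"
    and hfun_osc_step_near: "\<lbrakk>0 < e; e < 1; markov_operator M T;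
       \<And>f. f \<in> borel_measurable M \<Longrightarrow> ennreal e * T f x \<le> Q f x;
       \<And>f. f \<in> borel_measurable M \<Longrightarrow> ennreal e * T f y \<le> Q f y;
       \<And>f. f \<in> borel_measurable M \<Longrightarrow> T f x = T f y;
       \<And>x. x \<in> space M \<Longrightarrow> g x \<le> 1;
       Q (\<lambda>z. ennreal (V z)) x + Q (\<lambda>z. ennreal (V z)) y \<le> ennreal ((1 - e) * a)\<rbrakk> \<Longrightarrow>
           Q g x \<le> Q g y + ennreal ((1 - e) * hfun \<beta> t a * D)"
proof -
  define u where "u = a powr (1 / \<beta>)"
  define al where "al = t * (t + u) powr (\<beta> - 1) * D"
  define l where "l = ((t + u) / u) powr (\<beta> - 1) * D"
  have al: "al \<ge> 0" "l \<ge> 0" using par by (auto simp: al_def l_def)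
  have hal: "hfun \<beta> t a * D = al + l * a"
    using arg_cong[OF hfun_tangent_eq[of \<beta> t a], of "\<lambda>z. z * D"] par
    by (simp add: al_def l_def u_def algebra_simps)
  have osc': "g x \<le> g y + ennreal al + ennreal l * ennreal (V x) + ennreal l * ennreal (V y)"
    if "x \<in> space M" "y \<in> space M" for x y
  proof -
    have vv: "V x \<ge> 1" "V y \<ge> 1" using V that by auto
    have "hfun \<beta> t (V x + V y) * D \<le> al + l * V x + l * V y"
      using mult_right_mono[OF hfun_tangent[of \<beta> t a "V x + V y"], of D] par vv
      by (simp add: al_def l_def u_def algebra_simps)
    then have "ennreal (hfun \<beta> t (V x + V y) * D) \<le> ennreal (al + l * V x + l * V y)"
      by (rule ennreal_leI)
    also have "\<dots> = ennreal al + ennreal l * ennreal (V x) + ennreal l * ennreal (V y)"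
      using al vv by (simp add: ennreal_plus ennreal_mult)
    finally show ?thesis
      using osc[OF that] by (simp add: add.assoc add_left_mono order_trans)
  qed
  let ?V = "\<lambda>z. ennreal (V z)"
  {
    assume a: "Q ?V x + Q ?V y \<le> ennreal a"
    have "Q g x \<le> Q g y + ennreal al + ennreal l * Q ?V x + ennreal l * Q ?V y"
      by (rule osc_step) (use osc' sp in auto)
    also have "\<dots> = Q g y + (ennreal al + ennreal l * (Q ?V x + Q ?V y))"
      by (simp add: algebra_simps)
    also have "\<dots> \<le> Q g y + (ennreal al + ennreal l * ennreal a)"
      by (intro add_left_mono mult_left_mono a) auto
    also have "ennreal al + ennreal l * ennreal a = ennreal (hfun \<beta> t a * D)"
      unfolding hal using al par by (simp add: ennreal_plus ennreal_mult)
    finally show "Q g x \<le> Q g y + ennreal (hfun \<beta> t a * D)" .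
  }
  {
    assume e: "0 < e" "e < 1" and T: "markov_operator M T"
       "\<And>f. f \<in> borel_measurable M \<Longrightarrow> ennreal e * T f x \<le> Q f x"
       "\<And>f. f \<in> borel_measurable M \<Longrightarrow> ennreal e * T f y \<le> Q f y"
       "\<And>f. f \<in> borel_measurable M \<Longrightarrow> T f x = T f y"
       and g1: "\<And>x. x \<in> space M \<Longrightarrow> g x \<le> 1"
       and a: "Q ?V x + Q ?V y \<le> ennreal ((1 - e) * a)"
    have "Q g x \<le> Q g y + ennreal ((1 - e) * al) + ennreal l * Q ?V x + ennreal l * Q ?V y"
    proof (rule osc_step_minorized[where T = T and vx = "(1 - e) * a" and vy = "(1 - e) * a"])
      show "Q ?V x \<le> ennreal ((1 - e) * a)" "Q ?V y \<le> ennreal ((1 - e) * a)"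
        by (rule order_trans[OF _ a], simp)+
      show "V x \<ge> 0" if "x \<in> space M" for x using V[OF that] by simp
    qed (use osc' sp e T g1 al in auto)
    also have "\<dots> = Q g y + (ennreal ((1 - e) * al) + ennreal l * (Q ?V x + Q ?V y))"
      by (simp add: algebra_simps)
    also have "\<dots> \<le> Q g y + (ennreal ((1 - e) * al) + ennreal l * ennreal ((1 - e) * a))"
      by (intro add_left_mono mult_left_mono a) auto
    also have "ennreal ((1 - e) * al) + ennreal l * ennreal ((1 - e) * a)
        = ennreal ((1 - e) * al + l * ((1 - e) * a))"
      using al par e by (simp add: ennreal_plus ennreal_mult)
    also have "(1 - e) * al + l * ((1 - e) * a) = (1 - e) * hfun \<beta> t a * D"
      unfolding mult.assoc hal by (simp add: algebra_simps)
    finally show "Q g x \<le> Q g y + ennreal ((1 - e) * hfun \<beta> t a * D)" .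
  }
qed

text \<open>The minorization will hold for a power of \<open>Q\<close> only, whereas the contraction
  needs drift and minorization for one operator. The loss is kept from the first step alone; each
  further step costs at most \<open>b\<close>.\<close>

lemma op_drift_power:
  fixes V :: "'a \<Rightarrow> real"
  assumes [measurable]: "V \<in> borel_measurable M"
    and c: "c \<ge> 0" "b \<ge> 0" and V: "\<And>x. x \<in> space M \<Longrightarrow> V x \<ge> 0"
    and drift: "\<And>x. x \<in> space M \<Longrightarrow>
      Q (\<lambda>z. ennreal (V z)) x + ennreal (c * V x powr k) \<le> ennreal (V x + b)"
    and x: "x \<in> space M"
  shows "(Q ^^ Suc m) (\<lambda>z. ennreal (V z)) x + ennreal (c * V x powr k)
    \<le> ennreal (V x + real (Suc m) * b)"
  using x
proof (induction m arbitrary: x)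
  case 0
  then show ?case using drift by simp
next
  case (Suc m)
  interpret P: markov_operator M "Q ^^ Suc m" by (rule markov_operator_power)
  let ?V = "\<lambda>z. ennreal (V z)"
  have "(Q ^^ Suc (Suc m)) ?V x = Q ((Q ^^ Suc m) ?V) x" by simp
  also have "\<dots> \<le> Q (\<lambda>z. ennreal (real (Suc m) * b) + ?V z + 0 * ?V z) x"
  proof (rule op_mono)
    fix y assume y: "y \<in> space M"
    have "(Q ^^ Suc m) ?V y \<le> (Q ^^ Suc m) ?V y + ennreal (c * V y powr k)" by simp
    also have "\<dots> \<le> ennreal (V y + real (Suc m) * b)" by (rule Suc.IH[OF y])
    finally show "(Q ^^ Suc m) ?V y \<le> ennreal (real (Suc m) * b) + ?V y + 0 * ?V y"
      using V[OF y] c by (simp add: ennreal_plus[symmetric] add.commute del: ennreal_plus)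
  qed (use Suc.prems P.measurable_op in \<open>auto simp del: funpow.simps\<close>)
  also have "\<dots> = ennreal (real (Suc m) * b) + Q ?V x"
    by (subst affine_op) (use Suc.prems in auto)
  finally have "(Q ^^ Suc (Suc m)) ?V x + ennreal (c * V x powr k)
     \<le> ennreal (real (Suc m) * b) + Q ?V x + ennreal (c * V x powr k)" by (rule add_right_mono)
  also have "\<dots> = ennreal (real (Suc m) * b) + (Q ?V x + ennreal (c * V x powr k))"
    by (simp add: add.assoc)
  also have "\<dots> \<le> ennreal (real (Suc m) * b) + ennreal (V x + b)"
    by (intro add_left_mono drift Suc.prems)
  also have "\<dots> = ennreal (V x + real (Suc (Suc m)) * b)"
    using V[OF Suc.prems] c by (simp add: ennreal_plus[symmetric] algebra_simps del: ennreal_plus)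
  finally show ?case .
qed

theorem polynomial_contraction:
  fixes V :: "'a \<Rightarrow> real"
  assumes [measurable]: "V \<in> borel_measurable M"
    and par: "\<beta> > 1" "c > 0" "b \<ge> 0" and V: "\<And>x. x \<in> space M \<Longrightarrow> V x \<ge> 1"
    and drift: "\<And>x. x \<in> space M \<Longrightarrow>
      Q (\<lambda>z. ennreal (V z)) x + ennreal (c * V x powr (1 - 1 / \<beta>)) \<le> ennreal (V x + b)"
    and minor: "\<And>R. \<exists>e T. 0 < e \<and> e < 1 \<and> markov_operator M T \<and>
      (\<forall>f\<in>borel_measurable M. \<forall>x\<in>space M. \<forall>y\<in>space M. T f x = T f y) \<and>
      (\<forall>f\<in>borel_measurable M. \<forall>x\<in>space M. V x \<le> R \<longrightarrow> ennreal e * T f x \<le> Q f x)"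
  shows "\<exists>C>0. \<forall>f\<in>borel_measurable M. (\<forall>x\<in>space M. f x \<le> 1) \<longrightarrow>
      (\<forall>n. \<forall>x\<in>space M. \<forall>y\<in>space M.
        (Q ^^ n) f x \<le> (Q ^^ n) f y + ennreal (C * (V x + V y) / (real n + 1) powr \<beta>))"
proof -
  let ?V = "\<lambda>z. ennreal (V z)"
  define k where "k = 1 - 1 / \<beta>"
  have k: "0 < k" "k < 1" using par by (auto simp: k_def)
  \<comment> \<open>Half of the loss absorbs the constant \<open>2 * b\<close> as soon as the sum of
    the two values exceeds \<open>R\<close>; the other half, capped at 1/2 so that
    \<open>v - c' * v powr k\<close> stays positive, drives the contraction.\<close>
  define c' where "c' = min (c / 2) (1 / 2)"
  have c': "0 < c'" "c' < 1" "c' \<le> 1 / 2" "c' \<le> c / 2" using par by (auto simp: c'_def)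
  define R where "R = max 1 ((4 * b / c) powr (1 / k))"
  have R: "R \<ge> 1" by (simp add: R_def)
  have Rb: "2 * b \<le> c / 2 * v powr k" if "v \<ge> R" for v
  proof -
    have "4 * b / c = ((4 * b / c) powr (1 / k)) powr k"
      using par k by (simp add: powr_powr)
    also have "\<dots> \<le> v powr k" using that k by (intro powr_mono2) (auto simp: R_def)
    finally show ?thesis using par by (simp add: field_simps)
  qed
  have sum_drift: "Q ?V x + Q ?V y + ennreal (c * (V x + V y) powr k) \<le> ennreal (V x + V y + 2 * b)"
    if xy: "x \<in> space M" "y \<in> space M" for x y
  proof -
    have vv: "V x \<ge> 1" "V y \<ge> 1" using V xy by auto
    have "c * (V x + V y) powr k \<le> c * V x powr k + c * V y powr k"
      using powr_add_le[of k "V x" "V y"] k vv par by (simp flip: distrib_left)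
    then have "ennreal (c * (V x + V y) powr k) \<le> ennreal (c * V x powr k) + ennreal (c * V y powr k)"
      using par by (subst ennreal_plus[symmetric]) (auto intro!: ennreal_leI simp del: ennreal_plus)
    then have "Q ?V x + Q ?V y + ennreal (c * (V x + V y) powr k)
        \<le> Q ?V x + Q ?V y + (ennreal (c * V x powr k) + ennreal (c * V y powr k))"
      by (rule add_left_mono)
    also have "\<dots> = (Q ?V x + ennreal (c * V x powr k)) + (Q ?V y + ennreal (c * V y powr k))"
      by (simp add: add_ac)
    also have "\<dots> \<le> ennreal (V x + b) + ennreal (V y + b)"
      using drift xy unfolding k_def by (intro add_mono) auto
    also have "\<dots> = ennreal (V x + V y + 2 * b)"
      using vv par by (simp add: ennreal_plus[symmetric] algebra_simps del: ennreal_plus)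
    finally show ?thesis .
  qed
  obtain e T where e: "0 < e" "e < 1" and T: "markov_operator M T"
    and Tc: "\<And>f x y. \<lbrakk>f \<in> borel_measurable M; x \<in> space M; y \<in> space M\<rbrakk> \<Longrightarrow> T f x = T f y"
    and Tm: "\<And>f x. \<lbrakk>f \<in> borel_measurable M; x \<in> space M; V x \<le> R\<rbrakk> \<Longrightarrow> ennreal e * T f x \<le> Q f x"
    using minor[of R] by blast
  \<comment> \<open>The factor \<open>1 - e\<close> gained near the center becomes a factor
    \<open>th\<close> inside the power:
    \<open>(1 - e) * hfun \<beta> t a = (th * (t + a')) powr \<beta>\<close>.\<close>
  define th where "th = (1 - e) powr (1 / \<beta>)"
  have th: "0 < th" "th < 1" using e par powr_less_mono2[of "1 / \<beta>" "1 - e" 1] by (auto simp: th_def)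
  define a where "a = (R + 2 * b) / (1 - e)"
  have a: "a > 0" using R par e by (auto simp: a_def intro!: divide_pos_pos)
  define a' where "a' = a powr (1 / \<beta>)"
  have a': "a' > 0" using a by (simp add: a'_def)
  define c1 where "c1 = c' / \<beta>"
  have c1: "c1 > 0" using c' par by (simp add: c1_def)
  \<comment> \<open>Chosen so that \<open>th * (t + a') \<le> t - c1\<close> for all
    \<open>t \<ge> n0 + c1\<close>. The minorization then lowers \<open>t\<close> by the same amount
    \<open>c1\<close> as the drift does, and one step serves both cases.\<close>
  define n0 where "n0 = (th * a' + c1) / (1 - th)"
  have n0: "n0 > 0" using th a' c1 by (auto simp: n0_def intro!: divide_pos_pos add_pos_pos)
  have step: "Q g x \<le> Q g y + ennreal (hfun \<beta> (t - c1) (V x + V y) * D)"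
    if t: "t \<ge> n0 + c1" and D: "D \<ge> 0" and g [measurable]: "g \<in> borel_measurable M"
      and g1: "\<And>x. x \<in> space M \<Longrightarrow> g x \<le> 1"
      and osc: "\<And>x y. \<lbrakk>x \<in> space M; y \<in> space M\<rbrakk> \<Longrightarrow> g x \<le> g y + ennreal (hfun \<beta> t (V x + V y) * D)"
      and xy: "x \<in> space M" "y \<in> space M"
    for t D g x y
  proof (cases "V x + V y \<le> R")
    case True
    have vv: "V x \<ge> 1" "V y \<ge> 1" using V xy by auto
    have "Q ?V x + Q ?V y \<le> ennreal (V x + V y + 2 * b)"
      by (rule order_trans[OF _ sum_drift[OF xy]]) simp
    also have "\<dots> \<le> ennreal ((1 - e) * a)"
      using True e by (intro ennreal_leI) (simp add: a_def)
    finally have s: "Q ?V x + Q ?V y \<le> ennreal ((1 - e) * a)" .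
    have "Q g x \<le> Q g y + ennreal ((1 - e) * hfun \<beta> t a * D)"
    proof (rule hfun_osc_step_near[OF g _ xy, where T = T])
      show "V x \<ge> 1" if "x \<in> space M" for x using V[OF that] .
      show "ennreal e * T f x \<le> Q f x" if "f \<in> borel_measurable M" for f
        using that True vv xy by (intro Tm) auto
      show "ennreal e * T f y \<le> Q f y" if "f \<in> borel_measurable M" for f
        using that True vv xy by (intro Tm) auto
      show "T f x = T f y" if "f \<in> borel_measurable M" for f
        using Tc[OF that xy] .
    qed (use par t n0 c1 D a in \<open>(simp; fail)+\<close>, (fact assms osc T s g1 e D a)+)
    also have "\<dots> \<le> Q g y + ennreal (hfun \<beta> (t - c1) (V x + V y) * D)"
    proof (intro add_left_mono ennreal_leI mult_right_mono D)
      have "(1 - e) * hfun \<beta> t a = (th * (t + a')) powr \<beta>"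
        using e par th a' t n0 c1 by (simp add: hfun_def th_def a'_def powr_mult powr_powr)
      also have "th * (t + a') \<le> t - c1"
      proof -
        have "(1 - th) * (n0 + c1) \<le> (1 - th) * t" using t th by (intro mult_left_mono) auto
        moreover have "(1 - th) * n0 = th * a' + c1" using th by (simp add: n0_def)
        moreover have "(1 - th) * c1 \<ge> 0" using th c1 by simp
        ultimately show ?thesis by (simp add: algebra_simps)
      qed
      then have "(th * (t + a')) powr \<beta> \<le> (t - c1 + (V x + V y) powr (1 / \<beta>)) powr \<beta>"
        using th t n0 c1 a' par by (intro powr_mono2) (auto intro: order_trans)
      finally show "(1 - e) * hfun \<beta> t a \<le> hfun \<beta> (t - c1) (V x + V y)"
        by (simp add: hfun_def)
    qed
    finally show ?thesis .
  next
    case False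
    define v where "v = V x + V y"
    have v: "v \<ge> R" "v \<ge> 1" using False R by (auto simp: v_def)
    have "v powr k \<le> v" using v k powr_mono[of k 1 v] by simp
    moreover have "c' * v powr k \<le> 1 / 2 * v powr k" using c' by (intro mult_right_mono) auto
    ultimately have pos: "v - c' * v powr k > 0" using v by linarith
    have "Q ?V x + Q ?V y + ennreal (c * v powr k) \<le> ennreal (v + 2 * b)"
      using sum_drift[OF xy] by (simp add: v_def)
    also have "\<dots> \<le> ennreal ((v - c' * v powr k) + c * v powr k)"
    proof (rule ennreal_leI)
      have "c' * v powr k \<le> c / 2 * v powr k" using c' by (intro mult_right_mono) auto
      then show "v + 2 * b \<le> (v - c' * v powr k) + c * v powr k" using Rb[OF v(1)] by simp
    qed
    also have "\<dots> = ennreal (v - c' * v powr k) + ennreal (c * v powr k)"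
      using pos par by (intro ennreal_plus) auto
    finally have s: "Q ?V x + Q ?V y \<le> ennreal (v - c' * v powr k)"
      by (subst (asm) (1 2) add.commute) (simp add: ennreal_add_left_cancel_le)
    have "Q g x \<le> Q g y + ennreal (hfun \<beta> t (v - c' * v powr k) * D)"
      by (rule hfun_osc_step_far[OF g _ xy]) (use par t n0 c1 D pos V osc s in auto)
    also have "\<dots> \<le> Q g y + ennreal (hfun \<beta> (t - c1) v * D)"
      using hfun_decrease[of \<beta> c' t v] par t n0 c1 v c'
      by (intro add_left_mono ennreal_leI mult_right_mono D) (auto simp: k_def c1_def)
    finally show ?thesis by (simp add: v_def)
  qed
  define C where "C = ((n0 + 1) / min n0 c1) powr \<beta>"
  have C: "C > 0" using n0 c1 by (simp add: C_def)
  have main: "(Q ^^ n) f x \<le> (Q ^^ n) f y + ennreal (C * (V x + V y) / (real n + 1) powr \<beta>)"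
    if f [measurable]: "f \<in> borel_measurable M" and f1: "\<And>x. x \<in> space M \<Longrightarrow> f x \<le> 1"
      and xy: "x \<in> space M" "y \<in> space M" for f n x y
  proof -
    \<comment> \<open>At \<open>j = 0\<close> only \<open>f x \<le> 1\<close> is known, and this
      normalization makes the claimed bound at least 1. In \<open>n\<close> steps the argument
      \<open>t\<close> comes down from \<open>n0 + c1 * n\<close> to \<open>n0\<close> while
      \<open>D\<close> is kept, which leaves a bound of order
      \<open>n powr -\<beta>\<close>.\<close>
    define D where "D = 1 / (n0 + c1 * real n) powr \<beta>"
    have npos: "n0 + c1 * real n > 0" using n0 c1 by (intro add_pos_nonneg) auto
    have D: "D \<ge> 0" using npos by (simp add: D_def)
    have ind: "(Q ^^ j) f x \<le> (Q ^^ j) f y + ennreal (hfun \<beta> (n0 + c1 * (real n - real j)) (V x + V y) * D)"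
      if "j \<le> n" "x \<in> space M" "y \<in> space M" for j x y
      using that
    proof (induction j arbitrary: x y)
      case 0
      have "(n0 + c1 * real n) powr \<beta> \<le> hfun \<beta> (n0 + c1 * real n) (V x + V y)"
        unfolding hfun_def using npos par by (intro powr_mono2) auto
      then have "1 \<le> hfun \<beta> (n0 + c1 * real n) (V x + V y) * D"
        using npos by (simp add: D_def)
      then have "1 \<le> ennreal (hfun \<beta> (n0 + c1 * real n) (V x + V y) * D)"
        by (metis ennreal_1 ennreal_leI)
      then have "f x \<le> ennreal (hfun \<beta> (n0 + c1 * real n) (V x + V y) * D)"
        using f1[OF 0(2)] by (rule order_trans[rotated])
      also have "\<dots> \<le> f y + \<dots>" by simp
      finally show ?case by simp
    next
      case (Suc j)
      interpret P: markov_operator M "Q ^^ j" by (rule markov_operator_power)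
      have "Q ((Q ^^ j) f) x \<le> Q ((Q ^^ j) f) y
          + ennreal (hfun \<beta> (n0 + c1 * (real n - real j) - c1) (V x + V y) * D)"
      proof (rule step)
        show "n0 + c1 \<le> n0 + c1 * (real n - real j)" using Suc.prems c1 by simp
        show "(Q ^^ j) f x \<le> 1" if "x \<in> space M" for x
          using P.op_le_one f f1 that by blast
      qed (use Suc D in auto)
      moreover have "n0 + c1 * (real n - real j) - c1 = n0 + c1 * (real n - real (Suc j))"
        by (simp add: algebra_simps)
      ultimately show ?case by simp
    qed
    have vv: "V x + V y \<ge> 1" using V xy by (smt (verit))
    have "(Q ^^ n) f x \<le> (Q ^^ n) f y + ennreal (hfun \<beta> n0 (V x + V y) * D)"
      using ind[of n x y] xy by simp
    also have "\<dots> \<le> (Q ^^ n) f y + ennreal (C * (V x + V y) / (real n + 1) powr \<beta>)"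
    proof (intro add_left_mono ennreal_leI)
      define u where "u = (V x + V y) powr (1 / \<beta>)"
      have u: "u \<ge> 1" using vv par by (auto simp: u_def ge_one_powr_ge_zero)
      have ub: "u powr \<beta> = V x + V y" using vv par by (simp add: u_def powr_powr)
      have "n0 + u \<le> (n0 + 1) * u" using u n0 by (simp add: algebra_simps)
      then have "hfun \<beta> n0 (V x + V y) \<le> ((n0 + 1) * u) powr \<beta>"
        unfolding hfun_def u_def[symmetric] using n0 u par by (intro powr_mono2) auto
      then have 1: "hfun \<beta> n0 (V x + V y) \<le> (n0 + 1) powr \<beta> * (V x + V y)"
        using n0 u ub by (simp add: powr_mult)
      have "min n0 c1 * (real n + 1) \<le> n0 + c1 * real n"
      proof -
        have "min n0 c1 * real n \<le> c1 * real n" by (intro mult_right_mono) auto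
        then show ?thesis by (simp add: algebra_simps)
      qed
      then have "(min n0 c1 * (real n + 1)) powr \<beta> \<le> (n0 + c1 * real n) powr \<beta>"
        using n0 c1 par by (intro powr_mono2) auto
      then have "D \<le> 1 / (min n0 c1 * (real n + 1)) powr \<beta>"
        unfolding D_def using n0 c1 npos by (intro divide_left_mono) auto
      then have "hfun \<beta> n0 (V x + V y) * D
          \<le> ((n0 + 1) powr \<beta> * (V x + V y)) * (1 / (min n0 c1 * (real n + 1)) powr \<beta>)"
        using 1 D vv by (intro mult_mono) auto
      also have "\<dots> = C * (V x + V y) / (real n + 1) powr \<beta>"
        using n0 c1 by (simp add: C_def powr_divide powr_mult)
      finally show "hfun \<beta> n0 (V x + V y) * D \<le> C * (V x + V y) / (real n + 1) powr \<beta>" .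
    qed
    finally show ?thesis .
  qed
  show ?thesis using C main by blast
qed

text \<open>Division of \<open>n\<close> by \<open>Suc m\<close>: the remaining steps are absorbed
  into the test function, since \<open>(Q ^^ j) f\<close> is again at most 1. The price is the
  factor \<open>real (Suc m) powr \<beta>\<close>.\<close>

theorem polynomial_contraction_of_power:
  fixes V :: "'a \<Rightarrow> real"
  assumes [measurable]: "V \<in> borel_measurable M"
    and par: "\<beta> > 1" "c > 0" "b \<ge> 0" and V: "\<And>x. x \<in> space M \<Longrightarrow> V x \<ge> 1"
    and drift: "\<And>x. x \<in> space M \<Longrightarrow>
      Q (\<lambda>z. ennreal (V z)) x + ennreal (c * V x powr (1 - 1 / \<beta>)) \<le> ennreal (V x + b)"
    and minor: "\<And>R. \<exists>e T. 0 < e \<and> e < 1 \<and> markov_operator M T \<and>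
      (\<forall>f\<in>borel_measurable M. \<forall>x\<in>space M. \<forall>y\<in>space M. T f x = T f y) \<and>
      (\<forall>f\<in>borel_measurable M. \<forall>x\<in>space M. V x \<le> R \<longrightarrow> ennreal e * T f x \<le> (Q ^^ Suc m) f x)"
  shows "\<exists>C>0. \<forall>f\<in>borel_measurable M. (\<forall>x\<in>space M. f x \<le> 1) \<longrightarrow>
      (\<forall>n. \<forall>x\<in>space M. \<forall>y\<in>space M.
        (Q ^^ n) f x \<le> (Q ^^ n) f y + ennreal (C * (V x + V y) / (real n + 1) powr \<beta>))"
proof -
  interpret P: markov_operator M "Q ^^ Suc m" by (rule markov_operator_power)
  have V0: "\<And>x. x \<in> space M \<Longrightarrow> V x \<ge> 0" using V by (meson order_trans zero_le_one)
  have "\<exists>C>0. \<forall>f\<in>borel_measurable M. (\<forall>x\<in>space M. f x \<le> 1) \<longrightarrow>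
      (\<forall>n. \<forall>x\<in>space M. \<forall>y\<in>space M.
        ((Q ^^ Suc m) ^^ n) f x \<le> ((Q ^^ Suc m) ^^ n) f y + ennreal (C * (V x + V y) / (real n + 1) powr \<beta>))"
  proof (rule P.polynomial_contraction[where c = c and b = "real (Suc m) * b"])
    show "(Q ^^ Suc m) (\<lambda>z. ennreal (V z)) x + ennreal (c * V x powr (1 - 1 / \<beta>))
        \<le> ennreal (V x + real (Suc m) * b)" if "x \<in> space M" for x
      by (rule op_drift_power) (use par V0 drift that in auto)
    show "V x \<ge> 1" if "x \<in> space M" for x using V[OF that] .
    show "V \<in> borel_measurable M" by simp
    show "\<beta> > 1" "c > 0" "real (Suc m) * b \<ge> 0" using par by auto
  qed (rule minor)
  then obtain C where C: "C > 0" and le: "\<And>f n x y. \<lbrakk>f \<in> borel_measurable M; \<And>x. x \<in> space M \<Longrightarrow> f x \<le> 1;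
      x \<in> space M; y \<in> space M\<rbrakk> \<Longrightarrow> ((Q ^^ Suc m) ^^ n) f x
         \<le> ((Q ^^ Suc m) ^^ n) f y + ennreal (C * (V x + V y) / (real n + 1) powr \<beta>)"
    by blast
  have "(Q ^^ n) f x \<le> (Q ^^ n) f y + ennreal (C * real (Suc m) powr \<beta> * (V x + V y) / (real n + 1) powr \<beta>)"
    if f [measurable]: "f \<in> borel_measurable M" and f1: "\<And>x. x \<in> space M \<Longrightarrow> f x \<le> 1"
      and xy: "x \<in> space M" "y \<in> space M" for f n x y
  proof -
    define j where "j = n mod Suc m"
    define k where "k = n div Suc m"
    interpret J: markov_operator M "Q ^^ j" by (rule markov_operator_power)
    have n: "n = Suc m * k + j"
      unfolding j_def k_def by (rule mult_div_mod_eq[symmetric])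
    have eq: "(Q ^^ n) f = ((Q ^^ Suc m) ^^ k) ((Q ^^ j) f)"
      unfolding n funpow_add funpow_mult by simp
    have "(Q ^^ n) f x \<le> (Q ^^ n) f y + ennreal (C * (V x + V y) / (real k + 1) powr \<beta>)"
      unfolding eq by (rule le) (use xy f1 J.op_le_one in auto)
    also have "\<dots> \<le> (Q ^^ n) f y + ennreal (C * real (Suc m) powr \<beta> * (V x + V y) / (real n + 1) powr \<beta>)"
    proof (intro add_left_mono ennreal_leI)
      have "j < Suc m" by (simp add: j_def)
      then have "n + 1 \<le> Suc m * (k + 1)" unfolding n by simp
      then have "real n + 1 \<le> real (Suc m) * (real k + 1)"
        by (metis of_nat_1 of_nat_add of_nat_le_iff of_nat_mult)
      then have "(real n + 1) powr \<beta> \<le> (real (Suc m) * (real k + 1)) powr \<beta>"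
        using par by (intro powr_mono2) auto
      also have "\<dots> = real (Suc m) powr \<beta> * (real k + 1) powr \<beta>" by (simp add: powr_mult)
      finally have "1 / (real k + 1) powr \<beta> \<le> real (Suc m) powr \<beta> / (real n + 1) powr \<beta>"
        by (simp add: field_simps add_pos_nonneg)
      then have "C * (V x + V y) * (1 / (real k + 1) powr \<beta>)
          \<le> C * (V x + V y) * (real (Suc m) powr \<beta> / (real n + 1) powr \<beta>)"
        using C V0 xy by (intro mult_left_mono) auto
      then show "C * (V x + V y) / (real k + 1) powr \<beta>
          \<le> C * real (Suc m) powr \<beta> * (V x + V y) / (real n + 1) powr \<beta>"
        by (simp add: mult_ac)
    qed
    finally show ?thesis .
  qed
  moreover have "C * real (Suc m) powr \<beta> > 0" using C by simp
  ultimately show ?thesis by blast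
qed

end

subsection \<open>Uniform and exponential variables\<close>

text \<open>The endpoints are removed so that an exchange keeps both energies strictly positive, as
  membership in the state space demands.\<close>

definition unif01 :: "real measure" where
  "unif01 = restrict_space lborel {0<..<1}"

definition expo :: "real \<Rightarrow> real measure" where
  "expo T = density (restrict_space lborel {0..}) (\<lambda>x. ennreal (exp (- x / T) / T))"

lemma sets_unif01 [measurable_cong]: "sets unif01 = sets (restrict_space borel {0<..<1})"
  unfolding unif01_def by (rule sets_restrict_space_cong) simp

lemma space_unif01: "space unif01 = {0<..<1}"
  by (simp add: unif01_def space_restrict_space)

lemma sets_expo [measurable_cong]: "sets (expo T) = sets (restrict_space borel {0..})"
  unfolding expo_def sets_density by (rule sets_restrict_space_cong) simp

lemma space_expo: "space (expo T) = {0..}"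
  by (simp add: expo_def space_restrict_space)

lemma measurable_unif01_id [measurable]: "(\<lambda>p. p) \<in> borel_measurable unif01"
  unfolding unif01_def by (intro measurable_restrict_space1) simp

lemma measurable_expo_id [measurable]: "(\<lambda>p. p) \<in> borel_measurable (expo T)"
  unfolding expo_def by (simp add: measurable_restrict_space1)

lemma nn_integral_unif01:
  "(\<integral>\<^sup>+p. f p \<partial>unif01) = (\<integral>\<^sup>+p. indicator {0<..<1} p * f p \<partial>lborel)"
  unfolding unif01_def by (subst nn_integral_restrict_space) (auto simp: mult.commute)

lemma nn_integral_expo:
  assumes [measurable]: "f \<in> borel_measurable (expo T)"
  shows "(\<integral>\<^sup>+x. f x \<partial>expo T) = (\<integral>\<^sup>+x. indicator {0..} x * ennreal (exp (- x / T) / T) * f x \<partial>lborel)"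
proof -
  have [measurable]: "f \<in> borel_measurable (restrict_space lborel {0..})"
    using assms by (simp add: expo_def)
  have [measurable]: "(\<lambda>x. ennreal (exp (- x / T) / T)) \<in> borel_measurable (restrict_space lborel {0..})"
    by (intro measurable_restrict_space1) simp
  show ?thesis unfolding expo_def
    by (subst nn_integral_density)
       (auto simp: nn_integral_restrict_space mult_ac intro!: nn_integral_cong)
qed

lemma prob_space_unif01: "prob_space unif01"
  by standard (simp add: unif01_def emeasure_restrict_space space_restrict_space)

lemma expo_eq_exponential_density:
  assumes "T > 0"
  shows "indicator {0..} x * ennreal (exp (- x / T) / T) = ennreal (exponential_density (1 / T) x)"
  using assms by (auto simp: exponential_density_def indicator_def)

lemma prob_space_expo:
  assumes "T > 0"
  shows "prob_space (expo T)"
proof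
  have "emeasure (expo T) (space (expo T)) = (\<integral>\<^sup>+x. 1 \<partial>expo T)" by simp
  also have "\<dots> = (\<integral>\<^sup>+x. ennreal (exponential_density (1 / T) x) \<partial>lborel)"
    by (subst nn_integral_expo) (simp_all only: expo_eq_exponential_density[OF assms] mult_1_right
        borel_measurable_const)
  also have "\<dots> = 1"
    using nn_integral_erlang_ith_moment[of "1 / T" 0 0] assms by simp
  finally show "emeasure (expo T) (space (expo T)) = 1" .
qed

lemma nn_integral_expo_id:
  assumes "T > 0"
  shows "(\<integral>\<^sup>+x. ennreal x \<partial>expo T) = ennreal T"
proof -
  have "(\<integral>\<^sup>+x. ennreal x \<partial>expo T) = (\<integral>\<^sup>+x. ennreal (exponential_density (1 / T) x * x ^ 1) \<partial>lborel)"
    using assms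
    by (subst nn_integral_expo)
       (auto simp: indicator_def exponential_density_def ennreal_mult[symmetric]
          intro!: nn_integral_cong)
  also have "\<dots> = ennreal T"
    using assms by (subst nn_integral_erlang_ith_moment) auto
  finally show ?thesis .
qed

lemma nn_integral_powr_unit:
  assumes "\<rho> < 1"
  shows "(\<integral>\<^sup>+p. indicator {0<..<1} p * ennreal (p powr - \<rho>) \<partial>lborel) = ennreal (1 / (1 - \<rho>))"
proof -
  have "((\<lambda>x. x powr - \<rho>) has_integral (1 powr (- \<rho> + 1) / (- \<rho> + 1))) {0..1}"
    by (rule has_integral_powr_from_0) (use assms in auto)
  then have "((\<lambda>x. if x \<in> {0..1} then x powr - \<rho> else 0) has_integral (1 / (1 - \<rho>))) UNIV"
    by (subst has_integral_restrict_UNIV) simp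
  then have "((\<lambda>x. indicator {0..1} x * x powr - \<rho>) has_integral (1 / (1 - \<rho>))) UNIV"
    by (rule has_integral_eq[rotated]) (auto simp: indicator_def)
  then have "(\<integral>\<^sup>+p. ennreal (indicator {0..1} p * p powr - \<rho>) \<partial>lborel) = ennreal (1 / (1 - \<rho>))"
    by (intro nn_integral_has_integral_lborel) auto
  moreover have "(\<integral>\<^sup>+p. ennreal (indicator {0..1} p * p powr - \<rho>) \<partial>lborel)
      = (\<integral>\<^sup>+p. indicator {0<..<1} p * ennreal (p powr - \<rho>) \<partial>lborel)"
    by (intro nn_integral_cong_AE, rule AE_mp[OF AE_lborel_singleton[of 1]],
        intro AE_I2) (auto simp: indicator_def)
  ultimately show ?thesis by simp
qed

lemma nn_integral_unif01_powr:
  "\<rho> < 1 \<Longrightarrow> (\<integral>\<^sup>+p. ennreal (p powr - \<rho>) \<partial>unif01) = ennreal (1 / (1 - \<rho>))"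
  by (simp add: nn_integral_unif01 nn_integral_powr_unit)

lemma nn_integral_unif01_id: "(\<integral>\<^sup>+p. ennreal p \<partial>unif01) = ennreal (1 / 2)"
proof -
  have "(\<integral>\<^sup>+p. ennreal p \<partial>unif01) = (\<integral>\<^sup>+p. ennreal (p powr - (-1)) \<partial>unif01)"
    by (intro nn_integral_cong) (auto simp: space_unif01)
  then show ?thesis using nn_integral_unif01_powr[of "-1"] by simp
qed

lemma nn_integral_unif01_reflect:
  assumes "f \<in> borel_measurable unif01"
  shows "(\<integral>\<^sup>+p. f (1 - p) \<partial>unif01) = (\<integral>\<^sup>+p. f p \<partial>unif01)"
proof -
  have [measurable]: "(\<lambda>p. f p * indicator {0<..<1} p) \<in> borel_measurable borel"
    using assms unfolding unif01_def
    by (subst (asm) borel_measurable_restrict_space_iff_ennreal) auto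
  have "(\<integral>\<^sup>+p. f p \<partial>unif01) = (\<integral>\<^sup>+p. f p * indicator {0<..<1} p \<partial>lborel)"
    by (simp add: nn_integral_unif01 mult.commute)
  also have "\<dots> = (\<integral>\<^sup>+p. f (1 + -1 * p) * indicator {0<..<1} (1 + -1 * p) \<partial>lborel)"
    by (subst nn_integral_real_affine[where c = "-1" and t = 1]) auto
  also have "\<dots> = (\<integral>\<^sup>+p. f (1 - p) \<partial>unif01)"
    unfolding nn_integral_unif01 by (intro nn_integral_cong) (auto simp: indicator_def)
  finally show ?thesis ..
qed

text \<open>The common shape of the one-step estimates as functions of the fraction
  \<open>p\<close>: a constant, a singular term from low energies and a linear term from high
  energies.\<close>

lemma nn_integral_unif01_affine:
  assumes "\<rho> < 1" "c \<ge> 0" "d \<ge> 0" "m \<ge> 0"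
  shows "(\<integral>\<^sup>+p. ennreal (d + c * p powr - \<rho> + m * p) \<partial>unif01) = ennreal (d + c / (1 - \<rho>) + m / 2)"
proof -
  interpret U: prob_space unif01 by (rule prob_space_unif01)
  have "(\<integral>\<^sup>+p. ennreal (d + c * p powr - \<rho> + m * p) \<partial>unif01)
    = (\<integral>\<^sup>+p. ennreal d + ennreal c * ennreal (p powr - \<rho>) + ennreal m * ennreal p \<partial>unif01)"
    using assms by (intro nn_integral_cong) (auto simp: space_unif01 ennreal_plus ennreal_mult)
  also have "\<dots> = ennreal d + ennreal c * ennreal (1 / (1 - \<rho>)) + ennreal m * ennreal (1 / 2)"
    using assms(1) by (simp add: nn_integral_add nn_integral_cmult nn_integral_unif01_powr
        nn_integral_unif01_id U.emeasure_space_1 del: ennreal_half)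
  also have "\<dots> = ennreal (d + c / (1 - \<rho>) + m / 2)"
    using assms by (simp add: ennreal_plus ennreal_mult[symmetric] del: ennreal_half)
  finally show ?thesis .
qed

lemma nn_integral_unif01_affine_reflect:
  assumes "\<rho> < 1" "c \<ge> 0" "d \<ge> 0" "m \<ge> 0"
  shows "(\<integral>\<^sup>+p. ennreal (d + c * (1 - p) powr - \<rho> + m * (1 - p)) \<partial>unif01)
    = ennreal (d + c / (1 - \<rho>) + m / 2)"
  using nn_integral_unif01_reflect[of "\<lambda>p. ennreal (d + c * p powr - \<rho> + m * p)"]
    nn_integral_unif01_affine[OF assms] by simp

text \<open>On the unit interval the density is at most \<open>1 / T\<close> and the power is
  integrable; beyond 1 the integrand is at most 1.\<close>

lemma nn_integral_expo_powr_finite: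
  assumes "T > 0" "0 \<le> \<rho>" "\<rho> < 1"
  shows "(\<integral>\<^sup>+x. ennreal (x powr - \<rho>) \<partial>expo T) \<le> ennreal (1 / (T * (1 - \<rho>)) + 1)"
proof -
  interpret X: prob_space "expo T" using assms by (intro prob_space_expo)
  have "(\<integral>\<^sup>+x. ennreal (x powr - \<rho>) \<partial>expo T)
      \<le> (\<integral>\<^sup>+x. indicator {0<..<1} x * ennreal (x powr - \<rho>) + 1 \<partial>expo T)"
  proof (intro nn_integral_mono)
    fix x assume "x \<in> space (expo T)"
    show "ennreal (x powr - \<rho>) \<le> indicator {0<..<1} x * ennreal (x powr - \<rho>) + 1"
    proof (cases "0 < x \<and> x < 1")
      case False
      have "x powr - \<rho> \<le> 1"
      proof (cases "x \<ge> 1")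
        case True
        then show ?thesis using assms powr_mono[of "-\<rho>" 0 x] by simp
      qed (use False \<open>x \<in> space (expo T)\<close> in \<open>auto simp: space_expo\<close>)
      then show ?thesis using False by (simp add: indicator_def)
    qed (simp add: indicator_def)
  qed
  also have "\<dots> = (\<integral>\<^sup>+x. indicator {0<..<1} x * ennreal (x powr - \<rho>) \<partial>expo T) + 1"
    by (subst nn_integral_add) (auto simp: X.emeasure_space_1)
  also have "(\<integral>\<^sup>+x. indicator {0<..<1} x * ennreal (x powr - \<rho>) \<partial>expo T)
     \<le> (\<integral>\<^sup>+x. ennreal (1 / T) * (indicator {0<..<1} x * ennreal (x powr - \<rho>)) \<partial>lborel)"
    using assms by (subst nn_integral_expo)
      (auto intro!: nn_integral_mono mult_right_mono ennreal_leI divide_right_mono simp: indicator_def)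
  also have "\<dots> = ennreal (1 / T) * ennreal (1 / (1 - \<rho>))"
    using assms by (subst nn_integral_cmult) (auto simp: nn_integral_powr_unit)
  also have "ennreal (1 / T) * ennreal (1 / (1 - \<rho>)) + 1 = ennreal (1 / (T * (1 - \<rho>)) + 1)"
    using assms by (subst ennreal_plus) (auto simp: ennreal_mult[symmetric])
  finally show ?thesis by (simp add: add_right_mono)
qed

subsection \<open>The jump chain as a Markov operator\<close>

text \<open>Exchanges, baths and the refreshing steps of the minorization are all of this form, so
  the axioms are verified once.\<close>

lemma markov_operator_random_map:
  fixes M :: "'a measure"
  assumes P: "prob_space P"
    and t [measurable]: "(\<lambda>z. t (fst z) (snd z)) \<in> measurable (M \<Otimes>\<^sub>M P) M"
  shows "markov_operator M (\<lambda>f x. \<integral>\<^sup>+w. f (t x w) \<partial>P)"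
proof -
  interpret P: prob_space P by fact
  have tx: "t x \<in> measurable P M" if "x \<in> space M" for x
    using measurable_compose[OF measurable_Pair1'[OF that] t] by simp
  show ?thesis
  proof
    fix f g :: "'a \<Rightarrow> ennreal" and x c
    assume f [measurable]: "f \<in> borel_measurable M"
    show "(\<lambda>x. \<integral>\<^sup>+w. f (t x w) \<partial>P) \<in> borel_measurable M"
      using P.borel_measurable_nn_integral_fst[OF measurable_compose[OF t f]] by simp
    assume x: "x \<in> space M"
    note [measurable] = tx[OF x]
    show "(\<integral>\<^sup>+w. c * f (t x w) \<partial>P) = c * (\<integral>\<^sup>+w. f (t x w) \<partial>P)"
      by (rule nn_integral_cmult) simp
    assume g [measurable]: "g \<in> borel_measurable M"
    show "(\<integral>\<^sup>+w. f (t x w) + g (t x w) \<partial>P) = (\<integral>\<^sup>+w. f (t x w) \<partial>P) + (\<integral>\<^sup>+w. g (t x w) \<partial>P)"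
      by (rule nn_integral_add) auto
    assume "\<And>y. y \<in> space M \<Longrightarrow> f y \<le> g y"
    then show "(\<integral>\<^sup>+w. f (t x w) \<partial>P) \<le> (\<integral>\<^sup>+w. g (t x w) \<partial>P)"
      using measurable_space[OF tx[OF x]] by (intro nn_integral_mono) auto
  qed (simp add: P.emeasure_space_1)
qed

lemma space_state_space: "space (state_space N) = PiE {..<N} (\<lambda>_. {0<..})"
  by (simp add: state_space_def space_PiM space_restrict_space)

lemma state_pos: "E \<in> space (state_space N) \<Longrightarrow> i < N \<Longrightarrow> E i > 0"
  by (auto simp: space_state_space PiE_iff)

lemma state_upd: "E \<in> space (state_space N) \<Longrightarrow> i < N \<Longrightarrow> z > 0 \<Longrightarrow> E(i := z) \<in> space (state_space N)"
  by (auto simp: space_state_space PiE_iff extensional_def)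

lemma measurable_site: "i < N \<Longrightarrow> (\<lambda>E. E i) \<in> borel_measurable (state_space N)"
  using measurable_component_singleton[of i "{..<N}" "\<lambda>_. restrict_space borel {0::real<..}"]
  unfolding state_space_def measurable_restrict_space2_iff by simp

lemma measurable_state_upd:
  assumes [measurable]: "f \<in> measurable P (state_space N)" "h \<in> borel_measurable P"
    and "i < N" "\<And>w. w \<in> space P \<Longrightarrow> h w > 0"
  shows "(\<lambda>w. (f w)(i := h w)) \<in> measurable P (state_space N)"
proof -
  have "h \<in> measurable P (restrict_space borel {0<..})"
    using assms by (intro measurable_restrict_space2) auto
  moreover have "{..<N} = {..<N} \<union> {i}" using assms by auto
  ultimately show ?thesis
    using assms(1) unfolding state_space_def by (intro measurable_fun_upd) auto
qed

definition exchange_op :: "nat \<Rightarrow> ((nat \<Rightarrow> real) \<Rightarrow> ennreal) \<Rightarrow> (nat \<Rightarrow> real) \<Rightarrow> ennreal" where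
  "exchange_op i f E =
    (\<integral>\<^sup>+p. f (E(i := p * (E i + E (Suc i)), Suc i := (1 - p) * (E i + E (Suc i)))) \<partial>unif01)"

definition bath_op :: "real \<Rightarrow> nat \<Rightarrow> ((nat \<Rightarrow> real) \<Rightarrow> ennreal) \<Rightarrow> (nat \<Rightarrow> real) \<Rightarrow> ennreal" where
  "bath_op T i f E = (\<integral>\<^sup>+p. \<integral>\<^sup>+x. f (E(i := p * (E i + x))) \<partial>expo T \<partial>unif01)"

lemma markov_operator_exchange_op:
  assumes "Suc i < N"
  shows "markov_operator (state_space N) (exchange_op i)"
  unfolding exchange_op_def[abs_def]
proof (rule markov_operator_random_map[OF prob_space_unif01])
  let ?M = "state_space N \<Otimes>\<^sub>M unif01"
  have [measurable]: "(\<lambda>z. fst z i) \<in> borel_measurable ?M" "(\<lambda>z. fst z (Suc i)) \<in> borel_measurable ?M"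
    using assms by (auto intro!: measurable_compose[OF measurable_fst measurable_site])
  have [measurable]: "snd \<in> borel_measurable ?M"
    by (rule measurable_compose[OF measurable_snd measurable_unif01_id])
  show "(\<lambda>z. (fst z)(i := snd z * (fst z i + fst z (Suc i)),
     Suc i := (1 - snd z) * (fst z i + fst z (Suc i)))) \<in> measurable ?M (state_space N)"
    using assms
    by (intro measurable_state_upd)
       (auto simp: space_pair_measure space_unif01 state_pos intro!: mult_pos_pos add_pos_pos)
qed

text \<open>By Tonelli's theorem the iterated integral is one integral over a product space, which
  makes the contact with a bath a random map.\<close>

lemma bath_op_pair:
  assumes "i < N" "T > 0" "f \<in> borel_measurable (state_space N)" "E \<in> space (state_space N)"
  shows "bath_op T i f E = (\<integral>\<^sup>+w. f (E(i := fst w * (E i + snd w))) \<partial>(unif01 \<Otimes>\<^sub>M expo T))"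
proof -
  interpret X: prob_space "expo T" using assms by (intro prob_space_expo)
  let ?M = "unif01 \<Otimes>\<^sub>M expo T"
  have [measurable]: "fst \<in> borel_measurable ?M" "snd \<in> borel_measurable ?M"
    by (rule measurable_compose[OF measurable_fst measurable_unif01_id]
          measurable_compose[OF measurable_snd measurable_expo_id])+
  have [measurable]: "(\<lambda>w. E(i := fst w * (E i + snd w))) \<in> measurable ?M (state_space N)"
    using assms by (intro measurable_state_upd measurable_const)
      (auto simp: space_pair_measure space_unif01 space_expo state_pos intro!: mult_pos_pos add_pos_nonneg)
  show ?thesis
    unfolding bath_op_def
    by (subst X.nn_integral_fst[symmetric]) (use assms(3) in auto)
qed

lemma markov_operator_cong:
  assumes "markov_operator M Q"
    and "\<And>f x. f \<in> borel_measurable M \<Longrightarrow> x \<in> space M \<Longrightarrow> P f x = Q f x"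
  shows "markov_operator M P"
proof -
  interpret Q: markov_operator M Q by fact
  show ?thesis
  proof
    fix f g :: "'a \<Rightarrow> ennreal" and x c
    assume f [measurable]: "f \<in> borel_measurable M"
    show "P f \<in> borel_measurable M"
      using Q.measurable_op[OF f] assms(2)[OF f] by (subst measurable_cong) auto
    assume x: "x \<in> space M"
    show "P (\<lambda>y. c * f y) x = c * P f x" using assms(2) x Q.op_cmult by simp
    assume [measurable]: "g \<in> borel_measurable M"
    show "P (\<lambda>y. f y + g y) x = P f x + P g x" using assms(2) x Q.op_add by simp
    assume "\<And>y. y \<in> space M \<Longrightarrow> f y \<le> g y"
    then show "P f x \<le> P g x" using assms(2) x Q.op_mono by simp
  qed (use assms(2) Q.op_one in auto)
qed

lemma markov_operator_bath_op:
  assumes "i < N" "T > 0"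
  shows "markov_operator (state_space N) (bath_op T i)"
proof (rule markov_operator_cong[OF markov_operator_random_map bath_op_pair[OF assms]])
  show "prob_space (unif01 \<Otimes>\<^sub>M expo T)"
    using assms by (intro prob_space_pair prob_space_unif01 prob_space_expo)
  let ?M = "state_space N \<Otimes>\<^sub>M (unif01 \<Otimes>\<^sub>M expo T)"
  have [measurable]: "(\<lambda>z. fst z i) \<in> borel_measurable ?M"
    using assms by (auto intro!: measurable_compose[OF measurable_fst measurable_site])
  have [measurable]: "(\<lambda>z. fst (snd z)) \<in> borel_measurable ?M" "(\<lambda>z. snd (snd z)) \<in> borel_measurable ?M"
    by (rule measurable_compose[OF measurable_snd measurable_compose[OF measurable_fst measurable_unif01_id]]
          measurable_compose[OF measurable_snd measurable_compose[OF measurable_snd measurable_expo_id]])+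
  show "(\<lambda>z. (fst z)(i := fst (snd z) * (fst z i + snd (snd z)))) \<in> measurable ?M (state_space N)"
    using assms by (intro measurable_state_upd)
      (auto simp: space_pair_measure space_unif01 space_expo state_pos intro!: mult_pos_pos add_pos_nonneg)
qed

lemma exchange_op_le_affine:
  assumes E: "E \<in> space (state_space N)" "Suc i < N"
    and par: "\<rho> < 1" "c \<ge> 0" "d \<ge> 0" "m \<ge> 0"
    and h: "\<And>p. 0 < p \<Longrightarrow> p < 1 \<Longrightarrow>
      h (E(i := p * (E i + E (Suc i)), Suc i := (1 - p) * (E i + E (Suc i)))) \<le> d + c * p powr - \<rho> + m * p"
  shows "exchange_op i (\<lambda>E. ennreal (h E)) E \<le> ennreal (d + c / (1 - \<rho>) + m / 2)"
proof -
  have "exchange_op i (\<lambda>E. ennreal (h E)) E \<le> (\<integral>\<^sup>+p. ennreal (d + c * p powr - \<rho> + m * p) \<partial>unif01)"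
    unfolding exchange_op_def using h by (intro nn_integral_mono ennreal_leI) (auto simp: space_unif01)
  then show ?thesis using nn_integral_unif01_affine[OF par] by simp
qed

text \<open>The version for functions that are estimated through the energy of the right site of the
  edge, which here receives the fraction \<open>p\<close>.\<close>

lemma exchange_op_le_affine_reflect:
  assumes E: "E \<in> space (state_space N)" "Suc i < N"
    and par: "\<rho> < 1" "c \<ge> 0" "d \<ge> 0" "m \<ge> 0"
    and h: "\<And>p. 0 < p \<Longrightarrow> p < 1 \<Longrightarrow>
      h (E(i := (1 - p) * (E i + E (Suc i)), Suc i := p * (E i + E (Suc i)))) \<le> d + c * p powr - \<rho> + m * p"
  shows "exchange_op i (\<lambda>E. ennreal (h E)) E \<le> ennreal (d + c / (1 - \<rho>) + m / 2)"
proof -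
  have "exchange_op i (\<lambda>E. ennreal (h E)) E
      \<le> (\<integral>\<^sup>+p. ennreal (d + c * (1 - p) powr - \<rho> + m * (1 - p)) \<partial>unif01)"
    unfolding exchange_op_def
  proof (intro nn_integral_mono ennreal_leI)
    fix p assume "p \<in> space unif01"
    then show "h (E(i := p * (E i + E (Suc i)), Suc i := (1 - p) * (E i + E (Suc i))))
        \<le> d + c * (1 - p) powr - \<rho> + m * (1 - p)"
      using h[of "1 - p"] by (auto simp: space_unif01)
  qed
  then show ?thesis using nn_integral_unif01_affine_reflect[OF par] by simp
qed

text \<open>There are two linear terms: \<open>l * x\<close> for estimates that give up the factor
  \<open>p\<close> on the bath energy, and \<open>m * (p * (E i + x))\<close> for those that are
  linear in the new energy of the site.\<close>

lemma bath_op_le_affine: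
  assumes E: "E i > 0" and T: "T > 0"
    and par: "\<rho> < 1" "c \<ge> 0" "d \<ge> 0" "m \<ge> 0" "l \<ge> 0"
    and h: "\<And>p x. \<lbrakk>0 < p; p < 1; x \<ge> 0\<rbrakk> \<Longrightarrow>
      h (E(i := p * (E i + x))) \<le> d + c * p powr - \<rho> + l * x + m * (p * (E i + x))"
  shows "bath_op T i (\<lambda>E. ennreal (h E)) E \<le> ennreal (d + c / (1 - \<rho>) + l * T + m * (E i + T) / 2)"
proof -
  interpret X: prob_space "expo T" using T by (rule prob_space_expo)
  have "bath_op T i (\<lambda>E. ennreal (h E)) E
     \<le> (\<integral>\<^sup>+p. ennreal ((d + l * T) + c * p powr - \<rho> + (m * (E i + T)) * p) \<partial>unif01)"
    unfolding bath_op_def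
  proof (intro nn_integral_mono)
    fix p assume "p \<in> space unif01"
    then have p: "0 < p" "p < 1" by (auto simp: space_unif01)
    have "(\<integral>\<^sup>+x. ennreal (h (E(i := p * (E i + x)))) \<partial>expo T)
       \<le> (\<integral>\<^sup>+x. ennreal (d + c * p powr - \<rho> + m * p * E i) + ennreal (l + m * p) * ennreal x \<partial>expo T)"
    proof (intro nn_integral_mono)
      fix x assume "x \<in> space (expo T)"
      then have x: "x \<ge> 0" by (simp add: space_expo)
      have "ennreal (h (E(i := p * (E i + x)))) \<le> ennreal ((d + c * p powr - \<rho> + m * p * E i) + (l + m * p) * x)"
        using h[OF p x] by (intro ennreal_leI) (simp add: algebra_simps)
      also have "\<dots> = ennreal (d + c * p powr - \<rho> + m * p * E i) + ennreal (l + m * p) * ennreal x"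
        using par p x E by (simp add: ennreal_mult[symmetric] ennreal_plus[symmetric] del: ennreal_plus)
      finally show "ennreal (h (E(i := p * (E i + x)))) \<le> \<dots>" .
    qed
    also have "\<dots> = ennreal (d + c * p powr - \<rho> + m * p * E i) + ennreal (l + m * p) * ennreal T"
      by (subst nn_integral_add)
         (auto simp: nn_integral_cmult X.emeasure_space_1 nn_integral_expo_id[OF T])
    also have "\<dots> = ennreal ((d + l * T) + c * p powr - \<rho> + (m * (E i + T)) * p)"
      using par p T E
      by (simp add: ennreal_mult[symmetric] ennreal_plus[symmetric] algebra_simps del: ennreal_plus)
    finally show "(\<integral>\<^sup>+x. ennreal (h (E(i := p * (E i + x)))) \<partial>expo T) \<le> \<dots>" .
  qed
  also have "\<dots> = ennreal (d + c / (1 - \<rho>) + l * T + m * (E i + T) / 2)"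
    using par T E by (subst nn_integral_unif01_affine) (auto simp: algebra_simps)
  finally show ?thesis .
qed

text \<open>The pointwise bound uses only the share \<open>p * x\<close> that comes from the bath,
  so the resulting bound does not depend on the state: contact with a bath repairs a low
  energy.\<close>

lemma bath_op_le_powr:
  assumes T: "T > 0" and par: "0 \<le> \<rho>" "\<rho> < 1"
    and h: "\<And>p x. \<lbrakk>0 < p; p < 1; x > 0\<rbrakk> \<Longrightarrow> h (E(i := p * (E i + x))) \<le> p powr - \<rho> * x powr - \<rho>"
  shows "bath_op T i (\<lambda>E. ennreal (h E)) E \<le> ennreal ((1 / (T * (1 - \<rho>)) + 1) / (1 - \<rho>))"
proof -
  define C where "C = 1 / (T * (1 - \<rho>)) + 1"
  have C: "C \<ge> 0" using T par by (simp add: C_def)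
  \<comment> \<open>The pointwise hypothesis is about \<open>x > 0\<close>; the exceptional value 0
    is a null set of the exponential law.\<close>
  have "AE x in lborel. x \<noteq> (0::real)" by (rule AE_lborel_singleton)
  then have ne: "AE x in expo T. x \<noteq> 0"
    unfolding expo_def
    by (subst AE_density) (auto simp: AE_restrict_space_iff intro!: measurable_restrict_space1)
  have "bath_op T i (\<lambda>E. ennreal (h E)) E \<le> (\<integral>\<^sup>+p. ennreal (0 + C * p powr - \<rho> + 0 * p) \<partial>unif01)"
    unfolding bath_op_def
  proof (intro nn_integral_mono)
    fix p assume "p \<in> space unif01"
    then have p: "0 < p" "p < 1" by (auto simp: space_unif01)
    have "(\<integral>\<^sup>+x. ennreal (h (E(i := p * (E i + x)))) \<partial>expo T)
       \<le> (\<integral>\<^sup>+x. ennreal (p powr - \<rho>) * ennreal (x powr - \<rho>) \<partial>expo T)"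
    proof (intro nn_integral_mono_AE, use ne AE_space in eventually_elim, goal_cases)
      case (1 x)
      then have "x > 0" by (simp add: space_expo)
      then show ?case using h[OF p, of x] by (simp add: ennreal_mult[symmetric] ennreal_leI)
    qed
    also have "\<dots> = ennreal (p powr - \<rho>) * (\<integral>\<^sup>+x. ennreal (x powr - \<rho>) \<partial>expo T)"
      by (rule nn_integral_cmult) simp
    also have "\<dots> \<le> ennreal (p powr - \<rho>) * ennreal C"
      unfolding C_def using T par by (intro mult_left_mono nn_integral_expo_powr_finite) auto
    also have "\<dots> = ennreal (0 + C * p powr - \<rho> + 0 * p)"
      using C by (simp add: ennreal_mult[symmetric] mult.commute)
    finally show "(\<integral>\<^sup>+x. ennreal (h (E(i := p * (E i + x)))) \<partial>expo T) \<le> \<dots>" .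
  qed
  also have "\<dots> = ennreal (C / (1 - \<rho>))"
    using par C by (subst nn_integral_unif01_affine) auto
  finally show ?thesis by (simp add: C_def)
qed


section \<open>Decomposition of the jump chain over edges, and the calculus of drifts\<close>

locale energy_exchange =
  fixes N :: nat and K TL TR :: real
  assumes N: "N \<ge> 1" and K: "K \<ge> 1" and TL: "TL > 0" and TR: "TR > 0"
begin

definition L :: real where "L = real (N + 1) * K"

abbreviation "S \<equiv> state_space N"
abbreviation "Q \<equiv> jump_step N K TL TR"

text \<open>Edges are numbered from 0 to \<open>N\<close>: an inner edge \<open>e\<close> joins the
  sites \<open>e - 1\<close> and \<open>e\<close>, and the baths sit at the edges 0 and
  \<open>N\<close>. With this numbering the boundary edges of the block of sites
  \<open>{a..<b}\<close> are exactly \<open>a\<close> and \<open>b\<close>.\<close>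

definition edge_op :: "nat \<Rightarrow> ((nat \<Rightarrow> real) \<Rightarrow> ennreal) \<Rightarrow> (nat \<Rightarrow> real) \<Rightarrow> ennreal" where
  "edge_op e = (if e = 0 then bath_op TL 0 else if e = N then bath_op TR (N - 1) else exchange_op (e - 1))"

definition edge_rate :: "nat \<Rightarrow> (nat \<Rightarrow> real) \<Rightarrow> real" where
  "edge_rate e E = (if e = 0 then rate K TL (E 0) else if e = N then rate K (E (N - 1)) TR
     else rate K (E (e - 1)) (E e))"

lemma L_pos: "L > 0"
  using K by (simp add: L_def)

lemma edge_rate_pos: "E \<in> space S \<Longrightarrow> e \<le> N \<Longrightarrow> edge_rate e E > 0"
  using N K TL TR state_pos[of E N] by (auto simp: edge_rate_def rate_def)

lemma edge_rate_le_K: "edge_rate e E \<le> K"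
  by (auto simp: edge_rate_def rate_def)

lemma sum_edges:
  fixes f :: "nat \<Rightarrow> 'b :: comm_monoid_add"
  shows "(\<Sum>e\<le>N. f e) = (\<Sum>i<N-1. f (Suc i)) + f 0 + f N"
proof -
  obtain n where n: "N = Suc n" using N by (cases N) auto
  have "(\<Sum>e\<le>N. f e) = (\<Sum>e<Suc n. f e) + f N"
    unfolding n by (simp add: lessThan_Suc_atMost[symmetric] del: sum.lessThan_Suc)
       (simp add: lessThan_Suc_atMost)
  also have "(\<Sum>e<Suc n. f e) = f 0 + (\<Sum>i<n. f (Suc i))" by (rule sum.lessThan_Suc_shift)
  finally show ?thesis by (simp add: n add_ac)
qed

lemma total_rate_eq: "total_rate N K TL TR E = (\<Sum>e\<le>N. edge_rate e E)"
proof -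
  have "(\<Sum>i<N-1. edge_rate (Suc i) E) = (\<Sum>i<N-1. rate K (E i) (E (Suc i)))"
    by (intro sum.cong) (auto simp: edge_rate_def)
  then show ?thesis
    unfolding sum_edges total_rate_def using N by (simp add: edge_rate_def)
qed

lemma sum_edge_rate_le: "(\<Sum>e\<le>N. edge_rate e E) \<le> L"
  using sum_bounded_above[of "{..N}" "\<lambda>e. edge_rate e E" K] edge_rate_le_K by (simp add: L_def)

lemma markov_operator_edge_op: "e \<le> N \<Longrightarrow> markov_operator S (edge_op e)"
  using N TL TR
  by (auto simp: edge_op_def intro!: markov_operator_bath_op markov_operator_exchange_op)

lemma Q_eq:
  assumes E: "E \<in> space S" and f: "f \<in> borel_measurable S"
  shows "Q f E = (\<Sum>e\<le>N. ennreal (edge_rate e E / L) * edge_op e f E)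
     + ennreal (1 - (\<Sum>e\<le>N. edge_rate e E) / L) * f E"
proof -
  have bath: "(\<integral>\<^sup>+ p. indicator {0<..<1} p * (\<integral>\<^sup>+ x. indicator {0..} x * ennreal (exp (- x / T) / T) *
                f (E(i := p * (E i + x))) \<partial>lborel) \<partial>lborel) = bath_op T i f E" if "T > 0" "i < N" for T i
    unfolding bath_op_def nn_integral_unif01
  proof (intro nn_integral_cong)
    fix p :: real
    show "indicator {0<..<1} p * (\<integral>\<^sup>+ x. indicator {0..} x * ennreal (exp (- x / T) / T) *
                f (E(i := p * (E i + x))) \<partial>lborel)
        = indicator {0<..<1} p * (\<integral>\<^sup>+ x. f (E(i := p * (E i + x))) \<partial>expo T)"
    proof (cases "p \<in> {0<..<1}")
      case True
      have "(\<lambda>x. E(i := p * (E i + x))) \<in> measurable (expo T) S"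
        using True E that
        by (intro measurable_state_upd) (auto simp: space_expo state_pos intro!: mult_pos_pos add_pos_nonneg)
      then have "(\<lambda>x. f (E(i := p * (E i + x)))) \<in> borel_measurable (expo T)"
        using f by (rule measurable_compose)
      then show ?thesis by (simp add: nn_integral_expo)
    qed simp
  qed
  have ex: "(\<Sum>i<N-1. ennreal (edge_rate (Suc i) E / L) * edge_op (Suc i) f E)
     = (\<Sum>i<N-1. ennreal (rate K (E i) (E (Suc i)) / L) *
         (\<integral>\<^sup>+ p. indicator {0<..<1} p *
             f (E(i := p * (E i + E (Suc i)), Suc i := (1 - p) * (E i + E (Suc i)))) \<partial>lborel))"
    by (intro sum.cong) (auto simp: edge_rate_def edge_op_def exchange_op_def nn_integral_unif01)
  show ?thesis
    unfolding jump_step_def Let_def L_def[symmetric] total_rate_eq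
    using bath[OF TL, of 0] bath[OF TR, of "N - 1"] ex N
    by (simp add: sum_edges edge_rate_def edge_op_def add_ac)
qed

lemma markov_operator_Q: "markov_operator S Q"
proof
  note r = edge_rate_pos less_imp_le[OF L_pos] sum_edge_rate_le
  have le1: "(\<Sum>e\<le>N. edge_rate e E) / L \<le> 1" for E
    using sum_edge_rate_le[of E] L_pos by simp
  fix f g :: "(nat \<Rightarrow> real) \<Rightarrow> ennreal" and E c
  assume f [measurable]: "f \<in> borel_measurable S"
  have mr: "(\<lambda>E. edge_rate e E) \<in> borel_measurable S" if "e \<le> N" for e
  proof -
    have [measurable]: "(\<lambda>E. E 0) \<in> borel_measurable S" "(\<lambda>E. E (N - Suc 0)) \<in> borel_measurable S"
      using N by (auto intro!: measurable_site)
    show ?thesis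
    proof (cases "e = 0 \<or> e = N")
      case False
      then have [measurable]: "(\<lambda>E. E (e - Suc 0)) \<in> borel_measurable S" "(\<lambda>E. E e) \<in> borel_measurable S"
        using that by (auto intro!: measurable_site)
      show ?thesis using False by (simp add: edge_rate_def rate_def)
    qed (use N in \<open>auto simp: edge_rate_def rate_def\<close>)
  qed
  have "(\<lambda>E. (\<Sum>e\<le>N. ennreal (edge_rate e E / L) * edge_op e f E)
     + ennreal (1 - (\<Sum>e\<le>N. edge_rate e E) / L) * f E) \<in> borel_measurable S"
    using mr markov_operator.measurable_op[OF markov_operator_edge_op f]
    by (intro borel_measurable_add borel_measurable_sum borel_measurable_times measurable_compose[OF _ measurable_ennreal]
        borel_measurable_diff borel_measurable_divide) auto
  then show "Q f \<in> borel_measurable S"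
    by (subst measurable_cong[OF Q_eq]) auto
  assume E: "E \<in> space S"
  show "Q (\<lambda>y. c * f y) E = c * Q f E"
    using E f
    by (simp add: Q_eq markov_operator.op_cmult[OF markov_operator_edge_op] sum_distrib_left distrib_left mult_ac)
  assume g [measurable]: "g \<in> borel_measurable S"
  show "Q (\<lambda>y. f y + g y) E = Q f E + Q g E"
    using E f g
    by (simp add: Q_eq markov_operator.op_add[OF markov_operator_edge_op] sum.distrib distrib_left add_ac)
  assume "\<And>y. y \<in> space S \<Longrightarrow> f y \<le> g y"
  then show "Q f E \<le> Q g E"
    using E f g
    by (auto simp: Q_eq intro!: add_mono sum_mono mult_left_mono markov_operator.op_mono[OF markov_operator_edge_op])
next
  fix E assume E: "E \<in> space S"
  have "Q (\<lambda>_. 1) E = (\<Sum>e\<le>N. ennreal (edge_rate e E / L)) + ennreal (1 - (\<Sum>e\<le>N. edge_rate e E) / L)"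
    using E by (simp add: Q_eq markov_operator.op_one[OF markov_operator_edge_op])
  also have "(\<Sum>e\<le>N. ennreal (edge_rate e E / L)) = ennreal (\<Sum>e\<le>N. edge_rate e E / L)"
    using edge_rate_pos[OF E] L_pos by (intro sum_ennreal) (auto intro: less_imp_le)
  also have "(\<Sum>e\<le>N. edge_rate e E / L) = (\<Sum>e\<le>N. edge_rate e E) / L"
    by (rule sum_divide_distrib[symmetric])
  also have "ennreal \<dots> + ennreal (1 - (\<Sum>e\<le>N. edge_rate e E) / L) = 1"
  proof (subst ennreal_plus[symmetric])
    show "0 \<le> (\<Sum>e\<le>N. edge_rate e E) / L"
      using edge_rate_pos[OF E] L_pos by (intro divide_nonneg_pos sum_nonneg less_imp_le) auto
  qed (use L_pos sum_edge_rate_le[of E] in auto)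
  finally show "Q (\<lambda>_. 1) E = 1" .
qed

sublocale Q: markov_operator S Q
  by (rule markov_operator_Q)

text \<open>\<open>drift_le h E d\<close>: the generator \<open>L (Q - 1)\<close> of the process, applied to \<open>h\<close>, is at most \<open>d\<close>
  at \<open>E\<close>.  The first conjunct rules out that \<open>ennreal\<close> truncates the right-hand side.\<close>
definition drift_le :: "((nat \<Rightarrow> real) \<Rightarrow> real) \<Rightarrow> (nat \<Rightarrow> real) \<Rightarrow> real \<Rightarrow> bool" where
  "drift_le h E d \<longleftrightarrow> 0 \<le> h E + d / L \<and> Q (\<lambda>E. ennreal (h E)) E \<le> ennreal (h E + d / L)"

lemma drift_le_mono: "drift_le h E d \<Longrightarrow> d \<le> d' \<Longrightarrow> drift_le h E d'"
proof -
  assume "drift_le h E d" "d \<le> d'"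
  moreover from this have "h E + d / L \<le> h E + d' / L"
    using L_pos by (simp add: divide_right_mono)
  ultimately show "drift_le h E d'"
    by (auto simp: drift_le_def intro: order_trans ennreal_leI)
qed

text \<open>The generator is a sum over edges, so it is enough to bound the mean value after a ring
  of each single edge. The requirement \<open>u e \<ge> 0\<close> prevents \<open>ennreal\<close>
  from truncating these bounds.\<close>

lemma drift_le_edges:
  assumes E: "E \<in> space S" and [measurable]: "h \<in> borel_measurable S" and h: "h E \<ge> 0"
    and u: "\<And>e. e \<le> N \<Longrightarrow> u e \<ge> 0 \<and> edge_op e (\<lambda>E. ennreal (h E)) E \<le> ennreal (u e)"
  shows "drift_le h E (\<Sum>e\<le>N. edge_rate e E * (u e - h E))"
proof -
  have r: "edge_rate e E / L \<ge> 0" if "e \<le> N" for e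
    using edge_rate_pos[OF E that] L_pos by simp
  have le1: "(\<Sum>e\<le>N. edge_rate e E) / L \<le> 1"
    using sum_edge_rate_le[of E] L_pos by simp
  have eq: "h E + (\<Sum>e\<le>N. edge_rate e E * (u e - h E)) / L
     = (\<Sum>e\<le>N. edge_rate e E / L * u e) + (1 - (\<Sum>e\<le>N. edge_rate e E) / L) * h E"
    by (simp add: sum_subtractf right_diff_distrib diff_divide_distrib sum_divide_distrib
        sum_distrib_right left_diff_distrib)
  have nn: "(\<Sum>e\<le>N. edge_rate e E / L * u e) \<ge> 0" "(1 - (\<Sum>e\<le>N. edge_rate e E) / L) * h E \<ge> 0"
    using r u le1 h by (auto intro!: sum_nonneg mult_nonneg_nonneg simp del: times_divide_eq_left)
  have "Q (\<lambda>E. ennreal (h E)) E \<le> (\<Sum>e\<le>N. ennreal (edge_rate e E / L) * ennreal (u e))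
     + ennreal (1 - (\<Sum>e\<le>N. edge_rate e E) / L) * ennreal (h E)"
    using u by (subst Q_eq[OF E]) (auto intro!: add_mono sum_mono mult_left_mono)
  also have "(\<Sum>e\<le>N. ennreal (edge_rate e E / L) * ennreal (u e)) = ennreal (\<Sum>e\<le>N. edge_rate e E / L * u e)"
    using r u by (subst sum_ennreal[symmetric]) (auto intro!: sum.cong simp: ennreal_mult simp del: times_divide_eq_left)
  also have "ennreal (1 - (\<Sum>e\<le>N. edge_rate e E) / L) * ennreal (h E)
      = ennreal ((1 - (\<Sum>e\<le>N. edge_rate e E) / L) * h E)"
    using le1 h by (intro ennreal_mult[symmetric]) auto
  finally show ?thesis
    unfolding drift_le_def eq using nn by (simp add: ennreal_plus[symmetric] del: ennreal_plus)
qed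

lemma drift_le_add:
  assumes E: "E \<in> space S" and [measurable]: "h \<in> borel_measurable S" "h' \<in> borel_measurable S"
    and nn: "\<And>E. E \<in> space S \<Longrightarrow> h E \<ge> 0" "\<And>E. E \<in> space S \<Longrightarrow> h' E \<ge> 0"
    and "drift_le h E d" "drift_le h' E d'"
  shows "drift_le (\<lambda>E. h E + h' E) E (d + d')"
proof -
  have "Q (\<lambda>E. ennreal (h E + h' E)) E = Q (\<lambda>E. ennreal (h E) + ennreal (h' E)) E"
    using nn by (intro Q.op_cong E) (auto simp: ennreal_plus)
  also have "\<dots> = Q (\<lambda>E. ennreal (h E)) E + Q (\<lambda>E. ennreal (h' E)) E"
    by (intro Q.op_add E) auto
  also have "\<dots> \<le> ennreal (h E + d / L) + ennreal (h' E + d' / L)"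
    using assms by (intro add_mono) (auto simp: drift_le_def)
  also have "\<dots> = ennreal ((h E + h' E) + (d + d') / L)"
    using assms by (subst ennreal_plus[symmetric]) (auto simp: drift_le_def add_divide_distrib add_ac)
  finally show ?thesis using assms by (auto simp: drift_le_def add_divide_distrib)
qed

lemma drift_le_scale:
  assumes E: "E \<in> space S" and [measurable]: "h \<in> borel_measurable S"
    and nn: "\<And>E. E \<in> space S \<Longrightarrow> h E \<ge> 0" and c: "c \<ge> 0" and d: "drift_le h E d"
  shows "drift_le (\<lambda>E. c * h E) E (c * d)"
proof -
  have "Q (\<lambda>E. ennreal (c * h E)) E = Q (\<lambda>E. ennreal c * ennreal (h E)) E"
    using nn c by (intro Q.op_cong E) (auto simp: ennreal_mult)
  also have "\<dots> = ennreal c * Q (\<lambda>E. ennreal (h E)) E"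
    by (intro Q.op_cmult E) auto
  also have "\<dots> \<le> ennreal c * ennreal (h E + d / L)"
    using d by (intro mult_left_mono) (auto simp: drift_le_def)
  also have "\<dots> = ennreal (c * h E + c * d / L)"
    using c d by (subst ennreal_mult[symmetric]) (auto simp: drift_le_def distrib_left)
  finally show ?thesis using c d mult_nonneg_nonneg[of c "h E + d / L"]
    by (auto simp: drift_le_def distrib_left)
qed

lemma drift_le_sum:
  assumes E: "E \<in> space S" and "finite A" and m: "\<And>i. i \<in> A \<Longrightarrow> h i \<in> borel_measurable S"
    and nn: "\<And>i E. i \<in> A \<Longrightarrow> E \<in> space S \<Longrightarrow> h i E \<ge> 0"
    and d: "\<And>i. i \<in> A \<Longrightarrow> drift_le (h i) E (d i)"
  shows "drift_le (\<lambda>E. \<Sum>i\<in>A. h i E) E (\<Sum>i\<in>A. d i)"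
  using \<open>finite A\<close> m nn d
proof (induction A rule: finite_induct)
  case empty
  then show ?case using Q.op_const[OF E, of 0] by (simp add: drift_le_def)
next
  case (insert i A)
  have "drift_le (\<lambda>E. h i E + (\<Sum>i\<in>A. h i E)) E (d i + (\<Sum>i\<in>A. d i))"
    by (rule drift_le_add[OF E]) (use insert in \<open>auto intro!: borel_measurable_sum sum_nonneg\<close>)
  then show ?case using insert by simp
qed

end

lemma sum_powr_le:
  fixes f :: "'a \<Rightarrow> real"
  assumes "0 < p" "p \<le> 1" and "\<And>i. i \<in> A \<Longrightarrow> f i \<ge> 0"
  shows "(\<Sum>i\<in>A. f i) powr p \<le> (\<Sum>i\<in>A. f i powr p)"
  using assms(3)
proof (induction A rule: infinite_finite_induct)
  case (insert i A)
  have "(f i + sum f A) powr p \<le> f i powr p + sum f A powr p"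
    using insert assms by (intro powr_add_le sum_nonneg) auto
  then show ?case using insert by simp
qed auto

lemma sum_fun_upd:
  fixes E :: "nat \<Rightarrow> real"
  assumes "finite A"
  shows "sum (E(i := z)) A = sum E A + (if i \<in> A then z - E i else 0)"
proof (cases "i \<in> A")
  case True
  have "sum (E(i := z)) A = z + sum (E(i := z)) (A - {i})"
    using assms True by (simp add: sum.remove)
  also have "sum (E(i := z)) (A - {i}) = sum E (A - {i})"
    by (intro sum.cong) auto
  also have "\<dots> = sum E A - E i" using assms True by (simp add: sum_diff1)
  finally show ?thesis using True by simp
next
  case False
  then show ?thesis by (auto intro!: sum.cong)
qed

lemma sum_exchange:
  fixes E :: "nat \<Rightarrow> real"
  shows "sum (E(i := x, Suc i := y)) {a..<b} = sum E {a..<b}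
    + (if i \<in> {a..<b} then x - E i else 0) + (if Suc i \<in> {a..<b} then y - E (Suc i) else 0)"
  unfolding sum_fun_upd[OF finite_atLeastLessThan] by simp

lemma sum_exchange_conserved:
  fixes E :: "nat \<Rightarrow> real"
  assumes "Suc i \<noteq> a" "Suc i \<noteq> b"
  shows "sum (E(i := p * (E i + E (Suc i)), Suc i := (1 - p) * (E i + E (Suc i)))) {a..<b} = sum E {a..<b}"
  unfolding sum_exchange using assms by (auto simp: algebra_simps)

lemma sum_fun_upd_outside:
  fixes E :: "nat \<Rightarrow> real"
  assumes "i \<notin> {a..<b}"
  shows "sum (E(i := z)) {a..<b} = sum E {a..<b}"
  using assms by (subst sum_fun_upd) auto

text \<open>The upper bound on \<beta> is the integrability of \<open>p powr -(\<beta> / 2)\<close>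
  over the unit interval. The lower bound makes the exponent \<open>1 - 2 * (\<beta> - 1)\<close> in
  \<open>wt_block_powr_le\<close> nonpositive, and it is harmless because only values of \<beta>
  close to 2 are of interest.\<close>

locale lyapunov = energy_exchange +
  fixes \<beta> :: real
  assumes \<beta>: "3 / 2 \<le> \<beta>" "\<beta> < 2"
begin

definition \<kappa> :: real where "\<kappa> = 1 - 1 / \<beta>"

lemma kappa: "1 / 3 \<le> \<kappa>" "\<kappa> < 1 / 2" "\<kappa> > 0" "\<kappa> < 1"
  using \<beta> by (auto simp: \<kappa>_def field_simps)

lemma kappa_half_beta: "- (\<beta> / 2) * \<kappa> = 1 / 2 - \<beta> / 2"
  using \<beta> by (simp add: \<kappa>_def field_simps)

text \<open>Meant for \<open>x\<close> a part of the Lyapunov function and \<open>y\<close> the rate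
  at which it is lost: the wanted power of \<open>x\<close> is dominated by the available loss
  \<open>y * x\<close> plus a negative power of the rate. The exponent of \<open>y\<close> is forced
  by \<kappa> = 1 - 1/\<beta>.\<close>

lemma young:
  assumes "x > 0" "y > 0"
  shows "x powr \<kappa> \<le> y * x + y powr - (\<beta> - 1)"
proof -
  have e: "\<kappa> + - (\<beta> - 1) * (1 - \<kappa>) = 0" using \<beta> by (simp add: \<kappa>_def field_simps)
  have "x powr \<kappa> = x powr \<kappa> * (y powr \<kappa> * y powr (- (\<beta> - 1) * (1 - \<kappa>)))"
    using assms by (simp only: powr_add[symmetric] e) simp
  also have "\<dots> = (y * x) powr \<kappa> * (y powr - (\<beta> - 1)) powr (1 - \<kappa>)"
    using assms by (simp add: powr_mult powr_powr)
  also have "\<dots> \<le> \<kappa> * (y * x) + (1 - \<kappa>) * y powr - (\<beta> - 1)"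
    using kappa assms by (intro Youngs_inequality_0) auto
  also have "\<dots> \<le> 1 * (y * x) + 1 * y powr - (\<beta> - 1)"
    using kappa assms by (intro add_mono mult_right_mono) auto
  finally show ?thesis by simp
qed

lemma edge_rate_le_sqrt:
  assumes "E \<in> space S" "i < N" "e = i \<or> e = Suc i"
  shows "edge_rate e E \<le> min K (sqrt (E i))"
proof -
  have "edge_rate e E \<le> sqrt (E i)"
    using assms(2,3) N by (auto simp: edge_rate_def rate_def intro!: min.coboundedI2)
  then show ?thesis using edge_rate_le_K[of e E] by simp
qed

text \<open>Collects the error terms produced by \<open>young\<close>. All estimates below are
  allowed to produce multiples of it, since \<open>Rsum_le\<close> pays it back from the low-energy
  dissipation.\<close>

definition Rsum :: "(nat \<Rightarrow> real) \<Rightarrow> real" where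
  "Rsum E = (\<Sum>e\<le>N. edge_rate e E powr - (\<beta> - 1))"

lemma Rsum_ge: "e \<le> N \<Longrightarrow> edge_rate e E powr - (\<beta> - 1) \<le> Rsum E"
  unfolding Rsum_def by (rule member_le_sum) auto

lemma Rsum_nonneg: "Rsum E \<ge> 0"
  by (auto simp: Rsum_def intro!: sum_nonneg)

subsection \<open>Low energies\<close>

text \<open>Single sites would not be enough: an exchange between two low sites leaves both low, so
  the energy of the pair matters, and so on for longer blocks. The chain of comparisons ends with
  the whole system, whose boundary edges are the two baths.\<close>

definition block :: "nat \<times> nat \<Rightarrow> (nat \<Rightarrow> real) \<Rightarrow> real" where
  "block I E = (sum E {fst I..<snd I}) powr - (\<beta> / 2)"

definition blocks :: "(nat \<times> nat) set" where
  "blocks = {(a, b). a < b \<and> b \<le> N}"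

lemma finite_blocks: "finite blocks"
  by (rule finite_subset[of _ "{..N} \<times> {..N}"]) (auto simp: blocks_def)

lemma card_blocks: "card blocks \<le> (N + 1) ^ 2"
proof -
  have "card blocks \<le> card ({..N} \<times> {..N})"
    by (rule card_mono) (auto simp: blocks_def)
  then show ?thesis by (simp add: card_cartesian_product power2_eq_square)
qed

lemma block_sum_pos:
  assumes "E \<in> space S" "a < b" "b \<le> N"
  shows "sum E {a..<b} > 0"
  using assms state_pos[OF assms(1)] by (intro sum_pos) auto

lemma block_sum_nonneg:
  assumes "E \<in> space S" "b \<le> N"
  shows "sum E {a..<b} \<ge> 0"
  using assms state_pos[OF assms(1)] by (intro sum_nonneg) (auto intro: less_imp_le)

lemma block_pos: "E \<in> space S \<Longrightarrow> I \<in> blocks \<Longrightarrow> block I E > 0"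
  using block_sum_pos[of E "fst I" "snd I"] by (auto simp: block_def blocks_def)

lemma block_measurable: "I \<in> blocks \<Longrightarrow> block I \<in> borel_measurable S"
  unfolding block_def[abs_def] blocks_def
  by (intro powr_real_measurable borel_measurable_sum measurable_site borel_measurable_const) auto

text \<open>The two state-independent bounds of \<open>bath_op_le_powr\<close> with exponent
  \<beta>/2, added to serve both baths at once.\<close>

definition CT :: real where
  "CT = (1 / (TL * (1 - \<beta> / 2)) + 1) / (1 - \<beta> / 2) + (1 / (TR * (1 - \<beta> / 2)) + 1) / (1 - \<beta> / 2)"

lemma CT_ge: "(1 / (TL * (1 - \<beta> / 2)) + 1) / (1 - \<beta> / 2) \<le> CT" "(1 / (TR * (1 - \<beta> / 2)) + 1) / (1 - \<beta> / 2) \<le> CT"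
  "CT \<ge> 0"
proof -
  have "(1 / (T * (1 - \<beta> / 2)) + 1) / (1 - \<beta> / 2) \<ge> 0" if "T > 0" for T
    using that \<beta> by (intro divide_nonneg_nonneg add_nonneg_nonneg) auto
  from this[OF TL] this[OF TR] show "(1 / (TL * (1 - \<beta> / 2)) + 1) / (1 - \<beta> / 2) \<le> CT"
    "(1 / (TR * (1 - \<beta> / 2)) + 1) / (1 - \<beta> / 2) \<le> CT" "CT \<ge> 0"
    unfolding CT_def by linarith+
qed

lemma block_unaffected:
  assumes E: "E \<in> space S" and ab: "a < b" "b \<le> N" and e: "e \<le> N" "e \<noteq> a" "e \<noteq> b"
  shows "edge_op e (\<lambda>E. ennreal (block (a, b) E)) E \<le> ennreal (block (a, b) E)"
proof -
  let ?h = "block (a, b)"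
  consider "e = 0" | "e = N" "e \<noteq> 0" | i where "e = Suc i" "e < N"
    using e by (cases e) (auto simp: le_less)
  then show ?thesis
  proof cases
    case 1
    have "bath_op TL 0 (\<lambda>E. ennreal (?h E)) E \<le> ennreal (?h E + 0 / (1 - 0) + 0 * TL + 0 * (E 0 + TL) / 2)"
    proof (rule bath_op_le_affine)
      show "block (a, b) (E(0 := p * (E 0 + x))) \<le> block (a, b) E + 0 * p powr - 0 + 0 * x + 0 * (p * (E 0 + x))" for p x
        unfolding block_def fst_conv snd_conv using 1 e by (subst sum_fun_upd_outside) auto
    qed (use TL N state_pos[OF E] in \<open>auto simp: block_def\<close>)
    then show ?thesis using 1 by (simp add: edge_op_def)
  next
    case 2
    have "bath_op TR (N - 1) (\<lambda>E. ennreal (?h E)) E \<le> ennreal (?h E + 0 / (1 - 0) + 0 * TR + 0 * (E (N - 1) + TR) / 2)"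
    proof (rule bath_op_le_affine)
      show "block (a, b) (E(N - 1 := p * (E (N - 1) + x)))
          \<le> block (a, b) E + 0 * p powr - 0 + 0 * x + 0 * (p * (E (N - 1) + x))" for p x
        unfolding block_def fst_conv snd_conv using 2 e ab by (subst sum_fun_upd_outside) auto
    qed (use TR N state_pos[OF E] in \<open>auto simp: block_def\<close>)
    then show ?thesis using 2 by (simp add: edge_op_def)
  next
    case 3
    have "exchange_op i (\<lambda>E. ennreal (?h E)) E \<le> ennreal (?h E + 0 / (1 - 0) + 0 / 2)"
    proof (rule exchange_op_le_affine[OF E])
      show "block (a, b) (E(i := p * (E i + E (Suc i)), Suc i := (1 - p) * (E i + E (Suc i))))
          \<le> block (a, b) E + 0 * p powr - 0 + 0 * p" for p
        unfolding block_def fst_conv snd_conv using 3 e by (subst sum_exchange_conserved) auto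
    qed (use 3 in \<open>auto simp: block_def\<close>)
    then show ?thesis using 3 by (simp add: edge_op_def)
  qed
qed

lemma scaled_powr_le:
  fixes p s z c :: real
  assumes "0 < p" "0 < s" "p * s \<le> z" "c \<ge> 0"
  shows "z powr - c \<le> s powr - c * p powr - c"
proof -
  have "z powr - c \<le> (p * s) powr - c"
    using assms mult_pos_pos[of p s] by (cases "c = 0") (auto intro!: powr_mono2')
  then show ?thesis using assms by (simp add: powr_mult mult.commute)
qed

text \<open>After the exchange the block holds at least the fraction \<open>p\<close> of the energy
  of the block enlarged by one site to the left, and \<open>p powr -(\<beta> / 2)\<close> has mean
  \<open>1 / (1 - \<beta> / 2)\<close>.\<close>

lemma block_left:
  assumes E: "E \<in> space S" and ab: "0 < a" "a < b" "b \<le> N"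
  shows "edge_op a (\<lambda>E. ennreal (block (a, b) E)) E \<le> ennreal (block (a - 1, b) E / (1 - \<beta> / 2))"
proof -
  obtain i where a: "a = Suc i" using ab by (cases a) auto
  have pos: "E i > 0" "E (Suc i) > 0" using ab a state_pos[OF E] by auto
  have s: "sum E {i..<b} = E i + sum E {Suc i..<b}" "sum E {Suc i..<b} = E (Suc i) + sum E {Suc (Suc i)..<b}"
    using ab a by (auto simp: sum.atLeast_Suc_lessThan)
  have nn: "sum E {Suc (Suc i)..<b} \<ge> 0" using block_sum_nonneg[OF E ab(3)] .
  have "exchange_op i (\<lambda>E. ennreal (block (Suc i, b) E)) E \<le> ennreal (0 + block (i, b) E / (1 - \<beta> / 2) + 0 / 2)"
  proof (rule exchange_op_le_affine_reflect[OF E])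
    fix p :: real assume p: "0 < p" "p < 1"
    have "block (Suc i, b) (E(i := (1 - p) * (E i + E (Suc i)), Suc i := p * (E i + E (Suc i))))
        = (sum E {Suc i..<b} + (p * (E i + E (Suc i)) - E (Suc i))) powr - (\<beta> / 2)"
      using ab a unfolding block_def fst_conv snd_conv sum_exchange by simp
    also have "\<dots> \<le> block (i, b) E * p powr - (\<beta> / 2)"
      unfolding block_def fst_conv snd_conv
    proof (rule scaled_powr_le)
      have "p * sum E {Suc (Suc i)..<b} \<le> 1 * sum E {Suc (Suc i)..<b}" using p nn by (intro mult_right_mono) auto
      then show "p * sum E {i..<b} \<le> sum E {Suc i..<b} + (p * (E i + E (Suc i)) - E (Suc i))"
        unfolding s by (simp add: algebra_simps)
    qed (use p block_sum_pos[OF E, of i b] ab a \<beta> in auto)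
    finally show "block (Suc i, b) (E(i := (1 - p) * (E i + E (Suc i)), Suc i := p * (E i + E (Suc i))))
        \<le> 0 + block (i, b) E * p powr - (\<beta> / 2) + 0 * p" by simp
  qed (use ab a \<beta> in \<open>auto simp: block_def\<close>)
  then show ?thesis using ab a by (simp add: edge_op_def)
qed

lemma block_right:
  assumes E: "E \<in> space S" and ab: "a < b" "b < N"
  shows "edge_op b (\<lambda>E. ennreal (block (a, b) E)) E \<le> ennreal (block (a, Suc b) E / (1 - \<beta> / 2))"
proof -
  obtain i where b: "b = Suc i" using ab by (cases b) auto
  have pos: "E i > 0" "E (Suc i) > 0" using ab b state_pos[OF E] by auto
  have s: "sum E {a..<Suc (Suc i)} = sum E {a..<i} + E i + E (Suc i)" "sum E {a..<Suc i} = sum E {a..<i} + E i"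
    using ab b by auto
  have nn: "sum E {a..<i} \<ge> 0" using block_sum_nonneg[OF E, of i a] ab b by simp
  have "exchange_op i (\<lambda>E. ennreal (block (a, Suc i) E)) E \<le> ennreal (0 + block (a, Suc (Suc i)) E / (1 - \<beta> / 2) + 0 / 2)"
  proof (rule exchange_op_le_affine[OF E])
    fix p :: real assume p: "0 < p" "p < 1"
    have "block (a, Suc i) (E(i := p * (E i + E (Suc i)), Suc i := (1 - p) * (E i + E (Suc i))))
        = (sum E {a..<Suc i} + (p * (E i + E (Suc i)) - E i)) powr - (\<beta> / 2)"
      using ab b unfolding block_def fst_conv snd_conv sum_exchange by simp
    also have "\<dots> \<le> block (a, Suc (Suc i)) E * p powr - (\<beta> / 2)"
      unfolding block_def fst_conv snd_conv
    proof (rule scaled_powr_le)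
      have "p * sum E {a..<i} \<le> 1 * sum E {a..<i}" using p nn by (intro mult_right_mono) auto
      then show "p * sum E {a..<Suc (Suc i)} \<le> sum E {a..<Suc i} + (p * (E i + E (Suc i)) - E i)"
        unfolding s by (simp add: algebra_simps)
    qed (use p block_sum_pos[OF E, of a "Suc (Suc i)"] ab b \<beta> in auto)
    finally show "block (a, Suc i) (E(i := p * (E i + E (Suc i)), Suc i := (1 - p) * (E i + E (Suc i))))
        \<le> 0 + block (a, Suc (Suc i)) E * p powr - (\<beta> / 2) + 0 * p" by simp
  qed (use ab b \<beta> in \<open>auto simp: block_def\<close>)
  then show ?thesis using ab b by (simp add: edge_op_def)
qed

lemma block_bath:
  assumes E: "E \<in> space S" and ab: "a < b" "b \<le> N" and i: "a \<le> i" "i < b" and T: "T > 0"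
  shows "bath_op T i (\<lambda>E. ennreal (block (a, b) E)) E
    \<le> ennreal ((1 / (T * (1 - \<beta> / 2)) + 1) / (1 - \<beta> / 2))"
proof (rule bath_op_le_powr)
  fix p x :: real assume p: "0 < p" "p < 1" and x: "x > 0"
  have "sum E {a..<b} = E i + sum E ({a..<b} - {i})"
    using i by (simp add: sum.remove)
  moreover have "sum E ({a..<b} - {i}) \<ge> 0"
    using state_pos[OF E] ab by (intro sum_nonneg) (auto intro: less_imp_le)
  ultimately have ge: "sum E {a..<b} - E i \<ge> 0" by simp
  have "block (a, b) (E(i := p * (E i + x))) = (sum E {a..<b} + (p * (E i + x) - E i)) powr - (\<beta> / 2)"
    using i unfolding block_def fst_conv snd_conv sum_fun_upd[OF finite_atLeastLessThan] by simp
  also have "\<dots> \<le> x powr - (\<beta> / 2) * p powr - (\<beta> / 2)"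
  proof (rule scaled_powr_le)
    have "p * x \<le> p * (E i + x)" using p state_pos[OF E, of i] i ab by (intro mult_left_mono) auto
    then show "p * x \<le> sum E {a..<b} + (p * (E i + x) - E i)" using ge by simp
  qed (use p x \<beta> in auto)
  finally show "block (a, b) (E(i := p * (E i + x))) \<le> p powr - (\<beta> / 2) * x powr - (\<beta> / 2)"
    by (simp add: mult.commute)
qed (use T \<beta> in auto)

text \<open>The rate is at most the square root of the energy of any site at the edge, hence of the
  energy s of the block, and sqrt s * s powr -(\<beta>/2) is the power \<kappa> of the block value.
  This identity is the origin of \<kappa>.\<close>

lemma rate_block_le:
  assumes E: "E \<in> space S" and ab: "a < b" "b \<le> N" and e: "e \<le> N" and i: "a \<le> i" "i < b" "e = i \<or> e = Suc i"
  shows "edge_rate e E * block (a, b) E \<le> block (a, b) E powr \<kappa>"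
proof -
  let ?s = "sum E {a..<b}"
  have s: "?s > 0" by (rule block_sum_pos[OF E ab])
  have "E i \<le> ?s"
    using i ab state_pos[OF E] by (intro member_le_sum) (auto intro: less_imp_le)
  then have "edge_rate e E \<le> sqrt ?s"
    using edge_rate_le_sqrt[OF E, of i e] i ab by (auto intro: order_trans)
  then have "edge_rate e E * block (a, b) E \<le> sqrt ?s * ?s powr - (\<beta> / 2)"
    by (auto simp: block_def intro!: mult_right_mono)
  also have "\<dots> = ?s powr (1 / 2 - \<beta> / 2)"
    using s by (simp add: powr_half_sqrt[symmetric] powr_add[symmetric])
  also have "\<dots> = block (a, b) E powr \<kappa>"
    using s kappa_half_beta by (simp add: block_def powr_powr)
  finally show ?thesis .
qed

text \<open>Only the two boundary edges can change the energy of a block. The gain at such an edge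
  is its rate times the value of the block enlarged across it; for the larger block the edge is
  interior, so \<open>rate_block_le\<close> turns the gain into a power \<kappa>. The constant
  accounts for one bath at either end.\<close>

lemma block_drift:
  assumes E: "E \<in> space S" and ab: "a < b" "b \<le> N"
  shows "drift_le (block (a, b)) E
    ((if 0 < a then block (a - 1, b) E powr \<kappa> / (1 - \<beta> / 2) else 0)
     + (if b < N then block (a, Suc b) E powr \<kappa> / (1 - \<beta> / 2) else 0) + 2 * K * CT
     - (edge_rate a E + edge_rate b E) * block (a, b) E)"
proof -
  define u where "u e = (if e = a then (if a = 0 then CT else block (a - 1, b) E / (1 - \<beta> / 2))
      else if e = b then (if b = N then CT else block (a, Suc b) E / (1 - \<beta> / 2)) else block (a, b) E)" for e
  let ?h = "block (a, b)"
  have nn: "block I E \<ge> 0" for I by (simp add: block_def)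
  have b2: "1 - \<beta> / 2 > 0" using \<beta> by simp
  have "drift_le ?h E (\<Sum>e\<le>N. edge_rate e E * (u e - ?h E))"
  proof (rule drift_le_edges[OF E])
    show "?h \<in> borel_measurable S" using ab by (intro block_measurable) (auto simp: blocks_def)
    fix e assume e: "e \<le> N"
    have "u e \<ge> 0" using nn b2 CT_ge by (auto simp: u_def)
    moreover have "edge_op e (\<lambda>E. ennreal (?h E)) E \<le> ennreal (u e)"
    proof -
      consider "e \<noteq> a" "e \<noteq> b" | "e = a" "a = 0" | "e = a" "a > 0" | "e = b" "b = N" | "e = b" "b < N"
        using ab by linarith
      then show ?thesis
      proof cases
        case 2
        have "edge_op e (\<lambda>E. ennreal (?h E)) E \<le> ennreal ((1 / (TL * (1 - \<beta> / 2)) + 1) / (1 - \<beta> / 2))"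
          using block_bath[OF E ab, of 0 TL] 2 ab TL by (simp add: edge_op_def)
        also have "\<dots> \<le> ennreal CT" by (intro ennreal_leI CT_ge)
        finally show ?thesis using 2 by (simp add: u_def)
      next
        case 4
        have "edge_op e (\<lambda>E. ennreal (?h E)) E \<le> ennreal ((1 / (TR * (1 - \<beta> / 2)) + 1) / (1 - \<beta> / 2))"
          using block_bath[OF E ab, of "N - 1" TR] 4 ab TR by (simp add: edge_op_def)
        also have "\<dots> \<le> ennreal CT" by (intro ennreal_leI CT_ge)
        finally show ?thesis using 4 ab by (simp add: u_def)
      next
        case 1
        then show ?thesis using block_unaffected[OF E ab e] by (simp add: u_def)
      next
        case 3
        then show ?thesis using block_left[OF E _ ab] by (simp add: u_def)
      next
        case 5
        then show ?thesis using block_right[OF E ab(1)] ab by (simp add: u_def)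
      qed
    qed
    ultimately show "u e \<ge> 0 \<and> edge_op e (\<lambda>E. ennreal (?h E)) E \<le> ennreal (u e)" by blast
  qed (rule nn)
  moreover have "(\<Sum>e\<le>N. edge_rate e E * (u e - ?h E))
      = edge_rate a E * (u a - ?h E) + edge_rate b E * (u b - ?h E)"
  proof -
    have "(\<Sum>e\<le>N. edge_rate e E * (u e - ?h E)) = (\<Sum>e\<in>{a, b}. edge_rate e E * (u e - ?h E))"
      using ab by (intro sum.mono_neutral_right) (auto simp: u_def)
    then show ?thesis using ab by simp
  qed
  moreover have "edge_rate a E * u a \<le> (if 0 < a then block (a - 1, b) E powr \<kappa> / (1 - \<beta> / 2) else 0) + K * CT"
  proof (cases "a = 0")
    case True
    then show ?thesis using edge_rate_le_K[of a E] CT_ge(3) by (simp add: u_def mult_right_mono)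
  next
    case False
    then have "edge_rate a E * u a \<le> block (a - 1, b) E powr \<kappa> / (1 - \<beta> / 2)"
      using rate_block_le[OF E, of "a - 1" b a a] ab b2 by (simp add: u_def divide_right_mono)
    then show ?thesis using False K CT_ge(3) by (simp add: add_increasing2)
  qed
  moreover have "edge_rate b E * u b \<le> (if b < N then block (a, Suc b) E powr \<kappa> / (1 - \<beta> / 2) else 0) + K * CT"
  proof (cases "b = N")
    case True
    then show ?thesis using edge_rate_le_K[of b E] CT_ge(3) ab by (simp add: u_def mult_right_mono)
  next
    case False
    then have "edge_rate b E * u b \<le> block (a, Suc b) E powr \<kappa> / (1 - \<beta> / 2)"
      using rate_block_le[OF E, of a "Suc b" b b] ab b2 by (simp add: u_def divide_right_mono)
    then show ?thesis using False ab K CT_ge(3) by (simp add: add_increasing2)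
  qed
  ultimately show ?thesis
    by (elim drift_le_mono) (simp add: algebra_simps)
qed

text \<open>There are at most \<open>(N + 1) ^ 2\<close> blocks, each with at most two gains of size
  \<open>(Tot E / \<Theta> + Rsum E) / (1 - \<beta> / 2)\<close>, and \<open>Rsum\<close> brings
  \<open>N + 1\<close> further multiples of \<open>Tot E / \<Theta>\<close>. The value of \<Theta>
  keeps the total of these below \<open>Tot E / 2\<close>.\<close>

definition \<Theta> :: real where "\<Theta> = 4 * real (N + 2) ^ 3 / (1 - \<beta> / 2)"

definition wt :: "nat \<times> nat \<Rightarrow> real" where "wt I = \<Theta> ^ (4 ^ (snd I - fst I))"

definition Vlow :: "(nat \<Rightarrow> real) \<Rightarrow> real" where "Vlow E = (\<Sum>I\<in>blocks. wt I * block I E)"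

text \<open>The weighted losses of \<open>block_drift\<close>, the reserve that pays for everything
  else. Through \<open>young\<close> it dominates the power \<kappa> of \<open>Vlow\<close> up to
  \<open>Rsum\<close>, which it controls in turn.\<close>

definition Tot :: "(nat \<Rightarrow> real) \<Rightarrow> real" where
  "Tot E = (\<Sum>I\<in>blocks. wt I * ((edge_rate (fst I) E + edge_rate (snd I) E) * block I E))"

lemma Theta_ge: "\<Theta> \<ge> real (N + 1)" "\<Theta> \<ge> 1" "2 * real ((N + 1) ^ 2) * real (N + 2) / (1 - \<beta> / 2) \<le> \<Theta> / 2"
proof -
  have b: "0 < 1 - \<beta> / 2" "1 - \<beta> / 2 \<le> 1" using \<beta> by auto
  have "real (N + 1) ^ 2 * real (N + 2) \<le> real (N + 2) ^ 2 * real (N + 2)"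
    by (intro mult_right_mono power_mono) auto
  also have "\<dots> = real (N + 2) ^ 3" by (simp add: power2_eq_square power3_eq_cube)
  finally have 1: "real (N + 1) ^ 2 * real (N + 2) \<le> real (N + 2) ^ 3" .
  show "2 * real ((N + 1) ^ 2) * real (N + 2) / (1 - \<beta> / 2) \<le> \<Theta> / 2"
  proof -
    have half: "2 * x / y = 4 * x / y / 2" for x y :: real by simp
    have "2 * real ((N + 1) ^ 2) * real (N + 2) / (1 - \<beta> / 2) \<le> 2 * real (N + 2) ^ 3 / (1 - \<beta> / 2)"
      using 1 b(1) by (intro divide_right_mono) auto
    also have "2 * real (N + 2) ^ 3 / (1 - \<beta> / 2) = \<Theta> / 2" unfolding \<Theta>_def by (rule half)
    finally show ?thesis .
  qed
  define x where "x = real (N + 2)"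
  have x: "x \<ge> 1" by (simp add: x_def)
  have "x * (1 - \<beta> / 2) \<le> x * 1" using x b by (intro mult_left_mono) auto
  also have "\<dots> \<le> 4 * x ^ 3" using self_le_power[of x 3] x by simp
  finally have "x \<le> \<Theta>" using b unfolding \<Theta>_def x_def[symmetric] by (subst pos_le_divide_eq)
  then have "real (N + 2) \<le> \<Theta>" by (simp add: x_def)
  then show "\<Theta> \<ge> real (N + 1)" "\<Theta> \<ge> 1" by auto
qed

lemma wt_ge: "wt I \<ge> \<Theta>" "wt I \<ge> 1"
proof -
  have "\<Theta> ^ 1 \<le> \<Theta> ^ (4 ^ (snd I - fst I))"
    using Theta_ge by (intro power_increasing) auto
  then show "wt I \<ge> \<Theta>" by (simp add: wt_def)
  then show "wt I \<ge> 1" using Theta_ge by simp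
qed

lemma Tot_term_nonneg:
  assumes E: "E \<in> space S" and I: "I \<in> blocks"
  shows "0 \<le> edge_rate (fst I) E" "0 \<le> edge_rate (snd I) E"
    "0 \<le> wt I * ((edge_rate (fst I) E + edge_rate (snd I) E) * block I E)"
proof -
  have f: "fst I \<le> N" "snd I \<le> N" using I by (auto simp: blocks_def)
  show 1: "0 \<le> edge_rate (fst I) E" "0 \<le> edge_rate (snd I) E"
    using edge_rate_pos[OF E f(1)] edge_rate_pos[OF E f(2)] by auto
  show "0 \<le> wt I * ((edge_rate (fst I) E + edge_rate (snd I) E) * block I E)"
    using 1 block_pos[OF E I] wt_ge(2)[of I] by simp
qed

lemma Tot_ge:
  assumes E: "E \<in> space S" and I: "I \<in> blocks" and e: "e = fst I \<or> e = snd I"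
  shows "wt I * (edge_rate e E * block I E) \<le> Tot E"
proof -
  have "wt I * (edge_rate e E * block I E) \<le> wt I * ((edge_rate (fst I) E + edge_rate (snd I) E) * block I E)"
    using Tot_term_nonneg[OF E I] block_pos[OF E I] wt_ge(2)[of I] e
    by (intro mult_left_mono mult_right_mono) auto
  also have "\<dots> \<le> Tot E"
    unfolding Tot_def by (rule member_le_sum[OF I _ finite_blocks]) (use Tot_term_nonneg[OF E] in blast)
  finally show ?thesis .
qed

lemma Tot_nonneg: "E \<in> space S \<Longrightarrow> Tot E \<ge> 0"
  unfolding Tot_def using Tot_term_nonneg by (intro sum_nonneg) blast

lemma wt_block_nonneg: "wt I * block I E \<ge> 0"
  using wt_ge(2)[of I] by (simp add: block_def)

lemma block_powr_le:
  assumes E: "E \<in> space S" and I: "I \<in> blocks"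
  shows "block I E powr \<kappa> \<le> Tot E + Rsum E"
proof -
  have f: "fst I \<le> N" using I by (auto simp: blocks_def)
  have "block I E powr \<kappa> \<le> edge_rate (fst I) E * block I E + edge_rate (fst I) E powr - (\<beta> - 1)"
    using block_pos[OF E I] edge_rate_pos[OF E f] by (rule young)
  also have "edge_rate (fst I) E * block I E \<le> wt I * (edge_rate (fst I) E * block I E)"
    using mult_right_mono[OF wt_ge(2)[of I], of "edge_rate (fst I) E * block I E"]
      block_pos[OF E I] edge_rate_pos[OF E f] by simp
  also have "\<dots> \<le> Tot E" by (rule Tot_ge[OF E I]) simp
  finally show ?thesis using Rsum_ge[OF f, of E] by simp
qed

text \<open>The weights grow so fast (\<open>wt J = wt I ^ 4\<close>) that Young's inequality absorbs the gain of a block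
  into the loss of a block that is larger by one site, up to the rates alone.\<close>
lemma wt_block_powr_le:
  assumes E: "E \<in> space S" and J: "J \<in> blocks" and sz: "snd J - fst J = Suc (snd I - fst I)"
  shows "wt I * block J E powr \<kappa> \<le> Tot E / \<Theta> + Rsum E"
proof -
  define c where "c = wt I"
  define r where "r = edge_rate (fst J) E"
  have f: "fst J \<le> N" using J by (auto simp: blocks_def)
  have r: "r > 0" using edge_rate_pos[OF E f] by (simp add: r_def)
  have c: "c \<ge> 1" "c \<ge> \<Theta>" "c > 0" using wt_ge[of I] by (auto simp: c_def)
  have th: "\<Theta> > 0" using Theta_ge by simp
  have wJ: "wt J = c ^ 4" by (simp add: wt_def c_def sz power_mult[symmetric] mult.commute)
  have h: "block J E > 0" by (rule block_pos[OF E J])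
  have "block J E powr \<kappa> \<le> (c\<^sup>2 * r) * block J E + (c\<^sup>2 * r) powr - (\<beta> - 1)"
    using h r c by (intro young) auto
  then have "c * block J E powr \<kappa> \<le> c * ((c\<^sup>2 * r) * block J E + (c\<^sup>2 * r) powr - (\<beta> - 1))"
    using c by (intro mult_left_mono) auto
  also have "\<dots> = c ^ 3 * (r * block J E) + c * (c\<^sup>2 * r) powr - (\<beta> - 1)"
    by (simp add: algebra_simps power2_eq_square power3_eq_cube)
  also have "c ^ 3 * (r * block J E) \<le> Tot E / \<Theta>"
  proof -
    have "\<Theta> * c ^ 3 \<le> c * c ^ 3" using c by (intro mult_right_mono) auto
    then have "(\<Theta> * c ^ 3) * (r * block J E) \<le> wt J * (r * block J E)"
      using h r by (intro mult_right_mono) (auto simp: wJ power_numeral_reduce)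
    also have "\<dots> \<le> Tot E" unfolding r_def by (rule Tot_ge[OF E J]) simp
    finally show ?thesis using th by (simp add: field_simps)
  qed
  also have "c * (c\<^sup>2 * r) powr - (\<beta> - 1) \<le> Rsum E"
  proof -
    have "c * (c\<^sup>2 * r) powr - (\<beta> - 1) = c powr 1 * (c powr 2) powr - (\<beta> - 1) * r powr - (\<beta> - 1)"
      using c r by (simp add: powr_mult powr_numeral)
    also have "c powr 1 * (c powr 2) powr - (\<beta> - 1) = c powr (1 - 2 * (\<beta> - 1))"
      unfolding powr_powr powr_add[symmetric] by (simp add: algebra_simps)
    also have "\<dots> \<le> c powr 0" using c \<beta> by (intro powr_mono) auto
    also have "c powr 0 * r powr - (\<beta> - 1) \<le> Rsum E"
      using c Rsum_ge[OF f, of E] by (simp add: r_def)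
    finally show ?thesis by (simp add: mult_right_mono)
  qed
  finally show ?thesis by (simp add: c_def)
qed

text \<open>A rate is the cap \<open>K\<close>, the square root of a bath temperature, or
  \<open>sqrt (E i)\<close> for a site at the edge. In the last case its power
  \<open>- (\<beta> - 1)\<close> equals the rate times the value of the one-site block at
  \<open>i\<close>; this is a term of the loss \<open>Tot\<close>, where it carries a weight of at
  least \<Theta>.\<close>

lemma Rsum_le:
  assumes E: "E \<in> space S"
  shows "Rsum E \<le> real (N + 1) * (1 + TL powr - ((\<beta> - 1) / 2) + TR powr - ((\<beta> - 1) / 2)) + real (N + 1) * (Tot E / \<Theta>)"
proof -
  define C where "C = 1 + TL powr - ((\<beta> - 1) / 2) + TR powr - ((\<beta> - 1) / 2)"
  have C: "C \<ge> 1" "C \<ge> TL powr - ((\<beta> - 1) / 2)" "C \<ge> TR powr - ((\<beta> - 1) / 2)" by (auto simp: C_def)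
  have th: "\<Theta> > 0" using Theta_ge by simp
  have T0: "Tot E / \<Theta> \<ge> 0" using th Tot_nonneg[OF E] by simp
  have sq: "sqrt x powr - (\<beta> - 1) = x powr - ((\<beta> - 1) / 2)" if "x > 0" for x
    using that by (simp add: powr_half_sqrt[symmetric] powr_powr diff_divide_distrib)
  have site: "edge_rate e E powr - (\<beta> - 1) \<le> Tot E / \<Theta>"
    if i: "i < N" "e = i \<or> e = Suc i" "edge_rate e E = sqrt (E i)" for e i
  proof -
    let ?I = "(i, Suc i)"
    have I: "?I \<in> blocks" using i by (auto simp: blocks_def)
    have Ei: "E i > 0" using state_pos[OF E] i by simp
    have "edge_rate e E powr - (\<beta> - 1) = edge_rate e E * block ?I E"
    proof -
      have "sqrt (E i) * E i powr - (\<beta> / 2) = E i powr (1 / 2 + - (\<beta> / 2))"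
        using Ei by (simp only: powr_add powr_half_sqrt less_imp_le)
      also have "\<dots> = sqrt (E i) powr - (\<beta> - 1)"
        unfolding sq[OF Ei] by (simp add: diff_divide_distrib)
      finally show ?thesis using i by (simp add: block_def)
    qed
    moreover have "\<Theta> * (edge_rate e E * block ?I E) \<le> wt ?I * (edge_rate e E * block ?I E)"
      using wt_ge(1)[of ?I] edge_rate_pos[OF E, of e] block_pos[OF E I] i
      by (intro mult_right_mono mult_nonneg_nonneg) (auto intro: less_imp_le)
    moreover have "\<dots> \<le> Tot E" using i by (intro Tot_ge[OF E I]) auto
    ultimately show ?thesis using th by (simp add: field_simps)
  qed
  have one: "edge_rate e E powr - (\<beta> - 1) \<le> C + Tot E / \<Theta>" if e: "e \<le> N" for e
  proof -
    have "edge_rate e E = K \<or> (e = 0 \<and> edge_rate e E = sqrt TL) \<or> (e = N \<and> edge_rate e E = sqrt TR)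
        \<or> (\<exists>i. i < N \<and> (e = i \<or> e = Suc i) \<and> edge_rate e E = sqrt (E i))"
    proof -
      consider "e = 0" | "e = N" "e \<noteq> 0" | "0 < e" "e < N" using e by linarith
      then show ?thesis
      proof cases
        case 1
        then show ?thesis using N by (auto simp: edge_rate_def rate_def min_def)
      next
        case 2
        then have "e = Suc (N - 1) \<and> N - 1 < N" "edge_rate e E = rate K (E (N - 1)) TR"
          by (auto simp: edge_rate_def)
        then show ?thesis using 2(1) unfolding rate_def min_def by metis
      next
        case 3
        then have "e = Suc (e - 1) \<and> e - 1 < N" "edge_rate e E = rate K (E (e - 1)) (E e)"
          by (auto simp: edge_rate_def)
        then show ?thesis using 3(2) unfolding rate_def min_def by metis
      qed
    qed
    then show ?thesis
    proof (elim disjE exE conjE)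
      assume "edge_rate e E = K"
      then have "edge_rate e E powr - (\<beta> - 1) \<le> edge_rate e E powr 0" using K \<beta> by (intro powr_mono) auto
      then show ?thesis using \<open>edge_rate e E = K\<close> K C T0 by simp
    next
      assume "edge_rate e E = sqrt TL" then show ?thesis using sq[OF TL] C T0 by simp
    next
      assume "edge_rate e E = sqrt TR" then show ?thesis using sq[OF TR] C T0 by simp
    next
      fix i assume "i < N" "edge_rate e E = sqrt (E i)" "e = i"
      then show ?thesis using site[of i e] C by simp
    next
      fix i assume "i < N" "edge_rate e E = sqrt (E i)" "e = Suc i"
      then show ?thesis using site[of i e] C by simp
    qed
  qed
  have "Rsum E \<le> (\<Sum>e\<le>N. C + Tot E / \<Theta>)"
    unfolding Rsum_def using one by (intro sum_mono) auto
  also have "\<dots> = real (N + 1) * C + real (N + 1) * (Tot E / \<Theta>)" by (simp add: algebra_simps)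
  finally show ?thesis by (simp add: C_def)
qed

lemma Vlow_nonneg: "Vlow E \<ge> 0"
  unfolding Vlow_def using wt_block_nonneg by (intro sum_nonneg) blast

lemma sum_wt_nonneg: "(\<Sum>I\<in>blocks. wt I) \<ge> 0"
proof (rule sum_nonneg)
  show "wt I \<ge> 0" for I using wt_ge(2)[of I] by simp
qed

lemma Vlow_measurable: "Vlow \<in> borel_measurable S"
  unfolding Vlow_def[abs_def] using block_measurable by (intro borel_measurable_sum borel_measurable_times) auto

lemma Vlow_drift: "\<exists>C\<ge>0. \<forall>E\<in>space S. drift_le Vlow E (C - Tot E / 2)"
proof -
  define n where "n = real ((N + 1) ^ 2)"
  define c where "c = 1 / (1 - \<beta> / 2)"
  define C1 where "C1 = real (N + 1) * (1 + TL powr - ((\<beta> - 1) / 2) + TR powr - ((\<beta> - 1) / 2))"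
  define C where "C = n * 2 * c * C1 + (\<Sum>I\<in>blocks. wt I * (2 * K * CT))"
  have c: "c > 0" using \<beta> by (simp add: c_def)
  have n: "real (card blocks) \<le> n" "n \<ge> 0" using card_blocks unfolding n_def of_nat_le_iff by auto
  have th: "\<Theta> > 0" using Theta_ge by simp
  have C1: "C1 \<ge> 0" by (simp add: C1_def)
  have C: "C \<ge> 0"
  proof -
    have "wt I * (2 * K * CT) \<ge> 0" for I using wt_ge(2)[of I] K CT_ge(3) by simp
    then show ?thesis unfolding C_def using n c C1 by (intro add_nonneg_nonneg sum_nonneg) auto
  qed
  have "drift_le Vlow E (C - Tot E / 2)" if E: "E \<in> space S" for E
  proof -
    define X where "X = Tot E / \<Theta> + Rsum E"
    have X: "X \<ge> 0" using Tot_nonneg[OF E] th Rsum_nonneg[of E] by (simp add: X_def)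
    define d where "d I = wt I * ((if 0 < fst I then block (fst I - 1, snd I) E powr \<kappa> / (1 - \<beta> / 2) else 0)
     + (if snd I < N then block (fst I, Suc (snd I)) E powr \<kappa> / (1 - \<beta> / 2) else 0) + 2 * K * CT
     - (edge_rate (fst I) E + edge_rate (snd I) E) * block I E)" for I
    have "drift_le Vlow E (\<Sum>I\<in>blocks. d I)"
      unfolding Vlow_def[abs_def]
    proof (rule drift_le_sum[OF E finite_blocks])
      fix I assume I: "I \<in> blocks"
      show "drift_le (\<lambda>E. wt I * block I E) E (d I)"
        unfolding d_def using block_drift[OF E, of "fst I" "snd I"] I wt_ge(2)[of I] block_pos[OF _ I]
        by (intro drift_le_scale[OF E block_measurable]) (auto simp: blocks_def less_imp_le)
      show "(\<lambda>E. wt I * block I E) \<in> borel_measurable S"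
        using block_measurable[OF I] by simp
      show "wt I * block I E \<ge> 0" if "E \<in> space S" for E
        by (rule wt_block_nonneg)
    qed
    moreover have "(\<Sum>I\<in>blocks. d I) \<le> C - Tot E / 2"
    proof -
      \<comment> \<open>Both gains of a block come from blocks that are larger by one site, so
        \<open>wt_block_powr_le\<close> bounds each, weight included, by the same multiple
        \<open>c * X\<close>.\<close>
      have "d I \<le> 2 * c * X + wt I * (2 * K * CT) - wt I * ((edge_rate (fst I) E + edge_rate (snd I) E) * block I E)"
        if I: "I \<in> blocks" for I
      proof -
        have 1: "wt I * (if 0 < fst I then block (fst I - 1, snd I) E powr \<kappa> / (1 - \<beta> / 2) else 0) \<le> c * X"
        proof (cases "0 < fst I")
          case True
          have "wt I * block (fst I - 1, snd I) E powr \<kappa> \<le> X"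
            unfolding X_def using True I by (intro wt_block_powr_le[OF E]) (auto simp: blocks_def)
          then have "c * (wt I * block (fst I - 1, snd I) E powr \<kappa>) \<le> c * X" using c by (intro mult_left_mono) auto
          then show ?thesis using True by (simp add: c_def)
        qed (use c X in auto)
        have 2: "wt I * (if snd I < N then block (fst I, Suc (snd I)) E powr \<kappa> / (1 - \<beta> / 2) else 0) \<le> c * X"
        proof (cases "snd I < N")
          case True
          have "wt I * block (fst I, Suc (snd I)) E powr \<kappa> \<le> X"
            unfolding X_def using True I by (intro wt_block_powr_le[OF E]) (auto simp: blocks_def)
          then have "c * (wt I * block (fst I, Suc (snd I)) E powr \<kappa>) \<le> c * X" using c by (intro mult_left_mono) auto
          then show ?thesis using True by (simp add: c_def)
        qed (use c X in auto)
        show ?thesis using 1 2 unfolding d_def right_diff_distrib distrib_left by linarith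
      qed
      then have "(\<Sum>I\<in>blocks. d I) \<le> (\<Sum>I\<in>blocks. 2 * c * X + wt I * (2 * K * CT)
          - wt I * ((edge_rate (fst I) E + edge_rate (snd I) E) * block I E))"
        by (rule sum_mono)
      also have "\<dots> = real (card blocks) * (2 * c * X) + (\<Sum>I\<in>blocks. wt I * (2 * K * CT)) - Tot E"
        by (simp add: sum_subtractf sum.distrib Tot_def)
      also have "real (card blocks) * (2 * c * X) \<le> n * (2 * c * X)"
        using n c X by (intro mult_right_mono) auto
      also have "n * (2 * c * X) \<le> n * (2 * c * (real (N + 2) * (Tot E / \<Theta>) + C1))"
        using Rsum_le[OF E] n c unfolding X_def C1_def[symmetric]
        by (intro mult_left_mono) (auto simp: algebra_simps add_divide_distrib)
      also have "n * (2 * c * (real (N + 2) * (Tot E / \<Theta>) + C1))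
         = (2 * n * real (N + 2) * c) * (Tot E / \<Theta>) + n * 2 * c * C1"
        by (simp only: distrib_left mult_ac)
      also have "(2 * n * real (N + 2) * c) * (Tot E / \<Theta>) \<le> (\<Theta> / 2) * (Tot E / \<Theta>)"
        using Theta_ge(3) th Tot_nonneg[OF E] by (intro mult_right_mono) (auto simp: n_def c_def)
      also have "(\<Theta> / 2) * (Tot E / \<Theta>) = Tot E / 2" using th by simp
      finally show ?thesis by (simp add: C_def)
    qed
    ultimately show ?thesis by (rule drift_le_mono)
  qed
  then show ?thesis using C by blast
qed

lemma Vlow_powr_le: "\<exists>C\<ge>0. \<forall>E\<in>space S. Vlow E powr \<kappa> \<le> C * (Tot E + Rsum E)"
proof -
  have "Vlow E powr \<kappa> \<le> (\<Sum>I\<in>blocks. wt I) * (Tot E + Rsum E)" if E: "E \<in> space S" for E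
  proof -
    have "Vlow E powr \<kappa> \<le> (\<Sum>I\<in>blocks. (wt I * block I E) powr \<kappa>)"
      unfolding Vlow_def using kappa wt_block_nonneg by (intro sum_powr_le) auto
    also have "\<dots> \<le> (\<Sum>I\<in>blocks. wt I * (Tot E + Rsum E))"
    proof (rule sum_mono)
      fix I assume I: "I \<in> blocks"
      have "wt I powr \<kappa> \<le> wt I powr 1" using wt_ge(2)[of I] kappa by (intro powr_mono) auto
      then have "wt I powr \<kappa> \<le> wt I" using wt_ge(2)[of I] by simp
      then have "wt I powr \<kappa> * block I E powr \<kappa> \<le> wt I * (Tot E + Rsum E)"
        using block_powr_le[OF E I] wt_ge(2)[of I] by (intro mult_mono) auto
      then show "(wt I * block I E) powr \<kappa> \<le> wt I * (Tot E + Rsum E)"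
        using wt_ge(2)[of I] block_pos[OF E I] by (simp add: powr_mult)
    qed
    finally show ?thesis by (simp add: sum_distrib_right)
  qed
  then show ?thesis using sum_wt_nonneg by blast
qed

lemma Vlow_le: "\<exists>C\<ge>0. \<forall>E\<in>space S. Vlow E \<le> C * (\<Sum>i<N. E i powr - (\<beta> / 2))"
proof -
  have "Vlow E \<le> (\<Sum>I\<in>blocks. wt I) * (\<Sum>i<N. E i powr - (\<beta> / 2))" if E: "E \<in> space S" for E
    unfolding Vlow_def sum_distrib_right[of _ blocks]
  proof (rule sum_mono)
    fix I assume I: "I \<in> blocks"
    then have f: "fst I < N" "fst I < snd I" "snd I \<le> N" by (auto simp: blocks_def)
    have "E (fst I) \<le> sum E {fst I..<snd I}"
      using f state_pos[OF E] by (intro member_le_sum) (auto intro: less_imp_le)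
    then have "block I E \<le> E (fst I) powr - (\<beta> / 2)"
      unfolding block_def using state_pos[OF E f(1)] \<beta> by (intro powr_mono2') auto
    also have "\<dots> \<le> (\<Sum>i<N. E i powr - (\<beta> / 2))"
      using f by (intro member_le_sum) auto
    finally show "wt I * block I E \<le> wt I * (\<Sum>i<N. E i powr - (\<beta> / 2))"
      using wt_ge(2)[of I] by (intro mult_left_mono) auto
  qed
  then show ?thesis using sum_wt_nonneg by blast
qed

end

lemma powr_add_const_le:
  fixes a x q :: real
  assumes "a \<ge> 1" "x \<ge> 0" "0 < q" "q \<le> 1"
  shows "(a + x) powr q \<le> a powr q + x"
proof -
  have "(a + x) powr q = a powr q * (1 + x / a) powr q"
    using assms by (subst powr_mult[symmetric]) (auto simp: distrib_left)
  also have "\<dots> \<le> a powr q * (1 + x / a) powr 1"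
    using assms by (intro mult_left_mono powr_mono) auto
  also have "\<dots> = a powr q + a powr q * x / a"
    using assms by (simp add: algebra_simps)
  also have "a powr q * x / a \<le> x"
  proof -
    have "a powr q \<le> a powr 1" using assms by (intro powr_mono) auto
    then have "a powr q * x \<le> a * x" using assms by (intro mult_right_mono) auto
    then show ?thesis using assms by (simp add: field_simps)
  qed
  finally show ?thesis by simp
qed

lemma powr_antimono:
  fixes x y a :: real
  assumes "a \<le> 0" "0 < x" "x \<le> y"
  shows "y powr a \<le> x powr a"
  using assms powr_mono2'[of a x y] by (cases "a = 0") auto

context lyapunov
begin

subsection \<open>Low energies next to a reservoir of high energy\<close>

text \<open>The relation \<open>q i = \<kappa> * q (Suc i)\<close> allows the penalty at a site to
  be compared with the power \<kappa> of the penalty at its right neighbour. The bound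
  \<open>q i \<le> 1 / 8\<close> keeps the exponent \<open>q i - 1 / 8\<close> nonpositive, so that
  energy arriving at the site itself, however large, is no penalty.\<close>

definition q :: "nat \<Rightarrow> real" where "q i = \<kappa> ^ (N - 1 - i) / 8"

definition tail :: "nat \<Rightarrow> (nat \<Rightarrow> real) \<Rightarrow> real" where "tail i E = sum E {i..<N}"

text \<open>Large when site \<open>i\<close> is low while much energy sits to its right. The
  exponent 1/8 is small so that the mean of \<open>p powr -(1 / 8)\<close> is only 8/7: an
  unfavourable exchange costs a seventh of the value, which a favourable one outweighs.\<close>

definition fsite :: "nat \<Rightarrow> (nat \<Rightarrow> real) \<Rightarrow> real" where
  "fsite i E = (1 + tail i E) powr q i * E i powr - (1 / 8)"

text \<open>An upper bound for the rates of both edges at site \<open>i\<close>, attained by an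
  inner edge when the neighbour is at least as rich. It allows the dissipation to be expressed
  without reference to the neighbour's energy.\<close>

definition srate :: "nat \<Rightarrow> (nat \<Rightarrow> real) \<Rightarrow> real" where "srate i E = min K (sqrt (E i))"

definition gsite :: "nat \<Rightarrow> (nat \<Rightarrow> real) \<Rightarrow> real" where "gsite i E = srate i E * fsite i E"

lemma q_bounds: "0 < q i" "q i \<le> 1 / 8"
proof -
  show "0 < q i" using kappa by (simp add: q_def)
  have "\<kappa> ^ (N - 1 - i) \<le> 1" using kappa by (intro power_le_one) auto
  then show "q i \<le> 1 / 8" by (simp add: q_def)
qed

lemma q_Suc: "Suc i < N \<Longrightarrow> q i = \<kappa> * q (Suc i)"
proof -
  assume "Suc i < N"
  then have "N - 1 - i = Suc (N - 1 - Suc i)" by simp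
  then show ?thesis by (simp add: q_def)
qed

lemma tail_split: "i < N \<Longrightarrow> tail i E = E i + tail (Suc i) E"
  by (simp add: tail_def sum.atLeast_Suc_lessThan)

lemma tail_nonneg: "E \<in> space S \<Longrightarrow> tail i E \<ge> 0"
  unfolding tail_def by (rule block_sum_nonneg) auto

lemma srate_pos: "E \<in> space S \<Longrightarrow> i < N \<Longrightarrow> srate i E > 0"
  using K state_pos[of E N i] by (simp add: srate_def)

lemma srate_le_K: "srate i E \<le> K" by (simp add: srate_def)

lemma edge_rate_le_srate: "E \<in> space S \<Longrightarrow> i < N \<Longrightarrow> e = i \<or> e = Suc i \<Longrightarrow> edge_rate e E \<le> srate i E"
  unfolding srate_def by (rule edge_rate_le_sqrt)

lemma srate_powr_le_Rsum:
  assumes E: "E \<in> space S" "i < N"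
  shows "srate i E powr - (\<beta> - 1) \<le> Rsum E"
proof -
  have "srate i E powr - (\<beta> - 1) \<le> edge_rate i E powr - (\<beta> - 1)"
    using edge_rate_le_srate[OF E] edge_rate_pos[OF E(1), of i] E \<beta> by (intro powr_mono2') auto
  then show ?thesis using Rsum_ge[of i E] E by simp
qed

text \<open>Below energy 1 the factor \<open>sqrt (E i)\<close> in the rate compensates a
  singularity of order up to 1/2; above it the power is at most 1. The error terms in the drift of
  \<open>fsite\<close> that involve only the energy at site \<open>i\<close> are bounded in this
  way.\<close>

lemma srate_powr_le:
  assumes E: "E \<in> space S" "i < N" and a: "-1/2 \<le> a" "a \<le> 0"
  shows "srate i E * E i powr a \<le> K"
proof (cases "E i \<le> 1")
  case True
  have "srate i E * E i powr a \<le> sqrt (E i) * E i powr a"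
    by (intro mult_right_mono) (auto simp: srate_def)
  also have "\<dots> = E i powr (1 / 2 + a)"
    using state_pos[OF E] by (simp add: powr_half_sqrt[symmetric] powr_add)
  also have "\<dots> \<le> 1" using state_pos[OF E] True a by (intro powr_le1) auto
  finally show ?thesis using K by simp
next
  case False
  then have "E i powr a \<le> E i powr 0" using a by (intro powr_mono) auto
  then have "srate i E * E i powr a \<le> K * 1"
    using srate_le_K K srate_pos[OF E] False by (intro mult_mono) auto
  then show ?thesis by simp
qed

lemma fsite_pos: "E \<in> space S \<Longrightarrow> i < N \<Longrightarrow> fsite i E > 0"
  using tail_nonneg[of E i] state_pos[of E N i] by (simp add: fsite_def)

lemma fsite_nonneg: "fsite i E \<ge> 0" by (simp add: fsite_def)

lemma gsite_nonneg: "E \<in> space S \<Longrightarrow> i < N \<Longrightarrow> gsite i E \<ge> 0"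
  using srate_pos[of E i] fsite_nonneg[of i E] by (simp add: gsite_def)

lemma fsite_measurable:
  assumes "i < N"
  shows "fsite i \<in> borel_measurable S"
  unfolding fsite_def[abs_def] tail_def using assms
  by (intro borel_measurable_times powr_real_measurable borel_measurable_add borel_measurable_sum
      measurable_site borel_measurable_const) auto

lemma fsite_powr_le:
  assumes E: "E \<in> space S" "i < N"
  shows "fsite i E powr \<kappa> \<le> gsite i E + Rsum E"
  using young[OF fsite_pos[OF E] srate_pos[OF E]] srate_powr_le_Rsum[OF E] by (simp add: gsite_def)

text \<open>The value of \<open>fsite i\<close> after site \<open>i\<close> has received the energy \<open>p * s\<close>.\<close>
lemma fsite_refresh_le:
  assumes "0 < p" "p < 1" "s > 0" "t \<ge> 0"
  shows "(1 + t + p * s) powr q i * (p * s) powr - (1 / 8)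
    \<le> ((1 + t) powr q i * s powr - (1 / 8) + s powr (q i - 1 / 8)) * p powr - (1 / 8)"
proof -
  have "(1 + t + p * s) powr q i \<le> (1 + t) powr q i + (p * s) powr q i"
    using assms q_bounds[of i] by (intro powr_add_le) auto
  also have "(p * s) powr q i \<le> s powr q i"
    using assms q_bounds[of i] by (intro powr_mono2) (auto simp: mult_le_cancel_right1)
  finally have "(1 + t + p * s) powr q i * (p * s) powr - (1 / 8)
      \<le> ((1 + t) powr q i + s powr q i) * (p * s) powr - (1 / 8)"
    by (intro mult_right_mono) auto
  also have "((1 + t) powr q i + s powr q i) * (p * s) powr - (1 / 8)
     = ((1 + t) powr q i + s powr q i) * (p powr - (1 / 8) * s powr - (1 / 8))"
    using assms by (simp add: powr_mult)
  also have "((1 + t) powr q i + s powr q i) * (p powr - (1 / 8) * s powr - (1 / 8))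
     = ((1 + t) powr q i * s powr - (1 / 8) + s powr q i * s powr - (1 / 8)) * p powr - (1 / 8)"
    by (simp add: algebra_simps)
  also have "s powr q i * s powr - (1 / 8) = s powr (q i - 1 / 8)"
    by (simp add: powr_add[symmetric])
  finally show ?thesis .
qed

text \<open>The energy strictly to the right of \<open>i\<close> is untouched, while site
  \<open>i\<close> receives a uniform share of an amount \<open>s \<ge> E i\<close>. Averaging costs
  the factor 8/7, hence a net gain of one seventh; the contribution of the arriving energy itself is
  at most \<open>E i powr (q i - 1 / 8)\<close>, which the rate makes bounded.\<close>

lemma fsite_left:
  assumes E: "E \<in> space S" and i: "i < N"
  shows "\<exists>u\<ge>0. edge_op i (\<lambda>E. ennreal (fsite i E)) E \<le> ennreal u \<and>
     edge_rate i E * (u - fsite i E) \<le> edge_rate i E * fsite i E / 7 + 2 * K"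
proof -
  have pos: "E i > 0" using state_pos[OF E i] .
  have q: "0 < q i" "q i \<le> 1 / 8" by (rule q_bounds)+
  define t where "t = tail (Suc i) E"
  have t: "t \<ge> 0" using tail_nonneg[OF E] by (simp add: t_def)
  have f: "fsite i E = (1 + t + E i) powr q i * E i powr - (1 / 8)"
    using tail_split[OF i] by (simp add: fsite_def t_def add_ac)
  have X: "((1 + t) powr q i * s powr - (1 / 8) + s powr (q i - 1 / 8)) \<le> fsite i E + E i powr (q i - 1 / 8)"
    if "s \<ge> E i" for s
  proof (rule add_mono)
    show "(1 + t) powr q i * s powr - (1 / 8) \<le> fsite i E"
      unfolding f using pos that t q by (intro mult_mono powr_mono2 powr_mono2') auto
    show "s powr (q i - 1 / 8) \<le> E i powr (q i - 1 / 8)"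
      using pos that q by (intro powr_antimono) auto
  qed
  define c where "c = fsite i E + E i powr (q i - 1 / 8)"
  have c: "c \<ge> 0" using fsite_nonneg by (simp add: c_def)
  have "edge_op i (\<lambda>E. ennreal (fsite i E)) E \<le> ennreal (0 + c / (1 - 1 / 8))"
  proof (cases "i = 0")
    case True
    have "bath_op TL 0 (\<lambda>E. ennreal (fsite 0 E)) E
        \<le> ennreal (0 + c / (1 - 1 / 8) + 0 * TL + 0 * (E 0 + TL) / 2)"
    proof (rule bath_op_le_affine)
      fix p x :: real assume p: "0 < p" "p < 1" and x: "x \<ge> 0"
      let ?E = "E(0 := p * (E 0 + x))"
      have "tail (Suc 0) ?E = t" unfolding t_def tail_def True by (subst sum_fun_upd_outside) auto
      then have "fsite 0 ?E = (1 + t + p * (E 0 + x)) powr q i * (p * (E 0 + x)) powr - (1 / 8)"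
        using tail_split[of 0 ?E] i True by (simp add: fsite_def add_ac)
      also have "\<dots> \<le> ((1 + t) powr q i * (E 0 + x) powr - (1 / 8) + (E 0 + x) powr (q i - 1 / 8)) * p powr - (1 / 8)"
        using p x pos t True by (intro fsite_refresh_le) auto
      also have "\<dots> \<le> c * p powr - (1 / 8)"
        using X[of "E 0 + x"] x True by (intro mult_right_mono) (auto simp: c_def)
      finally show "fsite 0 ?E \<le> 0 + c * p powr - (1 / 8) + 0 * x + 0 * (p * (E 0 + x))" by simp
    qed (use pos True TL c in auto)
    then show ?thesis using True by (simp add: edge_op_def)
  next
    case False
    then obtain j where j: "i = Suc j" by (cases i) auto
    have Ej: "E j > 0" using state_pos[OF E, of j] i j by simp
    have "exchange_op j (\<lambda>E. ennreal (fsite i E)) E \<le> ennreal (0 + c / (1 - 1 / 8) + 0 / 2)"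
    proof (rule exchange_op_le_affine_reflect[OF E])
      fix p :: real assume p: "0 < p" "p < 1"
      let ?E = "E(j := (1 - p) * (E j + E (Suc j)), Suc j := p * (E j + E (Suc j)))"
      have "tail (Suc i) ?E = t"
        unfolding t_def tail_def j by (subst sum_fun_upd_outside, simp, subst sum_fun_upd_outside) auto
      then have "fsite i ?E = (1 + t + p * (E j + E (Suc j))) powr q i * (p * (E j + E (Suc j))) powr - (1 / 8)"
        using tail_split[of i ?E] i j by (simp add: fsite_def add_ac)
      also have "\<dots> \<le> ((1 + t) powr q i * (E j + E (Suc j)) powr - (1 / 8) + (E j + E (Suc j)) powr (q i - 1 / 8)) * p powr - (1 / 8)"
        using p pos t j Ej by (intro fsite_refresh_le) auto
      also have "\<dots> \<le> c * p powr - (1 / 8)"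
        using X[of "E j + E (Suc j)"] j Ej by (intro mult_right_mono) (auto simp: c_def)
      finally show "fsite i ?E \<le> 0 + c * p powr - (1 / 8) + 0 * p" by simp
    qed (use i j c in auto)
    then show ?thesis using i j by (simp add: edge_op_def)
  qed
  then have "edge_op i (\<lambda>E. ennreal (fsite i E)) E \<le> ennreal (8 / 7 * c)" by (simp add: mult.commute)
  moreover have "edge_rate i E * (8 / 7 * c - fsite i E) \<le> edge_rate i E * fsite i E / 7 + 2 * K"
  proof -
    have "edge_rate i E * E i powr (q i - 1 / 8) \<le> srate i E * E i powr (q i - 1 / 8)"
      using edge_rate_le_srate[OF E i] by (intro mult_right_mono) auto
    also have "\<dots> \<le> K" using q by (intro srate_powr_le[OF E i]) auto
    finally have "edge_rate i E * E i powr (q i - 1 / 8) \<le> K" .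
    moreover have "edge_rate i E * (8 / 7 * c - fsite i E)
       = edge_rate i E * fsite i E / 7 + 8 / 7 * (edge_rate i E * E i powr (q i - 1 / 8))"
      by (simp add: c_def algebra_simps)
    ultimately show ?thesis using K by simp
  qed
  ultimately show ?thesis using c by (intro exI[of _ "8 / 7 * c"]) auto
qed

text \<open>This exchange conserves \<open>tail i\<close>, so only the singular factor is
  renewed.\<close>

lemma fsite_right:
  assumes E: "E \<in> space S" and i: "Suc i < N"
  shows "edge_op (Suc i) (\<lambda>E. ennreal (fsite i E)) E
    \<le> ennreal (8 / 7 * ((1 + tail i E) powr q i * (E i + E (Suc i)) powr - (1 / 8)))"
proof -
  have pos: "E i > 0" "E (Suc i) > 0" using state_pos[OF E] i by auto
  let ?c = "(1 + tail i E) powr q i * (E i + E (Suc i)) powr - (1 / 8)"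
  have "exchange_op i (\<lambda>E. ennreal (fsite i E)) E \<le> ennreal (0 + ?c / (1 - 1 / 8) + 0 / 2)"
  proof (rule exchange_op_le_affine[OF E])
    fix p :: real assume p: "0 < p" "p < 1"
    have "tail i (E(i := p * (E i + E (Suc i)), Suc i := (1 - p) * (E i + E (Suc i)))) = tail i E"
      unfolding tail_def using i by (intro sum_exchange_conserved) auto
    then show "fsite i (E(i := p * (E i + E (Suc i)), Suc i := (1 - p) * (E i + E (Suc i))))
        \<le> 0 + ?c * p powr - (1 / 8) + 0 * p"
      using p pos by (simp add: fsite_def powr_mult)
  qed (use i in auto)
  then show ?thesis using i by (simp add: edge_op_def mult.commute)
qed

lemma fsite_last:
  assumes E: "E \<in> space S" and i: "Suc i = N"
  shows "\<exists>u\<ge>0. edge_op N (\<lambda>E. ennreal (fsite i E)) E \<le> ennreal u \<and> edge_rate N E * u \<le> 3 * K"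
proof -
  have pos: "E i > 0" using state_pos[OF E, of i] i by simp
  have q: "0 < q i" "q i \<le> 1 / 8" by (rule q_bounds)+
  define c where "c = E i powr - (1 / 8) + E i powr (q i - 1 / 8)"
  have c: "c \<ge> 0" by (simp add: c_def)
  have "bath_op TR i (\<lambda>E. ennreal (fsite i E)) E \<le> ennreal (0 + c / (1 - 1 / 8) + 0 * TR + 0 * (E i + TR) / 2)"
  proof (rule bath_op_le_affine)
    fix p x :: real assume p: "0 < p" "p < 1" and x: "x \<ge> 0"
    let ?E = "E(i := p * (E i + x))"
    have "tail i ?E = p * (E i + x)" using i by (auto simp: tail_def)
    then have "fsite i ?E = (1 + 0 + p * (E i + x)) powr q i * (p * (E i + x)) powr - (1 / 8)"
      by (simp add: fsite_def)
    also have "\<dots> \<le> ((1 + 0) powr q i * (E i + x) powr - (1 / 8) + (E i + x) powr (q i - 1 / 8)) * p powr - (1 / 8)"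
      using p x pos by (intro fsite_refresh_le) auto
    also have "\<dots> \<le> c * p powr - (1 / 8)"
    proof (rule mult_right_mono)
      have "(E i + x) powr - (1 / 8) \<le> E i powr - (1 / 8)" using pos x by (intro powr_mono2') auto
      moreover have "(E i + x) powr (q i - 1 / 8) \<le> E i powr (q i - 1 / 8)"
        using pos x q by (intro powr_antimono) auto
      ultimately show "(1 + 0) powr q i * (E i + x) powr - (1 / 8) + (E i + x) powr (q i - 1 / 8) \<le> c"
        by (simp add: c_def)
    qed auto
    finally show "fsite i ?E \<le> 0 + c * p powr - (1 / 8) + 0 * x + 0 * (p * (E i + x))" by simp
  qed (use pos TR c in auto)
  then have "edge_op N (\<lambda>E. ennreal (fsite i E)) E \<le> ennreal (8 / 7 * c)"
  proof -
    have "N - 1 = i" "N \<noteq> 0" using i by auto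
    then show ?thesis using \<open>bath_op TR i _ E \<le> _\<close> by (simp add: edge_op_def mult.commute)
  qed
  moreover have "edge_rate N E * (8 / 7 * c) \<le> 3 * K"
  proof -
    have 1: "edge_rate N E * E i powr a \<le> K" if "- 1 / 2 \<le> a" "a \<le> 0" for a
    proof -
      have "edge_rate N E * E i powr a \<le> srate i E * E i powr a"
        using edge_rate_le_srate[OF E, of i N] i by (intro mult_right_mono) auto
      also have "\<dots> \<le> K" using that i by (intro srate_powr_le[OF E]) auto
      finally show ?thesis .
    qed
    have "edge_rate N E * (8 / 7 * c) = 8 / 7 * (edge_rate N E * E i powr - (1 / 8)) + 8 / 7 * (edge_rate N E * E i powr (q i - 1 / 8))"
      by (simp add: c_def algebra_simps)
    also have "\<dots> \<le> 8 / 7 * K + 8 / 7 * K" using q by (intro add_mono mult_left_mono 1) auto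
    finally show ?thesis using K by linarith
  qed
  ultimately show ?thesis using c by (intro exI[of _ "8 / 7 * c"]) auto
qed

lemma fsite_unaffected:
  assumes E: "E \<in> space S" and i: "i < N" and e: "e < N" "e \<noteq> i" "e \<noteq> Suc i"
  shows "edge_op e (\<lambda>E. ennreal (fsite i E)) E \<le> ennreal (fsite i E)"
proof (cases e)
  case 0
  have "bath_op TL 0 (\<lambda>E. ennreal (fsite i E)) E \<le> ennreal (fsite i E + 0 / (1 - 0) + 0 * TL + 0 * (E 0 + TL) / 2)"
  proof (rule bath_op_le_affine)
    show "fsite i (E(0 := p * (E 0 + x))) \<le> fsite i E + 0 * p powr - 0 + 0 * x + 0 * (p * (E 0 + x))" for p x
      unfolding fsite_def tail_def using 0 e by (subst sum_fun_upd_outside) auto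
  qed (use TL N state_pos[OF E] fsite_nonneg in auto)
  then show ?thesis using 0 by (simp add: edge_op_def)
next
  case (Suc j)
  have "exchange_op j (\<lambda>E. ennreal (fsite i E)) E \<le> ennreal (fsite i E + 0 / (1 - 0) + 0 / 2)"
  proof (rule exchange_op_le_affine[OF E])
    show "fsite i (E(j := p * (E j + E (Suc j)), Suc j := (1 - p) * (E j + E (Suc j))))
          \<le> fsite i E + 0 * p powr - 0 + 0 * p" for p
      unfolding fsite_def tail_def using Suc e by (subst sum_exchange_conserved) auto
  qed (use Suc e fsite_nonneg in auto)
  then show ?thesis using Suc e by (simp add: edge_op_def)
qed

text \<open>The bath raises the energy to the right by at most the incoming \<open>x\<close>, and by
  \<open>powr_add_const_le\<close> this adds at most \<open>x\<close> to the growing factor; the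
  mean of \<open>x\<close> is \<open>TR\<close>.\<close>

lemma fsite_far_bath:
  assumes E: "E \<in> space S" and i: "Suc i < N"
  shows "edge_op N (\<lambda>E. ennreal (fsite i E)) E \<le> ennreal (fsite i E + TR * E i powr - (1 / 8))"
proof -
  have pos: "E i > 0" "E (N - 1) > 0" using state_pos[OF E] i by auto
  have q: "0 < q i" "q i \<le> 1 / 8" by (rule q_bounds)+
  let ?l = "E i powr - (1 / 8)"
  have "bath_op TR (N - 1) (\<lambda>E. ennreal (fsite i E)) E
      \<le> ennreal (fsite i E + 0 / (1 - 0) + ?l * TR + 0 * (E (N - 1) + TR) / 2)"
  proof (rule bath_op_le_affine)
    fix p x :: real assume p: "0 < p" "p < 1" and x: "x \<ge> 0"
    let ?E = "E(N - 1 := p * (E (N - 1) + x))"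
    have "tail i ?E = tail i E + (p * (E (N - 1) + x) - E (N - 1))"
      unfolding tail_def using i by (subst sum_fun_upd) auto
    also have "\<dots> \<le> tail i E + x"
    proof -
      have "p * (E (N - 1) + x) \<le> 1 * (E (N - 1) + x)" using p pos x by (intro mult_right_mono) auto
      then show ?thesis by simp
    qed
    finally have t: "tail i ?E \<le> tail i E + x" .
    have "tail i ?E \<ge> 0" using p pos x state_pos[OF E]
      unfolding tail_def by (intro sum_nonneg) (auto intro!: mult_nonneg_nonneg add_nonneg_nonneg intro: less_imp_le)
    then have "(1 + tail i ?E) powr q i \<le> ((1 + tail i E) + x) powr q i"
      using t q by (intro powr_mono2) auto
    also have "\<dots> \<le> (1 + tail i E) powr q i + x"
      using q x tail_nonneg[OF E, of i] by (intro powr_add_const_le) auto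
    finally have "(1 + tail i ?E) powr q i * ?l \<le> ((1 + tail i E) powr q i + x) * ?l"
      by (intro mult_right_mono) auto
    moreover have "?E i = E i" using i by auto
    ultimately show "fsite i ?E \<le> fsite i E + 0 * p powr - 0 + ?l * x + 0 * (p * (E (N - 1) + x))"
      unfolding fsite_def by (simp only: distrib_right mult_zero_left add_0_right mult.commute[of x])
  qed (use TR pos fsite_nonneg in auto)
  then show ?thesis using N by (simp add: edge_op_def mult.commute)
qed

text \<open>At the last site \<open>tail i\<close> is the energy of the site itself, so
  \<open>gsite\<close> is at most \<open>2 * K\<close> and a negative multiple of it can be inserted
  at the cost of a constant. Of \<open>7 * K\<close>, the two edges take \<open>2 * K\<close> and
  \<open>3 * K\<close>, and this insertion the rest.\<close>

lemma fsite_drift_last: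
  assumes E: "E \<in> space S" and i: "Suc i = N"
  shows "drift_le (fsite i) E (7 * K - gsite i E / 4)"
proof -
  have iN: "i < N" using i by simp
  have pos: "E i > 0" using state_pos[OF E iN] .
  have q: "0 < q i" "q i \<le> 1 / 8" by (rule q_bounds)+
  obtain u1 where u1: "u1 \<ge> 0" "edge_op i (\<lambda>E. ennreal (fsite i E)) E \<le> ennreal u1"
     "edge_rate i E * (u1 - fsite i E) \<le> edge_rate i E * fsite i E / 7 + 2 * K"
    using fsite_left[OF E iN] by blast
  obtain u2 where u2: "u2 \<ge> 0" "edge_op N (\<lambda>E. ennreal (fsite i E)) E \<le> ennreal u2"
     "edge_rate N E * u2 \<le> 3 * K"
    using fsite_last[OF E i] by blast
  define u where "u e = (if e = i then u1 else if e = N then u2 else fsite i E)" for e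
  have "drift_le (fsite i) E (\<Sum>e\<le>N. edge_rate e E * (u e - fsite i E))"
  proof (rule drift_le_edges[OF E fsite_measurable[OF iN] fsite_nonneg])
    fix e assume "e \<le> N"
    then show "u e \<ge> 0 \<and> edge_op e (\<lambda>E. ennreal (fsite i E)) E \<le> ennreal (u e)"
      using u1 u2 fsite_unaffected[OF E iN, of e] fsite_nonneg[of i E] i by (auto simp: u_def)
  qed
  moreover have "(\<Sum>e\<le>N. edge_rate e E * (u e - fsite i E)) = edge_rate i E * (u1 - fsite i E) + edge_rate N E * (u2 - fsite i E)"
  proof -
    have "(\<Sum>e\<le>N. edge_rate e E * (u e - fsite i E)) = (\<Sum>e\<in>{i, N}. edge_rate e E * (u e - fsite i E))"
      using i by (intro sum.mono_neutral_right) (auto simp: u_def)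
    then show ?thesis using i by (auto simp: u_def)
  qed
  moreover have "edge_rate i E * fsite i E \<le> gsite i E"
    unfolding gsite_def using edge_rate_le_srate[OF E iN] fsite_nonneg by (intro mult_right_mono) auto
  moreover have "edge_rate N E * fsite i E \<ge> 0"
    using edge_rate_pos[OF E, of N] fsite_nonneg by (intro mult_nonneg_nonneg) auto
  moreover have "gsite i E \<le> 2 * K"
  proof -
    have "tail i E = E i" using i by (auto simp: tail_def)
    then have "fsite i E \<le> (1 powr q i + E i powr q i) * E i powr - (1 / 8)"
      unfolding fsite_def using powr_add_le[of "q i" 1 "E i"] pos q by (intro mult_right_mono) auto
    also have "\<dots> = E i powr - (1 / 8) + E i powr (q i - 1 / 8)"
      by (simp add: algebra_simps powr_add[symmetric])
    finally have "gsite i E \<le> srate i E * (E i powr - (1 / 8) + E i powr (q i - 1 / 8))"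
      unfolding gsite_def using srate_pos[OF E iN] by (intro mult_left_mono) auto
    also have "\<dots> = srate i E * E i powr - (1 / 8) + srate i E * E i powr (q i - 1 / 8)"
      by (simp add: distrib_left)
    also have "\<dots> \<le> K + K" using q by (intro add_mono srate_powr_le[OF E iN]) auto
    finally show ?thesis by simp
  qed
  ultimately show ?thesis using u1 u2 K by (elim drift_le_mono) (simp add: right_diff_distrib)
qed

text \<open>If the right neighbour is comparable to site \<open>i\<close>, then the exchange with it can raise \<open>fsite i\<close>,
  but the energy to the right of \<open>i\<close> is then seen at about the same level from site \<open>i + 1\<close>, whose exponent
  \<open>q (i + 1) = q i / \<kappa>\<close> is larger.\<close>
lemma gsite_chain:
  assumes E: "E \<in> space S" and i: "Suc i < N" and near: "E (Suc i) < 3 ^ 8 * E i"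
  shows "gsite i E \<le> K + 3 * K * (gsite (Suc i) E + Rsum E)"
proof -
  have pos: "E i > 0" "E (Suc i) > 0" using state_pos[OF E] i by auto
  have q: "0 < q i" "q i \<le> 1 / 8" by (rule q_bounds)+
  have iN: "i < N" using i by simp
  define t where "t = tail (Suc i) E"
  have t: "t \<ge> 0" using tail_nonneg[OF E] by (simp add: t_def)
  have "fsite i E \<le> ((1 + t) powr q i + E i powr q i) * E i powr - (1 / 8)"
    unfolding fsite_def using tail_split[OF iN, of E] powr_add_le[of "q i" "1 + t" "E i"] pos q t
    by (intro mult_right_mono) (auto simp: t_def add_ac)
  also have "\<dots> = (1 + t) powr q i * E i powr - (1 / 8) + E i powr (q i - 1 / 8)"
    by (simp add: algebra_simps powr_add[symmetric])
  finally have "gsite i E \<le> srate i E * ((1 + t) powr q i * E i powr - (1 / 8) + E i powr (q i - 1 / 8))"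
    unfolding gsite_def using srate_pos[OF E iN] by (intro mult_left_mono) auto
  also have "\<dots> = (1 + t) powr q i * (srate i E * E i powr - (1 / 8)) + srate i E * E i powr (q i - 1 / 8)"
    by (simp add: algebra_simps)
  also have "srate i E * E i powr (q i - 1 / 8) \<le> K"
    using q by (intro srate_powr_le[OF E iN]) auto
  also have "(1 + t) powr q i * (srate i E * E i powr - (1 / 8)) \<le> 3 * K * fsite (Suc i) E powr \<kappa>"
  proof -
    have "srate i E * E i powr - (1 / 8) = (srate i E * E i powr (- (1 / 8) + \<kappa> / 8)) * E i powr - (\<kappa> / 8)"
      by (simp only: mult.assoc powr_add[symmetric]) simp
    also have "\<dots> \<le> K * E i powr - (\<kappa> / 8)"
      using kappa by (intro mult_right_mono srate_powr_le[OF E iN]) auto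
    also have "E i powr - (\<kappa> / 8) \<le> (E (Suc i) / 3 ^ 8) powr - (\<kappa> / 8)"
      using near pos kappa by (intro powr_mono2') auto
    also have "(E (Suc i) / 3 ^ 8) powr - (\<kappa> / 8) = E (Suc i) powr - (\<kappa> / 8) * (3 powr 8) powr (\<kappa> / 8)"
      using pos by (simp add: powr_divide powr_minus field_simps powr_numeral)
    also have "(3 powr 8) powr (\<kappa> / 8) = 3 powr \<kappa>" by (simp add: powr_powr)
    finally have *: "srate i E * E i powr - (1 / 8) \<le> K * (E (Suc i) powr - (\<kappa> / 8) * 3 powr \<kappa>)"
      using K by simp
    have "3 powr \<kappa> \<le> 3 powr (1 :: real)" using kappa by (intro powr_mono) auto
    with * have "srate i E * E i powr - (1 / 8) \<le> 3 * K * E (Suc i) powr - (\<kappa> / 8)"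
    proof -
      have "E (Suc i) powr - (\<kappa> / 8) * 3 powr \<kappa> \<le> E (Suc i) powr - (\<kappa> / 8) * 3 powr 1"
        by (intro mult_left_mono \<open>3 powr \<kappa> \<le> _\<close>) auto
      then have "K * (E (Suc i) powr - (\<kappa> / 8) * 3 powr \<kappa>) \<le> K * (E (Suc i) powr - (\<kappa> / 8) * 3 powr 1)"
        by (rule mult_left_mono) (use K in simp)
      also have "\<dots> = 3 * K * E (Suc i) powr - (\<kappa> / 8)" by simp
      finally show ?thesis by (rule order_trans[OF *])
    qed
    then have "(1 + t) powr q i * (srate i E * E i powr - (1 / 8)) \<le> (1 + t) powr q i * (3 * K * E (Suc i) powr - (\<kappa> / 8))"
      by (intro mult_left_mono) auto
    also have "\<dots> = 3 * K * fsite (Suc i) E powr \<kappa>"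
      using pos t by (simp add: fsite_def t_def[symmetric] powr_mult powr_powr q_Suc[OF i] mult_ac)
    finally show ?thesis .
  qed
  also have "3 * K * fsite (Suc i) E powr \<kappa> \<le> 3 * K * (gsite (Suc i) E + Rsum E)"
    using K by (intro mult_left_mono fsite_powr_le[OF E i]) auto
  finally show ?thesis by simp
qed

lemma site_powr_le_Rsum:
  assumes E: "E \<in> space S" "i < N"
  shows "E i powr - (1 / 8) \<le> 1 + Rsum E"
proof (cases "E i \<le> 1")
  case True
  have pos: "E i > 0" using state_pos[OF E] .
  have "E i powr - (1 / 8) \<le> E i powr - ((\<beta> - 1) / 2)"
    using True pos \<beta> by (intro powr_mono') auto
  also have "\<dots> = srate i E powr - (\<beta> - 1)"
  proof -
    have "sqrt (E i) \<le> K" using True K by (meson order_trans real_sqrt_le_1_iff)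
    then have "srate i E = E i powr (1 / 2)" using pos by (simp add: srate_def powr_half_sqrt)
    then show ?thesis using pos by (simp add: powr_powr diff_divide_distrib)
  qed
  finally show ?thesis using srate_powr_le_Rsum[OF E] by simp
next
  case False
  then have "E i powr - (1 / 8) \<le> E i powr 0" by (intro powr_mono) auto
  then show ?thesis using False Rsum_nonneg[of E] by simp
qed

text \<open>If the right neighbour has at least \<open>3 ^ 8\<close> times the energy of
  \<open>i\<close>, their edge rings at the full rate \<open>srate i\<close>, and after the ring the
  mean is at most 8/7 * 1/3 = 8/21 of the value, a loss of 13/21. Otherwise there may be no loss,
  but \<open>gsite_chain\<close> bounds \<open>gsite i\<close> by the neighbour's
  dissipation.\<close>

lemma fsite_drift:
  assumes E: "E \<in> space S" and i: "Suc i < N"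
  shows "drift_le (fsite i) E (3 * K + K * TR * (1 + Rsum E) + 3 * K * (gsite (Suc i) E + Rsum E) - gsite i E / 4)"
proof -
  have iN: "i < N" using i by simp
  have pos: "E i > 0" "E (Suc i) > 0" using state_pos[OF E] i by auto
  have q: "0 < q i" "q i \<le> 1 / 8" by (rule q_bounds)+
  obtain u1 where u1: "u1 \<ge> 0" "edge_op i (\<lambda>E. ennreal (fsite i E)) E \<le> ennreal u1"
     "edge_rate i E * (u1 - fsite i E) \<le> edge_rate i E * fsite i E / 7 + 2 * K"
    using fsite_left[OF E iN] by blast
  define u2 where "u2 = 8 / 7 * ((1 + tail i E) powr q i * (E i + E (Suc i)) powr - (1 / 8))"
  define u3 where "u3 = fsite i E + TR * E i powr - (1 / 8)"
  define u where "u e = (if e = i then u1 else if e = Suc i then u2 else if e = N then u3 else fsite i E)" for e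
  have nn: "u2 \<ge> 0" "u3 \<ge> 0" using TR fsite_nonneg[of i E] by (auto simp: u2_def u3_def)
  have "drift_le (fsite i) E (\<Sum>e\<le>N. edge_rate e E * (u e - fsite i E))"
  proof (rule drift_le_edges[OF E fsite_measurable[OF iN] fsite_nonneg])
    fix e assume e: "e \<le> N"
    consider "e = i" | "e = Suc i" | "e = N" "e \<noteq> i" "e \<noteq> Suc i" | "e < N" "e \<noteq> i" "e \<noteq> Suc i" using e by linarith
    then show "u e \<ge> 0 \<and> edge_op e (\<lambda>E. ennreal (fsite i E)) E \<le> ennreal (u e)"
    proof cases
      case 1 then show ?thesis using u1 by (simp add: u_def)
    next
      case 2 then show ?thesis using nn fsite_right[OF E i] by (simp add: u_def u2_def)
    next
      case 3 then show ?thesis using nn fsite_far_bath[OF E i] by (simp add: u_def u3_def)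
    next
      case 4 then show ?thesis using fsite_unaffected[OF E iN] fsite_nonneg by (simp add: u_def)
    qed
  qed
  moreover have "(\<Sum>e\<le>N. edge_rate e E * (u e - fsite i E)) = edge_rate i E * (u1 - fsite i E)
      + edge_rate (Suc i) E * (u2 - fsite i E) + edge_rate N E * (TR * E i powr - (1 / 8))"
  proof -
    have "(\<Sum>e\<le>N. edge_rate e E * (u e - fsite i E)) = (\<Sum>e\<in>{i, Suc i, N}. edge_rate e E * (u e - fsite i E))"
      using i by (intro sum.mono_neutral_right) (auto simp: u_def)
    then show ?thesis using i by (simp add: u_def u3_def)
  qed
  moreover have "edge_rate N E * (TR * E i powr - (1 / 8)) \<le> K * TR * (1 + Rsum E)"
    unfolding mult.assoc using TR K site_powr_le_Rsum[OF E iN] edge_rate_le_K[of N E]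
    by (intro mult_mono mult_left_mono mult_nonneg_nonneg) auto
  moreover have r1: "edge_rate i E * fsite i E \<le> gsite i E"
    unfolding gsite_def using edge_rate_le_srate[OF E iN] fsite_nonneg by (intro mult_right_mono) auto
  moreover have r2: "edge_rate (Suc i) E * fsite i E \<le> gsite i E"
    unfolding gsite_def using edge_rate_le_srate[OF E iN] fsite_nonneg by (intro mult_right_mono) auto
  \<comment> \<open>Here 11/28 = 1/4 + 1/7, where the second summand pays for the gain at the left
    edge.\<close>
  moreover have "edge_rate (Suc i) E * (u2 - fsite i E) \<le> 3 * K * (gsite (Suc i) E + Rsum E) + K - 11 / 28 * gsite i E"
  proof (cases "E (Suc i) < 3 ^ 8 * E i")
    case True
    have "(E i + E (Suc i)) powr - (1 / 8) \<le> E i powr - (1 / 8)"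
      using pos by (intro powr_mono2') auto
    then have "u2 \<le> 8 / 7 * fsite i E"
      unfolding u2_def fsite_def by (intro mult_left_mono) auto
    then have "edge_rate (Suc i) E * (u2 - fsite i E) \<le> edge_rate (Suc i) E * (fsite i E / 7)"
      using edge_rate_pos[OF E, of "Suc i"] i by (intro mult_left_mono) auto
    then have "edge_rate (Suc i) E * (u2 - fsite i E) \<le> gsite i E / 7" using r2 by simp
    moreover have "gsite i E \<le> K + 3 * K * (gsite (Suc i) E + Rsum E)" by (rule gsite_chain[OF E i True])
    moreover have "gsite i E \<ge> 0" by (rule gsite_nonneg[OF E iN])
    ultimately show ?thesis by simp
  next
    case False
    have "E i \<le> E (Suc i)" using False pos by simp
    then have rate: "edge_rate (Suc i) E = srate i E"
      using i by (simp add: edge_rate_def rate_def srate_def)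
    have "(E i + E (Suc i)) powr - (1 / 8) \<le> (3 ^ 8 * E i) powr - (1 / 8)"
      using pos False by (intro powr_mono2') auto
    also have "\<dots> = (3 powr 8) powr - (1 / 8) * E i powr - (1 / 8)"
      using pos by (simp add: powr_mult powr_numeral)
    also have "(3 powr 8) powr - (1 / 8) = (1 / 3 :: real)"
      unfolding powr_powr by (simp add: powr_minus)
    finally have "(1 + tail i E) powr q i * (E i + E (Suc i)) powr - (1 / 8)
        \<le> (1 + tail i E) powr q i * (1 / 3 * E i powr - (1 / 8))"
      by (intro mult_left_mono) auto
    then have "u2 \<le> 8 / 21 * fsite i E"
      unfolding u2_def fsite_def by linarith
    then have "srate i E * (u2 - fsite i E) \<le> srate i E * (- 13 / 21 * fsite i E)"
      using srate_pos[OF E iN] by (intro mult_left_mono) auto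
    also have "\<dots> = - 13 / 21 * gsite i E" by (simp add: gsite_def)
    finally have "edge_rate (Suc i) E * (u2 - fsite i E) \<le> - 13 / 21 * gsite i E" by (simp add: rate)
    moreover have "gsite i E \<ge> 0" by (rule gsite_nonneg[OF E iN])
    moreover have "K * (gsite (Suc i) E + Rsum E) \<ge> 0"
      using K gsite_nonneg[OF E i] Rsum_nonneg[of E] by simp
    ultimately show ?thesis using K by simp
  qed
  ultimately show ?thesis using u1 by (elim drift_le_mono) simp
qed

text \<open>The drift at site \<open>i\<close> contains \<open>3 * K * gsite (Suc i)\<close>. With
  weights \<open>B ^ i\<close> each of these terms is at most \<open>3 * K * G / B\<close>, and
  \<open>N\<close> of them use up \<open>G / 8\<close>, half of the available loss
  \<open>G / 4\<close>.\<close>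

definition B :: real where "B = 24 * K * real N"

definition F :: "(nat \<Rightarrow> real) \<Rightarrow> real" where "F E = (\<Sum>i<N. B ^ i * fsite i E)"

definition G :: "(nat \<Rightarrow> real) \<Rightarrow> real" where "G E = (\<Sum>i<N. B ^ i * gsite i E)"

lemma B_ge: "B \<ge> 1" "B \<ge> 24 * K * real N"
proof -
  have "1 * 1 \<le> 24 * K * real N" using K N by (intro mult_mono) auto
  then show "B \<ge> 1" "B \<ge> 24 * K * real N" by (auto simp: B_def)
qed

lemma G_ge: "E \<in> space S \<Longrightarrow> i < N \<Longrightarrow> B ^ i * gsite i E \<le> G E"
  unfolding G_def using gsite_nonneg B_ge by (intro member_le_sum) auto

lemma G_nonneg: "E \<in> space S \<Longrightarrow> G E \<ge> 0"
  unfolding G_def using gsite_nonneg B_ge by (intro sum_nonneg) auto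

lemma gsite_le_G: "E \<in> space S \<Longrightarrow> i < N \<Longrightarrow> gsite i E \<le> G E"
proof -
  assume a: "E \<in> space S" "i < N"
  have "1 * gsite i E \<le> B ^ i * gsite i E"
    using B_ge gsite_nonneg[OF a] by (intro mult_right_mono one_le_power) auto
  then show ?thesis using G_ge[OF a] by simp
qed

lemma F_nonneg: "F E \<ge> 0"
  unfolding F_def using fsite_nonneg B_ge by (intro sum_nonneg) auto

lemma F_measurable: "F \<in> borel_measurable S"
  unfolding F_def[abs_def] using fsite_measurable by (intro borel_measurable_sum borel_measurable_times) auto

lemma F_drift: "\<exists>C\<ge>0. \<forall>E\<in>space S. drift_le F E (C * (1 + Rsum E) - G E / 8)"
proof -
  define c where "c = 10 * K + K * TR"
  define C where "C = real N * (B ^ N * c)"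
  have c: "c \<ge> 0" using K TR by (simp add: c_def)
  have C: "C \<ge> 0" using c B_ge by (simp add: C_def)
  have "drift_le F E (C * (1 + Rsum E) - G E / 8)" if E: "E \<in> space S" for E
  proof -
    define X where "X = 1 + Rsum E"
    have X: "X \<ge> 1" using Rsum_nonneg[of E] by (simp add: X_def)
    define d where "d i = c * X + (if Suc i < N then 3 * K * gsite (Suc i) E else 0) - gsite i E / 4" for i
    have "drift_le F E (\<Sum>i<N. B ^ i * d i)"
      unfolding F_def[abs_def]
    proof (rule drift_le_sum[OF E])
      fix i assume "i \<in> {..<N}"
      then have i: "i < N" by simp
      have KX: "K * 1 \<le> K * X" "K * TR * X \<ge> 0" using K TR X by (auto intro!: mult_left_mono)
      have "drift_le (fsite i) E (d i)"
      proof (cases "Suc i < N")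
        case True
        have "3 * K + K * TR * (1 + Rsum E) + 3 * K * (gsite (Suc i) E + Rsum E) - gsite i E / 4
            = K * TR * X + 3 * (K * X) + 3 * K * gsite (Suc i) E - gsite i E / 4"
          by (simp add: X_def algebra_simps)
        then show ?thesis using True KX K
          by (intro drift_le_mono[OF fsite_drift[OF E True]]) (simp add: d_def c_def distrib_right mult.assoc)
      next
        case False
        then have "Suc i = N" using i by simp
        moreover have "7 * K \<le> c * X"
        proof -
          have "c * X = 10 * (K * X) + K * TR * X" by (simp add: c_def algebra_simps)
          then show ?thesis using KX K by linarith
        qed
        ultimately show ?thesis using False
          by (intro drift_le_mono[OF fsite_drift_last[OF E]]) (simp_all add: d_def)
      qed
      then show "drift_le (\<lambda>E. B ^ i * fsite i E) E (B ^ i * d i)"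
        using B_ge by (intro drift_le_scale[OF E fsite_measurable[OF i]] fsite_nonneg) auto
      show "(\<lambda>E. B ^ i * fsite i E) \<in> borel_measurable S" using fsite_measurable[OF i] by simp
      show "B ^ i * fsite i E \<ge> 0" for E using B_ge fsite_nonneg by simp
    qed auto
    moreover have "(\<Sum>i<N. B ^ i * d i) \<le> C * (1 + Rsum E) - G E / 8"
    proof -
      have "B ^ i * d i \<le> B ^ N * c * X + 3 * K * (G E / B) - B ^ i * gsite i E / 4" if i: "i < N" for i
      proof -
        have "B ^ i * (c * X) \<le> B ^ N * (c * X)"
          using B_ge c X i by (intro mult_right_mono power_increasing) auto
        moreover have "B ^ i * (if Suc i < N then 3 * K * gsite (Suc i) E else 0) \<le> 3 * K * (G E / B)"
        proof (cases "Suc i < N")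
          case True
          have "B * (B ^ i * gsite (Suc i) E) \<le> G E" using G_ge[OF E True] by (simp add: mult.assoc)
          then have "B ^ i * gsite (Suc i) E \<le> G E / B" using B_ge by (simp add: field_simps)
          then have "3 * K * (B ^ i * gsite (Suc i) E) \<le> 3 * K * (G E / B)" using K by (intro mult_left_mono) auto
          then show ?thesis using True by (simp add: mult_ac)
        qed (use K G_nonneg[OF E] B_ge in auto)
        ultimately show ?thesis unfolding d_def by (simp add: distrib_left right_diff_distrib mult.assoc)
      qed
      then have "(\<Sum>i<N. B ^ i * d i) \<le> (\<Sum>i<N. B ^ N * c * X + 3 * K * (G E / B) - B ^ i * gsite i E / 4)"
        by (intro sum_mono) auto
      also have "\<dots> = C * X + real N * (3 * K * (G E / B)) - G E / 4"
        by (simp add: sum_subtractf G_def C_def sum_divide_distrib algebra_simps)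
      also have "real N * (3 * K * (G E / B)) \<le> G E / 8"
      proof -
        have "24 * K * real N * G E \<le> B * G E" using B_ge G_nonneg[OF E] by (intro mult_right_mono) auto
        then show ?thesis using B_ge by (simp add: field_simps)
      qed
      finally show ?thesis by (simp add: X_def)
    qed
    ultimately show ?thesis by (rule drift_le_mono)
  qed
  then show ?thesis using C by blast
qed

lemma F_powr_le: "\<exists>C\<ge>0. \<forall>E\<in>space S. F E powr \<kappa> \<le> C * (G E + Rsum E)"
proof -
  have "F E powr \<kappa> \<le> (\<Sum>i<N. B ^ i) * (G E + Rsum E)" if E: "E \<in> space S" for E
  proof -
    have "F E powr \<kappa> \<le> (\<Sum>i<N. (B ^ i * fsite i E) powr \<kappa>)"
      unfolding F_def using kappa B_ge fsite_nonneg by (intro sum_powr_le) auto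
    also have "\<dots> \<le> (\<Sum>i<N. B ^ i * (G E + Rsum E))"
    proof (rule sum_mono)
      fix i assume "i \<in> {..<N}"
      then have i: "i < N" by simp
      have b: "B ^ i \<ge> 1" using B_ge by (intro one_le_power) auto
      then have "(B ^ i) powr \<kappa> \<le> (B ^ i) powr 1" using kappa by (intro powr_mono) auto
      then have "(B ^ i) powr \<kappa> \<le> B ^ i" using b by simp
      moreover have "fsite i E powr \<kappa> \<le> G E + Rsum E"
        using fsite_powr_le[OF E i] gsite_le_G[OF E i] by simp
      ultimately have "(B ^ i) powr \<kappa> * fsite i E powr \<kappa> \<le> B ^ i * (G E + Rsum E)"
        using b by (intro mult_mono) auto
      then show "(B ^ i * fsite i E) powr \<kappa> \<le> B ^ i * (G E + Rsum E)"
        using b fsite_nonneg by (simp add: powr_mult)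
    qed
    finally show ?thesis by (simp add: sum_distrib_right)
  qed
  moreover have "(\<Sum>i<N. B ^ i) \<ge> 0" using B_ge by (intro sum_nonneg) auto
  ultimately show ?thesis by blast
qed

text \<open>For a site below \<open>K\<^sup>2\<close> the singular factor is bounded below, so a
  large energy to its right must show up in \<open>fsite j\<close> and hence in \<open>G\<close>.
  This pays for the edges whose rate falls short of \<open>K\<close> in the drift of
  \<open>U\<close>.\<close>

lemma tail_powr_le:
  assumes E: "E \<in> space S" and j: "j < N" and low: "E j \<le> K\<^sup>2"
  shows "(1 + tail j E) powr (\<kappa> * q j) \<le> K * (G E + Rsum E)"
proof -
  have pos: "E j > 0" using state_pos[OF E j] .
  have "fsite j E powr \<kappa> = (1 + tail j E) powr (\<kappa> * q j) * E j powr - (\<kappa> / 8)"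
    using tail_nonneg[OF E, of j] by (simp add: fsite_def powr_mult powr_powr mult_ac)
  moreover have "1 / K \<le> E j powr - (\<kappa> / 8)"
  proof -
    have "K powr - 1 \<le> K powr - (\<kappa> / 4)" using K kappa by (intro powr_mono) auto
    also have "\<dots> = (K\<^sup>2) powr - (\<kappa> / 8)"
      using K by (simp add: powr_numeral[symmetric] powr_powr del: powr_numeral)
    also have "\<dots> \<le> E j powr - (\<kappa> / 8)" using low pos kappa by (intro powr_mono2') auto
    finally show ?thesis using K by (simp add: powr_minus field_simps)
  qed
  ultimately have "(1 + tail j E) powr (\<kappa> * q j) * (1 / K) \<le> fsite j E powr \<kappa>"
    using mult_left_mono[of "1 / K" "E j powr - (\<kappa> / 8)" "(1 + tail j E) powr (\<kappa> * q j)"] by simp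
  also have "\<dots> \<le> G E + Rsum E"
    using fsite_powr_le[OF E j] gsite_le_G[OF E j] by simp
  finally show ?thesis using K by (simp add: field_simps)
qed

text \<open>After splitting each product by x * y \<le> x^2 + y^2, the high energies occur with
  power at most 1 and the low ones with exponent -1/4, which near 0 is weaker than
  -\<beta>/2.\<close>

lemma F_le: "\<exists>C\<ge>0. \<forall>E\<in>space S. F E \<le> C * (1 + (\<Sum>i<N. E i) + (\<Sum>i<N. E i powr - (\<beta> / 2)))"
proof -
  have "F E \<le> (\<Sum>i<N. B ^ i * 2) * (1 + (\<Sum>i<N. E i) + (\<Sum>i<N. E i powr - (\<beta> / 2)))" if E: "E \<in> space S" for E
    unfolding F_def sum_distrib_right
  proof (rule sum_mono)
    fix i assume "i \<in> {..<N}"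
    then have i: "i < N" by simp
    have pos: "E i > 0" using state_pos[OF E i] .
    have q: "0 < q i" "q i \<le> 1 / 8" by (rule q_bounds)+
    let ?w = "1 + (\<Sum>i<N. E i)" and ?z = "\<Sum>i<N. E i powr - (\<beta> / 2)"
    have w: "1 + tail i E \<le> ?w"
      unfolding tail_def using state_pos[OF E] by (intro add_left_mono sum_mono2) (auto intro: less_imp_le)
    have w1: "1 + tail i E \<ge> 1" using tail_nonneg[OF E] by simp
    have "(1 + tail i E) powr q i \<le> (1 + tail i E) powr (1 / 2)" using w1 q by (intro powr_mono) auto
    also have "\<dots> \<le> ?w powr (1 / 2)" using w w1 by (intro powr_mono2) auto
    finally have a: "(1 + tail i E) powr q i \<le> ?w powr (1 / 2)" .
    have b: "(E i powr - (1 / 8))\<^sup>2 \<le> 1 + ?z"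
    proof (cases "E i \<le> 1")
      case True
      have "(E i powr - (1 / 8))\<^sup>2 = E i powr - (1 / 4)"
        using pos by (simp add: powr_numeral[symmetric] powr_powr del: powr_numeral)
      also have "\<dots> \<le> E i powr - (\<beta> / 2)" using True pos \<beta> by (intro powr_mono') auto
      also have "\<dots> \<le> ?z" using i by (intro member_le_sum) auto
      finally show ?thesis by simp
    next
      case False
      then have "E i powr - (1 / 8) \<le> 1" using powr_mono[of "-(1/8)" 0 "E i"] by simp
      then have "(E i powr - (1 / 8))\<^sup>2 \<le> 1" by (simp add: power_le_one)
      then show ?thesis by (simp add: add_increasing2 sum_nonneg)
    qed
    have "fsite i E \<le> ?w powr (1 / 2) * E i powr - (1 / 8)"
      unfolding fsite_def using a by (intro mult_right_mono) auto
    also have "\<dots> \<le> (?w powr (1 / 2))\<^sup>2 + (E i powr - (1 / 8))\<^sup>2"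
    proof -
      have "x * y \<le> x\<^sup>2 + y\<^sup>2" if "x \<ge> 0" "y \<ge> 0" for x y :: real
        using sum_squares_bound[of x y] mult_nonneg_nonneg[OF that] by linarith
      then show ?thesis by simp
    qed
    also have "(?w powr (1 / 2))\<^sup>2 = ?w"
      using w w1 by (simp add: powr_half_sqrt)
    finally have "fsite i E \<le> ?w + (E i powr - (1 / 8))\<^sup>2" .
    moreover have "?z \<ge> 0" by (intro sum_nonneg) auto
    ultimately have "fsite i E \<le> ?w + (1 + ?z)" "?w \<ge> 1" using order_trans[OF w1 w] b by linarith+
    then have "fsite i E \<le> 2 * (?w + ?z)" using \<open>?z \<ge> 0\<close> by (simp add: distrib_left)
    then have "B ^ i * fsite i E \<le> B ^ i * (2 * (?w + ?z))" using B_ge by (intro mult_left_mono) auto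
    then show "B ^ i * fsite i E \<le> B ^ i * 2 * (?w + ?z)" by (simp add: mult.assoc)
  qed
  moreover have "(\<Sum>i<N. B ^ i * 2) \<ge> 0" using B_ge by (intro sum_nonneg) auto
  ultimately show ?thesis by blast
qed

end

lemma half_le:
  fixes a b :: real
  shows "a \<le> b \<Longrightarrow> 0 \<le> b \<Longrightarrow> a / 2 \<le> b" "0 \<le> a \<Longrightarrow> 0 \<le> b \<Longrightarrow> - ((a - b) / 2) \<le> b"
  by (simp_all add: field_simps)

text \<open>Summation by parts with geometric weights: if all rates were equal, the exchanges would
  remove a multiple of every energy, except for the one positive term \<open>E 0\<close> that is
  left to the bath.\<close>

lemma sum_halving:
  fixes E :: "nat \<Rightarrow> real"
  shows "(\<Sum>k<n. (1 / 2) ^ Suc k * (E k - E (Suc k)))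
    = E 0 - (\<Sum>k\<le>n. (1 / 2) ^ Suc k * E k) - (1 / 2) ^ Suc n * E n"
proof (induction n)
  case (Suc n)
  have "(\<Sum>k\<le>Suc n. (1 / 2) ^ Suc k * E k) = (\<Sum>k\<le>n. (1 / 2) ^ Suc k * E k) + (1 / 2) ^ Suc (Suc n) * E (Suc n)"
    by simp
  moreover have "(1 / 2) ^ Suc (Suc n) * E (Suc n) + (1 / 2) ^ Suc (Suc n) * E (Suc n) = (1 / 2) ^ Suc n * E (Suc n)"
    by simp
  ultimately show ?case
    unfolding sum.lessThan_Suc Suc.IH by (simp only: right_diff_distrib)
qed simp

context lyapunov
begin

subsection \<open>High energies\<close>

text \<open>A lower bound for the rate of the left bath edge as soon as
  \<open>E 0 \<ge> 1\<close>.\<close>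

definition rmin :: real where "rmin = min 1 (sqrt TL)"

text \<open>The increments are \<open>(1 / 2) ^ Suc k\<close>, which leads to the sum in
  \<open>sum_halving\<close>. The offset gives \<open>rmin * lw 0 / 2 = K\<close>, so that the left
  bath removes about \<open>K * E 0\<close>, more than the exchanges leave over there.\<close>

definition lw :: "nat \<Rightarrow> real" where "lw k = 2 * K / rmin + 1 - (1 / 2) ^ k"

definition Lin :: "(nat \<Rightarrow> real) \<Rightarrow> real" where "Lin E = (\<Sum>k<N. lw k * E k)"

text \<open>Small enough to be at most \<open>\<kappa> * q j\<close> for every site
  \<open>j\<close>, the exponents for which \<open>tail_powr_le\<close> can pay.\<close>

definition sx :: real where "sx = \<kappa> ^ N / 8"

definition U :: "(nat \<Rightarrow> real) \<Rightarrow> real" where "U E = (1 + Lin E) powr sx"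

lemma rmin: "0 < rmin" "rmin \<le> 1" using TL by (auto simp: rmin_def)

lemma lw_bounds: "2 * K / rmin \<le> lw k" "lw k \<le> 2 * K / rmin + 1" "lw k \<ge> 1"
proof -
  have "K * rmin \<le> K * 1" using K rmin by (intro mult_left_mono) auto
  then have "K \<le> K / rmin" using rmin by (simp add: field_simps)
  then have "1 \<le> 2 * K / rmin" using K by simp
  moreover have "(1 / 2 :: real) ^ k \<le> 1" by (intro power_le_one) auto
  ultimately show "2 * K / rmin \<le> lw k" "lw k \<le> 2 * K / rmin + 1" "lw k \<ge> 1"
    by (auto simp: lw_def)
qed

lemma sx: "0 < sx" "sx \<le> 1 / 8"
proof -
  show "0 < sx" using kappa by (simp add: sx_def)
  have "\<kappa> ^ N \<le> 1" using kappa by (intro power_le_one) auto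
  then show "sx \<le> 1 / 8" by (simp add: sx_def)
qed

lemma sx_le: "j < N \<Longrightarrow> sx \<le> \<kappa> * q j"
proof -
  assume "j < N"
  have "\<kappa> * q j = \<kappa> ^ Suc (N - 1 - j) / 8" by (simp add: q_def)
  moreover have "\<kappa> ^ N \<le> \<kappa> ^ Suc (N - 1 - j)"
    using kappa \<open>j < N\<close> by (intro power_decreasing) auto
  ultimately show ?thesis unfolding sx_def by linarith
qed

lemma Lin_ge:
  assumes E: "E \<in> space S"
  shows "Lin E \<ge> (\<Sum>k<N. E k)" "j < N \<Longrightarrow> Lin E \<ge> lw j * E j" "Lin E \<ge> 0"
    "Lin E \<le> (2 * K / rmin + 1) * (\<Sum>k<N. E k)"
proof -
  have p: "k < N \<Longrightarrow> E k \<ge> 0" for k using state_pos[OF E] by (auto intro: less_imp_le)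
  have l: "lw k \<ge> 0" for k using lw_bounds(3)[of k] by simp
  have "1 * E k \<le> lw k * E k" if "k < N" for k using p that lw_bounds by (intro mult_right_mono) auto
  then show 1: "Lin E \<ge> (\<Sum>k<N. E k)" unfolding Lin_def by (intro sum_mono) simp
  show "Lin E \<ge> lw j * E j" if "j < N"
    unfolding Lin_def by (rule member_le_sum) (use p l that in auto)
  show "Lin E \<ge> 0" using 1 p by (meson order_trans sum_nonneg lessThan_iff)
  show "Lin E \<le> (2 * K / rmin + 1) * (\<Sum>k<N. E k)"
    unfolding Lin_def sum_distrib_left using p lw_bounds by (intro sum_mono mult_right_mono) auto
qed

lemma Lin_upd: "i < N \<Longrightarrow> Lin (E(i := z)) = Lin E + lw i * (z - E i)"
proof -
  assume i: "i < N"
  have "(\<lambda>k. lw k * (E(i := z)) k) = (\<lambda>k. lw k * E k)(i := lw i * z)" by auto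
  then have "Lin (E(i := z)) = sum ((\<lambda>k. lw k * E k)(i := lw i * z)) {..<N}" by (simp only: Lin_def)
  also have "\<dots> = Lin E + (lw i * z - lw i * E i)"
    using i by (subst sum_fun_upd) (auto simp: Lin_def)
  finally show ?thesis by (simp add: algebra_simps)
qed

definition dU :: "(nat \<Rightarrow> real) \<Rightarrow> real" where "dU E = sx * (1 + Lin E) powr (sx - 1)"

lemma U_tangent:
  assumes "Lin E \<ge> 0" "Lin E' \<ge> 0"
  shows "U E' \<le> U E + dU E * (Lin E' - Lin E)"
proof -
  define a where "a = 1 + Lin E"
  define b where "b = 1 + Lin E'"
  have ab: "a > 0" "b > 0" using assms by (auto simp: a_def b_def)
  have "(b / a) powr sx * 1 powr (1 - sx) \<le> sx * (b / a) + (1 - sx) * 1"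
    using ab sx by (intro Youngs_inequality_0) auto
  then have "a powr sx * (b / a) powr sx \<le> a powr sx * (sx * (b / a) + (1 - sx))"
    by (intro mult_left_mono) auto
  moreover have "a powr sx * (b / a) powr sx = b powr sx"
    using ab by (simp add: powr_divide)
  moreover have "a powr sx * (sx * (b / a) + (1 - sx)) = a powr sx + sx * a powr (sx - 1) * (b - a)"
    using ab by (simp add: powr_diff field_simps)
  ultimately show ?thesis by (simp add: U_def dU_def a_def b_def)
qed

lemma U_ge1: "E \<in> space S \<Longrightarrow> U E \<ge> 1"
  using Lin_ge(3)[of E] sx by (simp add: U_def ge_one_powr_ge_zero)

lemma dU_bounds:
  assumes E: "E \<in> space S"
  shows "0 \<le> dU E" "dU E \<le> 1" "dU E * (1 + Lin E) = sx * U E" "j < N \<Longrightarrow> dU E * (lw j * E j) \<le> U E"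
proof -
  have l: "Lin E \<ge> 0" by (rule Lin_ge[OF E])
  show 0: "0 \<le> dU E" using sx by (simp add: dU_def)
  have "(1 + Lin E) powr (sx - 1) \<le> (1 + Lin E) powr 0" using l sx by (intro powr_mono) auto
  then have "sx * (1 + Lin E) powr (sx - 1) \<le> 1 * 1" using sx l by (intro mult_mono) auto
  then show "dU E \<le> 1" by (simp add: dU_def)
  show 1: "dU E * (1 + Lin E) = sx * U E" using l by (simp add: dU_def U_def powr_diff)
  assume j: "j < N"
  have "dU E * (lw j * E j) \<le> dU E * (1 + Lin E)"
    using Lin_ge(2)[OF E j] 0 by (intro mult_left_mono) auto
  also have "\<dots> \<le> 1 * U E" unfolding 1 using sx U_ge1[OF E] by (intro mult_right_mono) auto
  finally show "dU E * (lw j * E j) \<le> U E" by simp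
qed

lemma U_measurable: "U \<in> borel_measurable S"
  unfolding U_def[abs_def] Lin_def
  by (intro powr_real_measurable borel_measurable_add borel_measurable_sum borel_measurable_times
      borel_measurable_const measurable_site) auto

text \<open>An exchange moves on average half of the difference of the two energies from
  \<open>i\<close> to \<open>Suc i\<close>, where the weight is larger by
  \<open>(1 / 2) ^ Suc i\<close>. By concavity \<open>U\<close> may be replaced by its tangent in
  \<open>Lin\<close>, which is averaged exactly.\<close>

lemma U_exchange:
  assumes E: "E \<in> space S" and i: "Suc i < N"
  shows "edge_op (Suc i) (\<lambda>E. ennreal (U E)) E
    \<le> ennreal (U E + dU E * ((1 / 2) ^ Suc i * (E i - E (Suc i)) / 2))"
proof -
  have pos: "E i > 0" "E (Suc i) > 0" using state_pos[OF E] i by auto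
  define w where "w = (1 / 2 :: real) ^ Suc i"
  have w: "w \<ge> 0" "lw (Suc i) = lw i + w" by (auto simp: w_def lw_def)
  define T where "T = E i + E (Suc i)"
  have d: "dU E * (w * E (Suc i)) \<le> U E"
  proof -
    have "w \<le> lw (Suc i)" using w lw_bounds(3)[of i] by simp
    then have "dU E * (w * E (Suc i)) \<le> dU E * (lw (Suc i) * E (Suc i))"
      using dU_bounds(1)[OF E] pos by (intro mult_left_mono mult_right_mono) auto
    also have "\<dots> \<le> U E" by (rule dU_bounds(4)[OF E i])
    finally show ?thesis .
  qed
  have "exchange_op i (\<lambda>E. ennreal (U E)) E
      \<le> ennreal ((U E - dU E * (w * E (Suc i))) + 0 / (1 - 0) + (dU E * (w * T)) / 2)"
  proof (rule exchange_op_le_affine_reflect[OF E i])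
    fix p :: real assume p: "0 < p" "p < 1"
    let ?E = "E(i := (1 - p) * (E i + E (Suc i)), Suc i := p * (E i + E (Suc i)))"
    have sp: "?E \<in> space S" using p pos i
      by (intro state_upd E) (auto intro!: mult_pos_pos)
    have "Lin ?E - Lin E = lw i * ((1 - p) * T - E i) + lw (Suc i) * (p * T - E (Suc i))"
      using i by (simp add: Lin_upd T_def)
    also have "\<dots> = w * (p * T - E (Suc i))" unfolding w by (simp add: T_def algebra_simps)
    finally have "Lin ?E - Lin E = w * (p * T - E (Suc i))" .
    then have "U ?E \<le> U E + dU E * (w * (p * T - E (Suc i)))"
      using U_tangent[of E ?E] Lin_ge(3)[OF E] Lin_ge(3)[OF sp] by simp
    then show "U ?E \<le> (U E - dU E * (w * E (Suc i))) + 0 * p powr - 0 + dU E * (w * T) * p"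
      by (simp add: algebra_simps)
  qed (use d dU_bounds(1)[OF E] w pos in \<open>auto simp: T_def\<close>)
  also have "(U E - dU E * (w * E (Suc i))) + 0 / (1 - 0) + (dU E * (w * T)) / 2
      = U E + dU E * (w * (E i - E (Suc i)) / 2)"
    by (simp add: T_def field_simps)
  finally show ?thesis using i by (simp add: edge_op_def w_def)
qed

lemma U_bath:
  assumes E: "E \<in> space S" and i: "i < N" and T: "T > 0"
  shows "bath_op T i (\<lambda>E. ennreal (U E)) E \<le> ennreal (U E + dU E * (lw i * (T - E i) / 2))"
proof -
  have pos: "E i > 0" using state_pos[OF E i] .
  have l: "lw i \<ge> 0" using lw_bounds(3)[of i] by simp
  have "bath_op T i (\<lambda>E. ennreal (U E)) E
      \<le> ennreal ((U E - dU E * (lw i * E i)) + 0 / (1 - 0) + 0 * T + (dU E * lw i) * (E i + T) / 2)"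
  proof (rule bath_op_le_affine)
    fix p x :: real assume p: "0 < p" "p < 1" and x: "x \<ge> 0"
    let ?E = "E(i := p * (E i + x))"
    have sp: "?E \<in> space S" using p pos i x
      by (intro state_upd E) (auto intro!: mult_pos_pos)
    have "U ?E \<le> U E + dU E * (lw i * (p * (E i + x) - E i))"
      using U_tangent[of E ?E] Lin_ge(3)[OF E] Lin_ge(3)[OF sp] i by (simp add: Lin_upd)
    then show "U ?E \<le> (U E - dU E * (lw i * E i)) + 0 * p powr - 0 + 0 * x + dU E * lw i * (p * (E i + x))"
      by (simp add: algebra_simps)
  qed (use dU_bounds[OF E] pos T i l in auto)
  also have "(U E - dU E * (lw i * E i)) + 0 / (1 - 0) + 0 * T + (dU E * lw i) * (E i + T) / 2
     = U E + dU E * (lw i * (T - E i) / 2)"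
    by (simp add: field_simps)
  finally show ?thesis .
qed

lemma U_drift_linear:
  assumes E: "E \<in> space S"
  shows "drift_le U E (dU E * ((\<Sum>k<N-1. edge_rate (Suc k) E * ((1 / 2) ^ Suc k * (E k - E (Suc k)) / 2))
     + edge_rate 0 E * (lw 0 * (TL - E 0) / 2) + edge_rate N E * (lw (N - 1) * (TR - E (N - 1)) / 2)))"
proof -
  define v where "v e = (if e = 0 then lw 0 * (TL - E 0) / 2 else if e = N then lw (N - 1) * (TR - E (N - 1)) / 2
    else (1 / 2) ^ e * (E (e - 1) - E e) / 2)" for e
  have U0: "U E \<ge> 0" using U_ge1[OF E] by simp
  \<comment> \<open>Needed for the sign condition of \<open>drift_le_edges\<close>: the mean of
    \<open>Lin\<close> falls by at most the weighted energy of one site, and \<open>dU\<close> times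
    that energy is at most \<open>U\<close>.\<close>
  have nn: "U E + dU E * v e \<ge> 0" if e: "e \<le> N" for e
  proof -
    have "- v e \<le> lw (if e = N then N - 1 else e) * E (if e = N then N - 1 else e)"
    proof -
      have p: "k < N \<Longrightarrow> lw k * E k \<ge> 0" for k
        using state_pos[OF E, of k] lw_bounds(3)[of k] by (intro mult_nonneg_nonneg) auto
      consider "e = 0" | "e = N" "e \<noteq> 0" | "0 < e" "e < N" using e by linarith
      then show ?thesis
      proof cases
        case 1
        have "lw 0 * TL \<ge> 0" using TL lw_bounds(3)[of 0] by simp
        moreover have "v e = (lw 0 * TL - lw 0 * E 0) / 2" using 1 by (simp add: v_def right_diff_distrib)
        moreover have "lw 0 * E 0 \<ge> 0" using p[of 0] N by simp
        ultimately have "- v e \<le> lw 0 * E 0" using half_le(2) by metis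
        then show ?thesis using 1 N by simp
      next
        case 2
        have "lw (N - 1) * TR \<ge> 0" using TR lw_bounds(3)[of "N - 1"] by simp
        moreover have "v e = (lw (N - 1) * TR - lw (N - 1) * E (N - 1)) / 2" using 2 by (simp add: v_def right_diff_distrib)
        moreover have "lw (N - 1) * E (N - 1) \<ge> 0" using p[of "N - 1"] N by simp
        ultimately have "- v e \<le> lw (N - 1) * E (N - 1)" using half_le(2) by metis
        then show ?thesis using 2 by simp
      next
        case 3
        then have "E (e - 1) > 0" "E e > 0" using state_pos[OF E] by auto
        moreover have "(1 / 2 :: real) ^ e \<le> 1" by (intro power_le_one) auto
        ultimately have "(1 / 2) ^ e * E (e - 1) \<ge> 0" "(1 / 2) ^ e * E e \<le> lw e * E e" "(1 / 2) ^ e * E e \<ge> 0"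
          using lw_bounds(3)[of e] by (auto intro!: mult_right_mono)
        moreover have "- v e = (1 / 2) ^ e * E e / 2 - (1 / 2) ^ e * E (e - 1) / 2"
          using 3 by (simp add: v_def right_diff_distrib diff_divide_distrib)
        ultimately show ?thesis using 3 by simp
      qed
    qed
    then have "dU E * (- v e) \<le> dU E * (lw (if e = N then N - 1 else e) * E (if e = N then N - 1 else e))"
      using dU_bounds(1)[OF E] by (rule mult_left_mono)
    also have "\<dots> \<le> U E" using e N by (intro dU_bounds(4)[OF E]) auto
    finally show ?thesis by simp
  qed
  have "drift_le U E (\<Sum>e\<le>N. edge_rate e E * ((U E + dU E * v e) - U E))"
  proof (rule drift_le_edges[OF E U_measurable U0])
    fix e assume e: "e \<le> N"
    have "edge_op e (\<lambda>E. ennreal (U E)) E \<le> ennreal (U E + dU E * v e)"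
    proof -
      consider "e = 0" | "e = N" "e \<noteq> 0" | i where "e = Suc i" "Suc i < N"
        using e by (cases e) (auto simp: le_less)
      then show ?thesis
      proof cases
        case 1
        then show ?thesis using U_bath[OF E _ TL, of 0] N by (simp add: edge_op_def v_def)
      next
        case 2
        then show ?thesis using U_bath[OF E _ TR, of "N - 1"] N by (simp add: edge_op_def v_def)
      next
        case 3
        then show ?thesis using U_exchange[OF E, of i] by (simp add: v_def)
      qed
    qed
    then show "U E + dU E * v e \<ge> 0 \<and> edge_op e (\<lambda>E. ennreal (U E)) E \<le> ennreal (U E + dU E * v e)"
      using nn[OF e] by blast
  qed
  moreover have "(\<Sum>e\<le>N. edge_rate e E * ((U E + dU E * v e) - U E)) = dU E * (\<Sum>e\<le>N. edge_rate e E * v e)"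
    by (simp add: sum_distrib_left mult_ac)
  moreover have "(\<Sum>e\<le>N. edge_rate e E * v e) = (\<Sum>k<N-1. edge_rate (Suc k) E * ((1 / 2) ^ Suc k * (E k - E (Suc k)) / 2))
     + edge_rate 0 E * (lw 0 * (TL - E 0) / 2) + edge_rate N E * (lw (N - 1) * (TR - E (N - 1)) / 2)"
  proof -
    have "(\<Sum>k<N-1. edge_rate (Suc k) E * v (Suc k)) = (\<Sum>k<N-1. edge_rate (Suc k) E * ((1 / 2) ^ Suc k * (E k - E (Suc k)) / 2))"
      by (intro sum.cong) (auto simp: v_def)
    then show ?thesis unfolding sum_edges using N by (simp add: v_def)
  qed
  ultimately show ?thesis by simp
qed

text \<open>If the exchange at an edge runs below the full rate \<open>K\<close>, then one of its two sites has energy below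
  \<open>K\<^sup>2\<close>; the left one is the only problem, and then \<open>G\<close> is large.\<close>
lemma U_drift: "\<exists>c C. 0 < c \<and> 0 \<le> C \<and> (\<forall>E\<in>space S. drift_le U E (C * (1 + G E + Rsum E) - c * U E))"
proof -
  define M where "M = 2 * K / rmin + 1"
  have M: "M \<ge> 1" using lw_bounds(3)[of 0] lw_bounds(2)[of 0] by (simp add: M_def)
  define a where "a = K / 2 * (1 / 2) ^ N"
  have a: "a > 0" using K by (simp add: a_def)
  define c where "c = a / M * sx"
  have c: "c > 0" using a M sx by (simp add: c_def)
  define C1 where "C1 = real N * (K * K\<^sup>2) + K + K * (M * TL) + K * (M * TR)"
  have C1: "C1 \<ge> 0" using K M TL TR by (simp add: C1_def)
  define C where "C = C1 + a + real N * K * K"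
  have C: "C \<ge> 0" using C1 a K by (simp add: C_def)
  have "drift_le U E (C * (1 + G E + Rsum E) - c * U E)" if E: "E \<in> space S" for E
  proof -
    have p: "k < N \<Longrightarrow> E k > 0" for k using state_pos[OF E] .
    define W where "W = (\<Sum>k<N. E k)"
    define bad where "bad k = (if E k < K\<^sup>2 then E (Suc k) else 0)" for k
    have edge: "edge_rate (Suc k) E * ((1 / 2) ^ Suc k * (E k - E (Suc k)) / 2)
       \<le> K / 2 * ((1 / 2) ^ Suc k * (E k - E (Suc k))) + K * bad k + K * K\<^sup>2" if k: "k < N - 1" for k
    proof -
      define h where "h = (1 / 2 :: real) ^ Suc k / 2"
      have h: "h \<ge> 0" "h \<le> 1" using power_le_one[of "1 / 2 :: real" "Suc k"] by (auto simp: h_def)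
      define r where "r = edge_rate (Suc k) E"
      have r: "0 \<le> r" "r \<le> K" using edge_rate_pos[OF E, of "Suc k"] edge_rate_le_K k by (auto simp: r_def less_imp_le)
      have pk: "E k > 0" "E (Suc k) > 0" using p k by auto
      have "(K - r) * E (Suc k) \<le> K * bad k + K * K\<^sup>2"
      proof (cases "r = K")
        case True
        then show ?thesis using K pk by (simp add: bad_def)
      next
        case False
        have "Suc k \<noteq> N" using k by simp
        then have "r = rate K (E k) (E (Suc k))" by (simp add: r_def edge_rate_def)
        then have "sqrt (min (E k) (E (Suc k))) < K" using False by (auto simp: rate_def min_def split: if_splits)
        then have "(sqrt (min (E k) (E (Suc k))))\<^sup>2 < K\<^sup>2"
          using pk by (intro power_strict_mono) auto
        then have "min (E k) (E (Suc k)) < K\<^sup>2" using pk by simp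
        then have "E (Suc k) \<le> bad k + K\<^sup>2" using pk by (auto simp: bad_def min_def split: if_splits)
        then have "K * E (Suc k) \<le> K * (bad k + K\<^sup>2)" using K by (intro mult_left_mono) auto
        moreover have "(K - r) * E (Suc k) \<le> K * E (Suc k)" using r pk by (intro mult_right_mono) auto
        ultimately show ?thesis by (simp add: distrib_left)
      qed
      then have "h * ((K - r) * E (Suc k)) \<le> h * (K * bad k + K * K\<^sup>2)" using h by (intro mult_left_mono) auto
      also have "\<dots> \<le> 1 * (K * bad k + K * K\<^sup>2)"
        using h K pk by (intro mult_right_mono) (auto simp: bad_def)
      finally have 1: "h * ((K - r) * E (Suc k)) \<le> K * bad k + K * K\<^sup>2" by simp
      have 2: "h * (r * E k) \<le> h * (K * E k)" using h r pk by (intro mult_left_mono mult_right_mono) auto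
      have "r * (h * (E k - E (Suc k))) \<le> K * (h * (E k - E (Suc k))) + (K * bad k + K * K\<^sup>2)"
        using 1 2 by (simp add: algebra_simps)
      then show ?thesis by (simp add: r_def h_def mult_ac)
    qed
    \<comment> \<open>For \<open>E 0 > 1\<close> the rate is at least \<open>rmin\<close>, and the
      choice of \<open>lw 0\<close> yields the loss \<open>K * E 0\<close>; for
      \<open>E 0 \<le> 1\<close> that term is at most the separate summand \<open>K\<close>.\<close>
    have bath0: "edge_rate 0 E * (lw 0 * (TL - E 0) / 2) \<le> K + K * (M * TL) - K * E 0"
    proof -
      have p0: "E 0 > 0" using p N by simp
      have l: "0 \<le> lw 0" "lw 0 \<le> M" using lw_bounds[of 0] by (auto simp: M_def)
      have "edge_rate 0 E * (lw 0 * TL / 2) \<le> K * (M * TL)"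
        using edge_rate_le_K[of 0 E] edge_rate_pos[OF E, of 0] l TL M K
        by (intro mult_mono) (auto intro: order_trans[of _ "lw 0 * TL"] mult_right_mono)
      moreover have "K * E 0 \<le> edge_rate 0 E * (lw 0 * E 0 / 2) + K"
      proof (cases "E 0 \<le> 1")
        case True
        then have "K * E 0 \<le> K * 1" using K by (intro mult_left_mono) auto
        moreover have "edge_rate 0 E * (lw 0 * E 0 / 2) \<ge> 0"
          using edge_rate_pos[OF E, of 0] l p0 by (intro mult_nonneg_nonneg) auto
        ultimately show ?thesis by simp
      next
        case False
        have "rmin \<le> edge_rate 0 E"
        proof -
          have "rmin \<le> sqrt (min TL (E 0))"
          proof (cases "TL \<le> E 0")
            case nle: False
            have "rmin \<le> 1" by (rule rmin)
            also have "1 \<le> sqrt (E 0)" using False by simp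
            finally show ?thesis using nle by (simp add: min_def)
          qed (simp add: rmin_def min_def)
          then show ?thesis using rmin K by (simp add: edge_rate_def rate_def)
        qed
        then have "rmin * (lw 0 * E 0 / 2) \<le> edge_rate 0 E * (lw 0 * E 0 / 2)"
          using l p0 by (intro mult_right_mono) auto
        moreover have "2 * K \<le> rmin * lw 0"
          using lw_bounds(1)[of 0] rmin by (simp add: field_simps)
        then have "2 * K * (E 0 / 2) \<le> rmin * lw 0 * (E 0 / 2)" using p0 by (intro mult_right_mono) auto
        ultimately show ?thesis using K by (simp add: mult_ac)
      qed
      ultimately show ?thesis by (simp add: right_diff_distrib diff_divide_distrib)
    qed
    have bathN: "edge_rate N E * (lw (N - 1) * (TR - E (N - 1)) / 2) \<le> K * (M * TR)"
    proof -
      have l: "0 \<le> lw (N - 1)" "lw (N - 1) \<le> M" "E (N - 1) > 0"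
        using lw_bounds[of "N - 1"] p N by (auto simp: M_def)
      have "lw (N - 1) * (TR - E (N - 1)) \<le> lw (N - 1) * TR" using l by (intro mult_left_mono) auto
      also have "\<dots> \<le> M * TR" using l TR by (intro mult_right_mono) auto
      finally have "lw (N - 1) * (TR - E (N - 1)) / 2 \<le> M * TR"
        using M TR by (intro half_le(1)) auto
      then have "edge_rate N E * (lw (N - 1) * (TR - E (N - 1)) / 2) \<le> edge_rate N E * (M * TR)"
        using edge_rate_pos[OF E, of N] by (intro mult_left_mono) auto
      also have "\<dots> \<le> K * (M * TR)"
        using edge_rate_le_K[of N E] M TR by (intro mult_right_mono) auto
      finally show ?thesis .
    qed
    have grad: "(\<Sum>k<N-1. K / 2 * ((1 / 2) ^ Suc k * (E k - E (Suc k)))) \<le> K * E 0 - a * W"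
    proof -
      have ins: "{..N-1} = {..<N}" using N by auto
      have "(\<Sum>k<N-1. (1 / 2) ^ Suc k * (E k - E (Suc k)))
          = E 0 - (\<Sum>k<N. (1 / 2) ^ Suc k * E k) - (1 / 2) ^ Suc (N - 1) * E (N - 1)"
        using sum_halving[of E "N - 1"] unfolding ins .
      also have "\<dots> \<le> E 0 - (\<Sum>k<N. (1 / 2) ^ N * E k)"
      proof -
        have "(\<Sum>k<N. (1 / 2) ^ N * E k) \<le> (\<Sum>k<N. (1 / 2) ^ Suc k * E k)"
          using p by (intro sum_mono mult_right_mono power_decreasing) (auto intro: less_imp_le)
        moreover have "(1 / 2) ^ Suc (N - 1) * E (N - 1) \<ge> 0" using p[of "N - 1"] N by simp
        ultimately show ?thesis by linarith
      qed
      also have "\<dots> = E 0 - (1 / 2) ^ N * W" by (simp add: W_def sum_distrib_left)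
      finally have "K / 2 * (\<Sum>k<N-1. (1 / 2) ^ Suc k * (E k - E (Suc k))) \<le> K / 2 * (E 0 - (1 / 2) ^ N * W)"
        using K by (intro mult_left_mono) auto
      also have "\<dots> \<le> K * E 0 - a * W"
        using K p[of 0] N by (simp add: a_def algebra_simps)
      finally show ?thesis by (simp add: sum_distrib_left)
    qed
    let ?A = "(\<Sum>k<N-1. edge_rate (Suc k) E * ((1 / 2) ^ Suc k * (E k - E (Suc k)) / 2))
     + edge_rate 0 E * (lw 0 * (TL - E 0) / 2) + edge_rate N E * (lw (N - 1) * (TR - E (N - 1)) / 2)"
    have "?A \<le> (\<Sum>k<N-1. K / 2 * ((1 / 2) ^ Suc k * (E k - E (Suc k))) + K * bad k + K * K\<^sup>2)
       + (K + K * (M * TL) - K * E 0) + K * (M * TR)"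
      using edge bath0 bathN by (intro add_mono sum_mono) auto
    also have "\<dots> = (\<Sum>k<N-1. K / 2 * ((1 / 2) ^ Suc k * (E k - E (Suc k)))) + K * (\<Sum>k<N-1. bad k)
       + real (N - 1) * (K * K\<^sup>2) + (K + K * (M * TL) - K * E 0) + K * (M * TR)"
      by (simp add: sum.distrib sum_distrib_left)
    also have "\<dots> \<le> C1 - a * W + K * (\<Sum>k<N-1. bad k)"
    proof -
      have "real (N - 1) * (K * K\<^sup>2) \<le> real N * (K * K\<^sup>2)" using K by (intro mult_right_mono) auto
      then show ?thesis using grad by (simp add: C1_def)
    qed
    finally have A: "?A \<le> C1 - a * W + K * (\<Sum>k<N-1. bad k)" .
    have d: "0 \<le> dU E" "dU E \<le> 1" "dU E * (1 + Lin E) = sx * U E" by (rule dU_bounds[OF E])+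
    have badb: "dU E * bad k \<le> K * (G E + Rsum E)" if k: "k < N - 1" for k
    proof (cases "E k < K\<^sup>2")
      case True
      have pk: "E k > 0" "E (Suc k) > 0" "k < N" "Suc k < N" using p k by auto
      have le1: "E (Suc k) \<le> Lin E"
      proof -
        have "1 * E (Suc k) \<le> lw (Suc k) * E (Suc k)" using pk lw_bounds by (intro mult_right_mono) auto
        then show ?thesis using Lin_ge(2)[OF E pk(4)] by simp
      qed
      have tl: "E (Suc k) \<le> tail k E"
        using tail_split[OF pk(3), of E] tail_split[OF pk(4), of E] tail_nonneg[OF E, of "Suc (Suc k)"] pk by simp
      \<comment> \<open>The derivative of the concave power decreases, so it may be evaluated at the
        smaller argument \<open>E (Suc k)\<close>. Multiplied by this energy it leaves only the
        power \<open>sx\<close> of it, which is within reach of \<open>tail_powr_le\<close>.\<close>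
      have "dU E \<le> 1 * (1 + E (Suc k)) powr (sx - 1)"
        unfolding dU_def using sx le1 pk by (intro mult_mono powr_antimono) auto
      then have "dU E * E (Suc k) \<le> (1 * (1 + E (Suc k)) powr (sx - 1)) * (1 + E (Suc k))"
        using d pk by (intro mult_mono) auto
      also have "\<dots> = (1 + E (Suc k)) powr sx" using pk by (simp add: powr_diff)
      also have "\<dots> \<le> (1 + tail k E) powr sx" using tl pk sx by (intro powr_mono2) auto
      also have "\<dots> \<le> (1 + tail k E) powr (\<kappa> * q k)"
        using sx_le[OF pk(3)] tail_nonneg[OF E, of k] by (intro powr_mono) auto
      also have "\<dots> \<le> K * (G E + Rsum E)" using True by (intro tail_powr_le[OF E pk(3)]) auto
      finally show ?thesis using True by (simp add: bad_def)
    next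
      case False
      then show ?thesis using K G_nonneg[OF E] Rsum_nonneg[of E] by (simp add: bad_def)
    qed
    have "dU E * ?A \<le> dU E * (C1 - a * W + K * (\<Sum>k<N-1. bad k))"
      using A d by (intro mult_left_mono) auto
    also have "\<dots> = dU E * C1 - a * (dU E * W) + K * (\<Sum>k<N-1. dU E * bad k)"
      by (simp add: algebra_simps sum_distrib_left)
    also have "\<dots> \<le> C1 - (c * U E - a) + K * (real N * (K * (G E + Rsum E)))"
    proof -
      have "dU E * C1 \<le> C1" using d C1 by (simp add: mult_left_le_one_le)
      \<comment> \<open>The loss of total energy becomes a loss of \<open>U\<close> itself because
        \<open>Lin\<close> is comparable to the total energy up to the factor \<open>M\<close> and
        \<open>dU E * (1 + Lin E) = sx * U E\<close>.\<close>
      moreover have "c * U E - a \<le> a * (dU E * W)"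
      proof -
        have "1 + Lin E \<le> M * (1 + W)"
          using Lin_ge(4)[OF E] M unfolding M_def[symmetric] W_def[symmetric] by (simp add: distrib_left)
        then have "dU E * (1 + Lin E) \<le> dU E * (M * (1 + W))" using d by (intro mult_left_mono) auto
        then have "sx * U E \<le> M * (dU E * (1 + W))" unfolding d(3) by (simp add: mult_ac)
        then have "a / M * (sx * U E) \<le> a / M * (M * (dU E * (1 + W)))" using a M by (intro mult_left_mono) auto
        also have "\<dots> = a * dU E + a * (dU E * W)" using M by (simp add: algebra_simps)
        also have "a * dU E \<le> a * 1" using a d by (intro mult_left_mono) auto
        finally show ?thesis by (simp add: c_def)
      qed
      moreover have "K * (\<Sum>k<N-1. dU E * bad k) \<le> K * (real N * (K * (G E + Rsum E)))"
      proof (rule mult_left_mono)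
        have "(\<Sum>k<N-1. dU E * bad k) \<le> (\<Sum>k<N-1. K * (G E + Rsum E))" using badb by (intro sum_mono) auto
        also have "\<dots> = real (N - 1) * (K * (G E + Rsum E))" by simp
        also have "\<dots> \<le> real N * (K * (G E + Rsum E))"
          using K G_nonneg[OF E] Rsum_nonneg[of E] by (intro mult_right_mono) auto
        finally show "(\<Sum>k<N-1. dU E * bad k) \<le> real N * (K * (G E + Rsum E))" .
      qed (use K in simp)
      ultimately show ?thesis by linarith
    qed
    also have "\<dots> \<le> C * (1 + G E + Rsum E) - c * U E"
    proof -
      have "(C1 + a) * 1 \<le> (C1 + a) * (1 + G E + Rsum E)"
        using C1 a G_nonneg[OF E] Rsum_nonneg[of E] by (intro mult_left_mono) auto
      moreover have "(real N * K * K) * (G E + Rsum E) \<le> (real N * K * K) * (1 + G E + Rsum E)"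
        using K by (intro mult_left_mono) auto
      moreover have "C * (1 + G E + Rsum E) = (C1 + a) * (1 + G E + Rsum E) + (real N * K * K) * (1 + G E + Rsum E)"
        by (simp add: C_def algebra_simps)
      moreover have "K * (real N * (K * (G E + Rsum E))) = (real N * K * K) * (G E + Rsum E)" by simp
      moreover have "c1 - (u - a) + k \<le> t - u"
        if "(c1 + a) * 1 \<le> p1" "p \<le> p2" "t = p1 + p2" "k = p" for c1 u k t p1 p2 p :: real
        using that by simp
      ultimately show ?thesis by blast
    qed
    finally show ?thesis by (rule drift_le_mono[OF U_drift_linear[OF E]])
  qed
  then show ?thesis using c C by blast
qed

section \<open>Assembly of the Lyapunov function\<close>

theorem lyapunov_function:
  "\<exists>V c b C. 0 < c \<and> 0 \<le> b \<and> 0 \<le> C \<and> V \<in> borel_measurable S \<and>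
    (\<forall>E\<in>space S. 1 \<le> V E \<and> V E \<le> C * (1 + (\<Sum>i<N. E i) + (\<Sum>i<N. E i powr - (\<beta> / 2))) \<and>
      Q (\<lambda>E. ennreal (V E)) E + ennreal (c * V E powr \<kappa>) \<le> ennreal (V E + b)) \<and>
    (\<forall>R. \<exists>\<delta> M. 0 < \<delta> \<and> (\<forall>E\<in>space S. V E \<le> R \<longrightarrow> (\<forall>i<N. \<delta> \<le> E i \<and> E i \<le> M)))"
proof -
  obtain cU CU where cU: "0 < cU" "0 \<le> CU"
    and dU: "\<And>E. E \<in> space S \<Longrightarrow> drift_le U E (CU * (1 + G E + Rsum E) - cU * U E)"
    using U_drift by blast
  obtain CF where CF: "0 \<le> CF" and dF: "\<And>E. E \<in> space S \<Longrightarrow> drift_le F E (CF * (1 + Rsum E) - G E / 8)"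
    using F_drift by blast
  obtain CV where CV: "0 \<le> CV" and dV: "\<And>E. E \<in> space S \<Longrightarrow> drift_le Vlow E (CV - Tot E / 2)"
    using Vlow_drift by blast
  obtain CF' where CF': "0 \<le> CF'" and pF: "\<And>E. E \<in> space S \<Longrightarrow> F E powr \<kappa> \<le> CF' * (G E + Rsum E)"
    using F_powr_le by blast
  obtain CV' where CV': "0 \<le> CV'" and pV: "\<And>E. E \<in> space S \<Longrightarrow> Vlow E powr \<kappa> \<le> CV' * (Tot E + Rsum E)"
    using Vlow_powr_le by blast
  obtain C1 where C1: "0 \<le> C1" and lF: "\<And>E. E \<in> space S \<Longrightarrow> F E \<le> C1 * (1 + (\<Sum>i<N. E i) + (\<Sum>i<N. E i powr - (\<beta> / 2)))"
    using F_le by blast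
  obtain C2 where C2: "0 \<le> C2" and lV: "\<And>E. E \<in> space S \<Longrightarrow> Vlow E \<le> C2 * (\<Sum>i<N. E i powr - (\<beta> / 2))"
    using Vlow_le by blast
  define CR where "CR = real (N + 1) * (1 + TL powr - ((\<beta> - 1) / 2) + TR powr - ((\<beta> - 1) / 2))"
  have CR: "CR \<ge> 0" by (simp add: CR_def)
  have R: "Rsum E \<le> CR + Tot E" if E: "E \<in> space S" for E
  proof -
    have "real (N + 1) * (Tot E / \<Theta>) \<le> \<Theta> * (Tot E / \<Theta>)"
      using Theta_ge Tot_nonneg[OF E] by (intro mult_right_mono) auto
    also have "\<dots> = Tot E" using Theta_ge by simp
    finally show ?thesis using Rsum_le[OF E] by (simp add: CR_def)
  qed
  \<comment> \<open>The loss of \<open>M1 * F\<close> is \<open>(CU + 1) * G\<close>, which covers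
    the gain \<open>CU * G\<close> of \<open>U\<close>. Similarly \<open>M2 * Tot / 2\<close> covers
    the multiples \<open>CU\<close> and \<open>M1 * CF\<close> of \<open>Rsum\<close>, each at most
    \<open>CR + Tot\<close>. In both cases one unit of loss remains.\<close>
  define M1 where "M1 = 8 * (CU + 1)"
  define M2 where "M2 = 2 * (CU + M1 * CF + 1)"
  have M: "M1 \<ge> 1" "M2 \<ge> 1" using cU CF by (auto simp: M1_def M2_def)
  define V where "V E = U E + (M1 * F E + M2 * Vlow E)" for E
  define b0 where "b0 = CU * (1 + CR) + M1 * CF * (1 + CR) + M2 * CV"
  have b0: "b0 \<ge> 0" using cU CF CV CR M by (simp add: b0_def)
  have drift: "drift_le V E (b0 - (cU * U E + G E + Tot E))" if E: "E \<in> space S" for E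
  proof -
    have "drift_le V E ((CU * (1 + G E + Rsum E) - cU * U E) + (M1 * (CF * (1 + Rsum E) - G E / 8) + M2 * (CV - Tot E / 2)))"
      unfolding V_def
    proof (rule drift_le_add[OF E U_measurable _ _ _ dU[OF E] drift_le_add[OF E _ _ _ _
          drift_le_scale[OF E F_measurable F_nonneg _ dF[OF E]] drift_le_scale[OF E Vlow_measurable Vlow_nonneg _ dV[OF E]]]])
    qed (use M F_measurable Vlow_measurable F_nonneg Vlow_nonneg U_ge1 in
        \<open>auto intro!: borel_measurable_add borel_measurable_times add_nonneg_nonneg mult_nonneg_nonneg intro: order_trans[OF zero_le_one]\<close>)
    moreover have "(CU * (1 + G E + Rsum E) - cU * U E) + (M1 * (CF * (1 + Rsum E) - G E / 8) + M2 * (CV - Tot E / 2))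
        \<le> b0 - (cU * U E + G E + Tot E)"
    proof -
      have "CU * Rsum E \<le> CU * (CR + Tot E)" "M1 * CF * Rsum E \<le> M1 * CF * (CR + Tot E)"
        using R[OF E] cU CF M by (auto intro!: mult_left_mono)
      then show ?thesis by (simp add: b0_def M1_def M2_def algebra_simps)
    qed
    ultimately show ?thesis by (rule drift_le_mono)
  qed
  have V1: "V E \<ge> U E" for E using F_nonneg[of E] Vlow_nonneg[of E] M by (simp add: V_def)
  have VU: "V E \<ge> 1" if E: "E \<in> space S" for E using V1[of E] U_ge1[OF E] by simp
  define P where "P = 1 + M1 * CF' + M2 * CV'"
  have P: "P \<ge> 1" using M CF' CV' by (simp add: P_def)
  \<comment> \<open>The wanted power of \<open>V\<close> is compared with the sum of the three
    dissipations, part by part, using subadditivity of the power \<kappa>.\<close>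
  have powr: "V E powr \<kappa> \<le> P * (U E + G E + 2 * Tot E + 2 * CR)" if E: "E \<in> space S" for E
  proof -
    have nn: "U E \<ge> 1" "G E \<ge> 0" "Tot E \<ge> 0" "F E \<ge> 0" "Vlow E \<ge> 0" "Rsum E \<ge> 0"
      using U_ge1[OF E] G_nonneg[OF E] Tot_nonneg[OF E] F_nonneg Vlow_nonneg Rsum_nonneg by auto
    have "V E powr \<kappa> \<le> U E powr \<kappa> + (M1 * F E + M2 * Vlow E) powr \<kappa>"
      unfolding V_def using kappa nn M by (intro powr_add_le) auto
    also have "(M1 * F E + M2 * Vlow E) powr \<kappa> \<le> (M1 * F E) powr \<kappa> + (M2 * Vlow E) powr \<kappa>"
      using kappa nn M by (intro powr_add_le) auto
    also have "U E powr \<kappa> \<le> U E"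
      using powr_mono[of \<kappa> 1 "U E"] kappa nn by simp
    also have "(M1 * F E) powr \<kappa> \<le> M1 * (CF' * (G E + Rsum E))"
    proof -
      have "M1 powr \<kappa> \<le> M1" using powr_mono[of \<kappa> 1 M1] kappa M by simp
      then have "M1 powr \<kappa> * F E powr \<kappa> \<le> M1 * (CF' * (G E + Rsum E))"
        using pF[OF E] M by (intro mult_mono) auto
      then show ?thesis using M nn by (simp add: powr_mult)
    qed
    also have "(M2 * Vlow E) powr \<kappa> \<le> M2 * (CV' * (Tot E + Rsum E))"
    proof -
      have "M2 powr \<kappa> \<le> M2" using powr_mono[of \<kappa> 1 M2] kappa M by simp
      then have "M2 powr \<kappa> * Vlow E powr \<kappa> \<le> M2 * (CV' * (Tot E + Rsum E))"
        using pV[OF E] M by (intro mult_mono) auto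
      then show ?thesis using M nn by (simp add: powr_mult)
    qed
    also have "U E + (M1 * (CF' * (G E + Rsum E)) + M2 * (CV' * (Tot E + Rsum E)))
       \<le> P * (U E + G E + 2 * Tot E + 2 * CR)"
    proof -
      define Z where "Z = U E + G E + 2 * Tot E + 2 * CR"
      have Z: "U E \<le> Z" "G E + Rsum E \<le> Z" "Tot E + Rsum E \<le> Z"
        using nn R[OF E] CR by (auto simp: Z_def)
      have "M1 * CF' * (G E + Rsum E) \<le> M1 * CF' * Z" "M2 * CV' * (Tot E + Rsum E) \<le> M2 * CV' * Z"
        using Z M CF' CV' by (auto intro!: mult_left_mono)
      then have "U E + (M1 * CF' * (G E + Rsum E) + M2 * CV' * (Tot E + Rsum E)) \<le> P * Z"
        using Z(1) by (simp add: P_def distrib_right)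
      then show ?thesis by (simp add: Z_def mult.assoc)
    qed
    finally show ?thesis by simp
  qed
  define c where "c = min cU (1 / 2) / P"
  have c: "c > 0" using cU P by (simp add: c_def)
  define b where "b = b0 + 2 * CR"
  have b: "b \<ge> 0" using b0 CR by (simp add: b_def)
  have drift2: "drift_le V E (b - c * V E powr \<kappa>)" if E: "E \<in> space S" for E
  proof (rule drift_le_mono[OF drift[OF E]])
    have nn: "U E \<ge> 1" "G E \<ge> 0" "Tot E \<ge> 0"
      using U_ge1[OF E] G_nonneg[OF E] Tot_nonneg[OF E] by auto
    define m where "m = min cU (1 / 2)"
    have m: "0 \<le> m" "m \<le> cU" "m \<le> 1 / 2" using cU by (auto simp: m_def)
    have "c * V E powr \<kappa> \<le> c * (P * (U E + G E + 2 * Tot E + 2 * CR))"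
      using powr[OF E] c by (intro mult_left_mono) auto
    also have "\<dots> = m * U E + m * G E + m * (2 * Tot E) + m * (2 * CR)"
      using P by (simp add: c_def m_def distrib_left)
    also have "\<dots> \<le> cU * U E + 1 * G E + 1 / 2 * (2 * Tot E) + 1 * (2 * CR)"
      using m nn CR by (intro add_mono mult_right_mono) auto
    finally show "b0 - (cU * U E + G E + Tot E) \<le> b - c * V E powr \<kappa>" by (simp add: b_def)
  qed
  have Vm: "V \<in> borel_measurable S"
    unfolding V_def[abs_def] using U_measurable F_measurable Vlow_measurable
    by (intro borel_measurable_add borel_measurable_times borel_measurable_const)
  have final: "Q (\<lambda>E. ennreal (V E)) E + ennreal (c / L * V E powr \<kappa>) \<le> ennreal (V E + b / L)" if E: "E \<in> space S" for E
  proof -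
    have d: "0 \<le> V E + (b - c * V E powr \<kappa>) / L" "Q (\<lambda>E. ennreal (V E)) E \<le> ennreal (V E + (b - c * V E powr \<kappa>) / L)"
      using drift2[OF E] by (auto simp: drift_le_def)
    have "Q (\<lambda>E. ennreal (V E)) E + ennreal (c / L * V E powr \<kappa>)
        \<le> ennreal (V E + (b - c * V E powr \<kappa>) / L) + ennreal (c / L * V E powr \<kappa>)"
      by (intro add_right_mono d)
    also have "\<dots> = ennreal (V E + b / L)"
      using d(1) c L_pos by (subst ennreal_plus[symmetric]) (auto simp: diff_divide_distrib)
    finally show ?thesis .
  qed
  define C where "C = 2 * K / rmin + 1 + M1 * C1 + M2 * C2"
  have le: "V E \<le> C * (1 + (\<Sum>i<N. E i) + (\<Sum>i<N. E i powr - (\<beta> / 2)))" if E: "E \<in> space S" for E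
  proof -
    let ?W = "\<Sum>i<N. E i" and ?z = "\<Sum>i<N. E i powr - (\<beta> / 2)"
    have W: "?W \<ge> 0" using state_pos[OF E] by (intro sum_nonneg) (auto intro: less_imp_le)
    have z: "?z \<ge> 0" by (intro sum_nonneg) auto
    have M0: "2 * K / rmin + 1 \<ge> 1" using K rmin by simp
    have "U E \<le> (1 + Lin E) powr 1"
      unfolding U_def using sx Lin_ge(3)[OF E] by (intro powr_mono) auto
    also have "\<dots> \<le> (2 * K / rmin + 1) * (1 + ?W)"
      using Lin_ge[OF E] M0 by (simp add: distrib_left)
    also have "\<dots> \<le> (2 * K / rmin + 1) * (1 + ?W + ?z)" using M0 z by (intro mult_left_mono) auto
    finally have u: "U E \<le> (2 * K / rmin + 1) * (1 + ?W + ?z)" .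
    have "M1 * F E \<le> M1 * (C1 * (1 + ?W + ?z))" using lF[OF E] M by (intro mult_left_mono) auto
    moreover have "M2 * Vlow E \<le> M2 * (C2 * (1 + ?W + ?z))"
    proof -
      have "C2 * ?z \<le> C2 * (1 + ?W + ?z)" using C2 W by (intro mult_left_mono) auto
      then show ?thesis using lV[OF E] M by (intro mult_left_mono) auto
    qed
    ultimately show ?thesis using u by (simp add: V_def C_def distrib_right mult.assoc)
  qed
  have level: "\<exists>\<delta> Mx. 0 < \<delta> \<and> (\<forall>E\<in>space S. V E \<le> R \<longrightarrow> (\<forall>i<N. \<delta> \<le> E i \<and> E i \<le> Mx))" for R
  proof -
    define R' where "R' = max R 1"
    have R': "R' \<ge> 1" "R \<le> R'" by (auto simp: R'_def)
    have "R' powr (- 1 / (\<beta> / 2)) \<le> E i \<and> E i \<le> R' powr (1 / sx)"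
      if E: "E \<in> space S" and V: "V E \<le> R" and i: "i < N" for E i
    proof
      have pos: "E i > 0" using state_pos[OF E i] .
      have I: "(i, Suc i) \<in> blocks" using i by (auto simp: blocks_def)
      have "1 * block (i, Suc i) E \<le> wt (i, Suc i) * block (i, Suc i) E"
        using wt_ge(2) block_pos[OF E I] by (intro mult_right_mono) auto
      also have "\<dots> \<le> Vlow E"
        unfolding Vlow_def using finite_blocks I wt_block_nonneg by (intro member_le_sum) auto
      also have "\<dots> \<le> M2 * Vlow E" using mult_right_mono[OF M(2) Vlow_nonneg[of E]] by simp
      also have "\<dots> \<le> V E"
        using F_nonneg[of E] M U_ge1[OF E] by (simp add: V_def)
      finally have "E i powr - (\<beta> / 2) \<le> R'" using V R' by (simp add: block_def)
      then have "R' powr (- 1 / (\<beta> / 2)) \<le> (E i powr - (\<beta> / 2)) powr (- 1 / (\<beta> / 2))"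
        using pos \<beta> by (intro powr_antimono) (auto simp: field_simps)
      then show "R' powr (- 1 / (\<beta> / 2)) \<le> E i" using pos \<beta> by (simp add: powr_powr)
      have "1 * E i \<le> lw i * E i" using lw_bounds pos by (intro mult_right_mono) auto
      then have "E i \<le> 1 + Lin E" using Lin_ge(2)[OF E i] by simp
      also have "\<dots> = U E powr (1 / sx)" using sx Lin_ge(3)[OF E] by (simp add: U_def powr_powr)
      also have "\<dots> \<le> R' powr (1 / sx)"
        using V V1[of E] R' U_ge1[OF E] sx by (intro powr_mono2) auto
      finally show "E i \<le> R' powr (1 / sx)" .
    qed
    moreover have "R' powr (- 1 / (\<beta> / 2)) > 0" using R' by simp
    ultimately show ?thesis by blast
  qed
  have Cnn: "C \<ge> 0" using K rmin M C1 C2 by (simp add: C_def)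
  show ?thesis
    by (rule exI[of _ V], rule exI[of _ "c / L"], rule exI[of _ "b / L"], rule exI[of _ "C"])
       (use c b L_pos Vm VU le final level Cnn in auto)
qed

end

subsection \<open>Minorization\<close>

text \<open>The intervals descend with the site: every value in \<open>dyadic (Suc i)\<close> is at
  most every value in \<open>dyadic i\<close>, so a site that has just been set holds enough energy
  to set its right neighbour.\<close>

definition dyadic :: "nat \<Rightarrow> real set" where
  "dyadic k = {(1 / 2) ^ Suc k .. (1 / 2) ^ k}"

definition unif_dyadic :: "nat \<Rightarrow> real measure" where
  "unif_dyadic k = density (restrict_space lborel (dyadic k)) (\<lambda>_. ennreal (2 ^ Suc k))"

definition refresh_op :: "nat \<Rightarrow> ((nat \<Rightarrow> real) \<Rightarrow> ennreal) \<Rightarrow> (nat \<Rightarrow> real) \<Rightarrow> ennreal" where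
  "refresh_op k f x = (\<integral>\<^sup>+z. f (x(k := z)) \<partial>unif_dyadic k)"

text \<open>The sites below \<open>k\<close> become independent, each uniform on its dyadic
  interval, and the others stay. For \<open>k = N\<close> nothing of the state remains, which gives
  the common component of the minorization.\<close>

primrec refresh_below :: "nat \<Rightarrow> ((nat \<Rightarrow> real) \<Rightarrow> ennreal) \<Rightarrow> (nat \<Rightarrow> real) \<Rightarrow> ennreal" where
  "refresh_below 0 f = f"
| "refresh_below (Suc k) f = refresh_op k (refresh_below k f)"

lemma dyadic_pos: "z \<in> dyadic k \<Longrightarrow> z > 0"
proof -
  assume "z \<in> dyadic k"
  then have "(1 / 2) ^ Suc k \<le> z" by (simp add: dyadic_def)
  moreover have "(1 / 2 :: real) ^ Suc k > 0" by (rule zero_less_power) simp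
  ultimately show "z > 0" by linarith
qed

lemma dyadic_le_1: "z \<in> dyadic k \<Longrightarrow> z \<le> 1"
  using power_le_one[of "1 / 2 :: real" k] by (auto simp: dyadic_def)

lemma sets_dyadic [measurable]: "dyadic k \<in> sets borel"
  by (simp add: dyadic_def)

lemma space_unif_dyadic: "space (unif_dyadic k) = dyadic k"
  by (simp add: unif_dyadic_def space_restrict_space)

lemma measurable_unif_dyadic_id: "(\<lambda>z. z) \<in> borel_measurable (unif_dyadic k)"
  unfolding unif_dyadic_def by (simp add: measurable_restrict_space1)

lemma nn_integral_unif_dyadic:
  assumes f: "f \<in> borel_measurable (unif_dyadic k)"
  shows "(\<integral>\<^sup>+z. f z \<partial>unif_dyadic k) = ennreal (2 ^ Suc k) * (\<integral>\<^sup>+z. indicator (dyadic k) z * f z \<partial>lborel)"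
    and "(\<lambda>z. indicator (dyadic k) z * f z) \<in> borel_measurable borel"
proof -
  have f' [measurable]: "f \<in> borel_measurable (restrict_space lborel (dyadic k))"
    using f by (simp add: unif_dyadic_def)
  then show "(\<lambda>z. indicator (dyadic k) z * f z) \<in> borel_measurable borel"
    by (subst (asm) borel_measurable_restrict_space_iff_ennreal) (auto simp: mult.commute)
  have "(\<integral>\<^sup>+z. f z \<partial>unif_dyadic k) = (\<integral>\<^sup>+z. ennreal (2 ^ Suc k) * f z \<partial>restrict_space lborel (dyadic k))"
    unfolding unif_dyadic_def by (rule nn_integral_density) auto
  also have "\<dots> = ennreal (2 ^ Suc k) * (\<integral>\<^sup>+z. f z \<partial>restrict_space lborel (dyadic k))"
    by (rule nn_integral_cmult) simp
  also have "(\<integral>\<^sup>+z. f z \<partial>restrict_space lborel (dyadic k)) = (\<integral>\<^sup>+z. indicator (dyadic k) z * f z \<partial>lborel)"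
    by (subst nn_integral_restrict_space) (auto simp: mult.commute)
  finally show "(\<integral>\<^sup>+z. f z \<partial>unif_dyadic k) = ennreal (2 ^ Suc k) * (\<integral>\<^sup>+z. indicator (dyadic k) z * f z \<partial>lborel)" .
qed

lemma prob_space_unif_dyadic: "prob_space (unif_dyadic k)"
proof
  have "emeasure (unif_dyadic k) (space (unif_dyadic k)) = (\<integral>\<^sup>+z. 1 \<partial>unif_dyadic k)" by simp
  also have "\<dots> = ennreal (2 ^ Suc k) * (\<integral>\<^sup>+z. indicator (dyadic k) z \<partial>lborel)"
    by (subst nn_integral_unif_dyadic) auto
  also have "(\<integral>\<^sup>+z. indicator (dyadic k) z \<partial>lborel) = emeasure lborel (dyadic k)"
    by (rule nn_integral_indicator) simp
  also have "emeasure lborel (dyadic k) = ennreal ((1 / 2) ^ Suc k)"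
    by (simp add: dyadic_def)
  also have "ennreal (2 ^ Suc k) * ennreal ((1 / 2) ^ Suc k) = ennreal (2 ^ Suc k * (1 / 2) ^ Suc k)"
    by (rule ennreal_mult[symmetric]) auto
  also have "(2 :: real) ^ Suc k * (1 / 2) ^ Suc k = 1"
    by (subst power_mult_distrib[symmetric]) simp
  finally show "emeasure (unif_dyadic k) (space (unif_dyadic k)) = 1" by simp
qed

lemma measurable_refresh:
  assumes "x \<in> space (state_space N)" "k < N"
  shows "(\<lambda>z. x(k := z)) \<in> measurable (unif_dyadic k) (state_space N)"
  using assms dyadic_pos measurable_unif_dyadic_id
  by (intro measurable_state_upd) (auto simp: space_unif_dyadic)

lemma markov_operator_refresh_op:
  assumes k: "k < N"
  shows "markov_operator (state_space N) (refresh_op k)"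
  unfolding refresh_op_def[abs_def]
proof (rule markov_operator_random_map[OF prob_space_unif_dyadic])
  show "(\<lambda>w. (fst w)(k := snd w)) \<in> measurable (state_space N \<Otimes>\<^sub>M unif_dyadic k) (state_space N)"
    using k dyadic_pos measurable_compose[OF measurable_snd measurable_unif_dyadic_id]
    by (intro measurable_state_upd) (auto simp: space_pair_measure space_unif_dyadic)
qed

lemma markov_operator_refresh_below: "k \<le> N \<Longrightarrow> markov_operator (state_space N) (refresh_below k)"
proof (induction k)
  case 0
  show ?case by standard auto
next
  case (Suc k)
  have "markov_operator (state_space N) (\<lambda>f. refresh_op k (refresh_below k f))"
    using Suc by (intro markov_operator.markov_operator_comp[OF Suc.IH markov_operator_refresh_op]) auto
  moreover have "refresh_below (Suc k) = (\<lambda>f. refresh_op k (refresh_below k f))"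
    by (rule ext) simp
  ultimately show ?case by (simp only:)
qed

lemma refresh_below_cong:
  assumes "x \<in> space (state_space N)" "y \<in> space (state_space N)" "k \<le> N" "\<And>j. j \<ge> k \<Longrightarrow> x j = y j"
  shows "refresh_below k f x = refresh_below k f y"
  using assms
proof (induction k arbitrary: x y)
  case 0
  then have "x = y" by auto
  then show ?case by simp
next
  case (Suc k)
  have "refresh_below k f (x(k := z)) = refresh_below k f (y(k := z))" if "z \<in> dyadic k" for z
    using Suc.prems dyadic_pos[OF that] by (intro Suc.IH state_upd) auto
  then show ?case
    by (auto simp: refresh_op_def space_unif_dyadic intro!: nn_integral_cong)
qed

lemma refresh_below_mono:
  assumes "x \<in> space (state_space N)" "k \<le> N"
    and "\<And>y. \<lbrakk>y \<in> space (state_space N); \<And>j. j < k \<Longrightarrow> y j \<in> dyadic j; \<And>j. j \<ge> k \<Longrightarrow> y j = x j\<rbrakk> \<Longrightarrow> f y \<le> g y"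
  shows "refresh_below k f x \<le> refresh_below k g x"
  using assms
proof (induction k arbitrary: x)
  case 0
  then show ?case by simp
next
  case (Suc k)
  have "refresh_below k f (x(k := z)) \<le> refresh_below k g (x(k := z))" if z: "z \<in> dyadic k" for z
  proof (rule Suc.IH)
    show "x(k := z) \<in> space (state_space N)" using Suc.prems dyadic_pos[OF z] by (intro state_upd) auto
    fix y assume y: "y \<in> space (state_space N)" "\<And>j. j < k \<Longrightarrow> y j \<in> dyadic j" "\<And>j. j \<ge> k \<Longrightarrow> y j = (x(k := z)) j"
    have "y k = z" using y(3)[of k] by simp
    show "f y \<le> g y"
    proof (rule Suc.prems(3)[OF y(1)])
      show "y j \<in> dyadic j" if "j < Suc k" for j
        using that y(2)[of j] z \<open>y k = z\<close> by (cases "j = k") auto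
      show "y j = x j" if "j \<ge> Suc k" for j using that y(3)[of j] by auto
    qed
  qed (use Suc.prems in auto)
  then show ?case
    by (auto simp: refresh_op_def space_unif_dyadic intro!: nn_integral_mono)
qed

context energy_exchange
begin

lemma Q_ge_edge:
  assumes E: "E \<in> space S" and f: "f \<in> borel_measurable S" and e: "e \<le> N"
    and r: "0 \<le> r" "r \<le> edge_rate e E"
  shows "ennreal (r / L) * edge_op e f E \<le> Q f E"
proof -
  have "ennreal (r / L) * edge_op e f E \<le> ennreal (edge_rate e E / L) * edge_op e f E"
    using r L_pos by (intro mult_right_mono ennreal_leI divide_right_mono) auto
  also have "\<dots> \<le> (\<Sum>e\<le>N. ennreal (edge_rate e E / L) * edge_op e f E)"
    using e by (intro member_le_sum) auto
  also have "\<dots> \<le> Q f E" by (simp add: Q_eq[OF E f])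
  finally show ?thesis .
qed

text \<open>For bath energies in [1, 2] the exponential density is at least
  \<open>exp (- 2 / TL) / TL\<close>, and \<open>E 0 + x\<close> lies between 1 and
  \<open>M + 2\<close>; hence \<open>p * (E 0 + x)\<close> covers \<open>dyadic 0\<close> with
  density at least \<open>1 / (M + 2)\<close>. The last factor 1/2 offsets the density 2 of
  \<open>unif_dyadic 0\<close>.\<close>

lemma bath_op_ge_refresh:
  assumes E: "E \<in> space S" "E 0 \<le> M" and f: "f \<in> borel_measurable S"
  shows "ennreal (exp (- 2 / TL) / TL / (M + 2) / 2) * refresh_op 0 f E \<le> bath_op TL 0 f E"
proof -
  have N0: "0 < N" using N by simp
  have pos: "E 0 > 0" using state_pos[OF E(1) N0] .
  define g where "g z = indicator (dyadic 0) z * f (E(0 := z))" for z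
  have meas: "(\<lambda>z. f (E(0 := z))) \<in> borel_measurable (unif_dyadic 0)"
    using measurable_compose[OF measurable_refresh[OF E(1) N0] f] by simp
  have g [measurable]: "g \<in> borel_measurable borel"
    unfolding g_def using nn_integral_unif_dyadic(2)[OF meas] .
  have gE: "refresh_op 0 f E = ennreal 2 * (\<integral>\<^sup>+z. g z \<partial>lborel)"
    unfolding refresh_op_def g_def using nn_integral_unif_dyadic(1)[OF meas] by simp
  define d where "d = exp (- 2 / TL) / TL"
  have d: "d > 0" using TL by (simp add: d_def)
  have bath: "bath_op TL 0 f E = (\<integral>\<^sup>+p. indicator {0<..<1} p *
      (\<integral>\<^sup>+x. indicator {0..} x * ennreal (exp (- x / TL) / TL) * f (E(0 := p * (E 0 + x))) \<partial>lborel) \<partial>lborel)"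
    unfolding bath_op_def nn_integral_unif01
  proof (intro nn_integral_cong)
    fix p :: real
    show "indicator {0<..<1} p * (\<integral>\<^sup>+ x. f (E(0 := p * (E 0 + x))) \<partial>expo TL)
       = indicator {0<..<1} p * (\<integral>\<^sup>+ x. indicator {0..} x * ennreal (exp (- x / TL) / TL) *
                f (E(0 := p * (E 0 + x))) \<partial>lborel)"
    proof (cases "p \<in> {0<..<1}")
      case True
      have "(\<lambda>x. E(0 := p * (E 0 + x))) \<in> measurable (expo TL) S"
        using True E N0 pos
        by (intro measurable_state_upd) (auto simp: space_expo intro!: mult_pos_pos add_pos_nonneg)
      then have "(\<lambda>x. f (E(0 := p * (E 0 + x)))) \<in> borel_measurable (expo TL)"
        using f by (rule measurable_compose)
      then show ?thesis by (simp add: nn_integral_expo)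
    qed simp
  qed
  have inner: "ennreal (1 / (M + 2)) * (\<integral>\<^sup>+z. g z \<partial>lborel) \<le> (\<integral>\<^sup>+p. g (p * (E 0 + x)) \<partial>lborel)"
    if x: "x \<in> {1..2}" for x
  proof -
    have s: "E 0 + x > 0" "E 0 + x \<le> M + 2" using x pos E by auto
    have "(\<integral>\<^sup>+z. g z \<partial>lborel) = ennreal (E 0 + x) * (\<integral>\<^sup>+p. g (0 + (E 0 + x) * p) \<partial>lborel)"
      using s nn_integral_real_affine[OF g, of "E 0 + x" 0] by simp
    then have "ennreal (1 / (M + 2)) * (\<integral>\<^sup>+z. g z \<partial>lborel)
        = ennreal (1 / (M + 2)) * ennreal (E 0 + x) * (\<integral>\<^sup>+p. g (p * (E 0 + x)) \<partial>lborel)"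
      by (simp add: mult_ac)
    also have "ennreal (1 / (M + 2)) * ennreal (E 0 + x) = ennreal (1 / (M + 2) * (E 0 + x))"
      using s by (intro ennreal_mult[symmetric]) auto
    also have "\<dots> \<le> ennreal 1" using s by (intro ennreal_leI) (simp add: field_simps)
    finally show ?thesis by (simp add: mult_right_mono)
  qed
  have "ennreal d * (ennreal (1 / (M + 2)) * (\<integral>\<^sup>+z. g z \<partial>lborel))
      = (\<integral>\<^sup>+x. indicator {1..2 :: real} x * (ennreal d * (ennreal (1 / (M + 2)) * (\<integral>\<^sup>+z. g z \<partial>lborel))) \<partial>lborel)"
    by (subst nn_integral_multc) auto
  also have "\<dots> \<le> (\<integral>\<^sup>+x. indicator {1..2} x * (ennreal d * (\<integral>\<^sup>+p. g (p * (E 0 + x)) \<partial>lborel)) \<partial>lborel)"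
    using inner by (intro nn_integral_mono) (auto simp: indicator_def intro!: mult_left_mono)
  also have "\<dots> = (\<integral>\<^sup>+x. (\<integral>\<^sup>+p. indicator {1..2} x * (ennreal d * g (p * (E 0 + x))) \<partial>lborel) \<partial>lborel)"
    by (simp add: nn_integral_cmult)
  \<comment> \<open>The substitution in \<open>p\<close> was made for a fixed bath energy, whereas
    \<open>bath_op\<close> has the integral over \<open>p\<close> outside.\<close>
  also have "\<dots> = (\<integral>\<^sup>+p. (\<integral>\<^sup>+x. indicator {1..2} x * (ennreal d * g (p * (E 0 + x))) \<partial>lborel) \<partial>lborel)"
    by (rule lborel_pair.Fubini') simp
  also have "\<dots> \<le> bath_op TL 0 f E"
    unfolding bath
  proof (intro nn_integral_mono)
    fix p :: real
    show "(\<integral>\<^sup>+x. indicator {1..2} x * (ennreal d * g (p * (E 0 + x))) \<partial>lborel) \<le> indicator {0<..<1} p *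
      (\<integral>\<^sup>+x. indicator {0..} x * ennreal (exp (- x / TL) / TL) * f (E(0 := p * (E 0 + x))) \<partial>lborel)"
    proof (cases "p \<in> {0<..<1}")
      case True
      have "indicator {1..2} x * (ennreal d * g (p * (E 0 + x)))
          \<le> indicator {0..} x * ennreal (exp (- x / TL) / TL) * f (E(0 := p * (E 0 + x)))" for x
      proof (cases "x \<in> {1..2} \<and> p * (E 0 + x) \<in> dyadic 0")
        case True
        have "d \<le> exp (- x / TL) / TL"
          unfolding d_def using True TL by (intro divide_right_mono) (auto simp: divide_right_mono)
        then show ?thesis using True by (auto simp: g_def intro!: mult_right_mono ennreal_leI)
      qed (auto simp: g_def indicator_def)
      then show ?thesis using True by (auto intro!: nn_integral_mono)
    next
      \<comment> \<open>Outside the unit interval \<open>g\<close> vanishes, since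
        \<open>dyadic 0\<close> lies in (0, 1] whereas \<open>E 0 + x > 1\<close>.\<close>
      case False
      have "indicator {1..2} x * (ennreal d * g (p * (E 0 + x))) = 0" for x
      proof (cases "x \<in> {1..2}")
        case True
        have "p * (E 0 + x) \<notin> dyadic 0"
        proof (cases "p \<le> 0")
          case True
          then have "p * (E 0 + x) \<le> 0" using pos \<open>x \<in> {1..2}\<close> by (intro mult_nonpos_nonneg) auto
          then show ?thesis using dyadic_pos by force
        next
          case nle: False
          then have "1 * (E 0 + x) \<le> p * (E 0 + x)" using False pos True by (intro mult_right_mono) auto
          moreover have "E 0 + x > 1" using pos True by simp
          ultimately have "p * (E 0 + x) > 1" by (simp add: less_le_trans)
          then show ?thesis using dyadic_le_1[of "p * (E 0 + x)" 0] by linarith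
        qed
        then show ?thesis by (simp add: g_def)
      qed simp
      then have "(\<lambda>x. indicator {1..2} x * (ennreal d * g (p * (E 0 + x)))) = (\<lambda>_. 0)" by (rule ext)
      then show ?thesis by (simp only: nn_integral_const mult_zero_left zero_le)
    qed
  qed
  finally have "ennreal d * (ennreal (1 / (M + 2)) * (\<integral>\<^sup>+z. g z \<partial>lborel)) \<le> bath_op TL 0 f E" .
  moreover have "ennreal (d / (M + 2) / 2) * (ennreal 2 * (\<integral>\<^sup>+z. g z \<partial>lborel))
      = ennreal d * (ennreal (1 / (M + 2)) * (\<integral>\<^sup>+z. g z \<partial>lborel))"
  proof -
    have "M + 2 > 0" using E pos by simp
    then have "ennreal (d / (M + 2) / 2) * ennreal 2 = ennreal d * ennreal (1 / (M + 2))"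
    proof -
      have gen: "y / 2 * 2 = y" "d * (1 / w) = d / w" for y w :: real by auto
      have "ennreal (d / (M + 2) / 2) * ennreal 2 = ennreal (d / (M + 2) / 2 * 2)"
        using d \<open>M + 2 > 0\<close> by (intro ennreal_mult[symmetric]) auto
      also have "\<dots> = ennreal (d * (1 / (M + 2)))" by (simp only: gen)
      also have "\<dots> = ennreal d * ennreal (1 / (M + 2))"
        using d \<open>M + 2 > 0\<close> by (intro ennreal_mult) auto
      finally show ?thesis .
    qed
    then show ?thesis by (simp only: mult.assoc[symmetric])
  qed
  ultimately show ?thesis unfolding gE d_def[symmetric] by (simp only:)
qed

text \<open>With \<open>s = E i + E (Suc i)\<close> the substitution is
  \<open>z = (1 - p) * s\<close>. Since every \<open>z\<close> in the target interval is at most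
  \<open>E i\<close> and hence below \<open>s\<close>, it is reached for some \<open>p\<close> in
  (0, 1), and its density is \<open>1 / s \<ge> 1 / M\<close>.\<close>

lemma exchange_op_ge:
  assumes E: "E \<in> space S" and i: "Suc i < N" and T: "E i \<ge> (1 / 2) ^ Suc i" "E i + E (Suc i) \<le> M"
    and h: "h \<in> borel_measurable (unif_dyadic (Suc i))"
    and le: "\<And>z. z \<in> dyadic (Suc i) \<Longrightarrow> h z \<le> f (E(i := E i + E (Suc i) - z, Suc i := z))"
  shows "ennreal (1 / M / 2 ^ Suc (Suc i)) * (\<integral>\<^sup>+z. h z \<partial>unif_dyadic (Suc i)) \<le> exchange_op i f E"
proof -
  define s where "s = E i + E (Suc i)"
  have pos: "E (Suc i) > 0" "E i > 0" using state_pos[OF E] i by auto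
  then have s: "s > 0" "s > (1 / 2) ^ Suc i" "s \<le> M" using T by (auto simp: s_def)
  have M: "M > 0" using s by simp
  define g where "g z = indicator (dyadic (Suc i)) z * h z" for z
  have g [measurable]: "g \<in> borel_measurable borel"
    unfolding g_def by (rule nn_integral_unif_dyadic(2)[OF h])
  have gi: "(\<integral>\<^sup>+z. h z \<partial>unif_dyadic (Suc i)) = ennreal (2 ^ Suc (Suc i)) * (\<integral>\<^sup>+z. g z \<partial>lborel)"
    unfolding g_def by (rule nn_integral_unif_dyadic(1)[OF h])
  have "ennreal (1 / M / 2 ^ Suc (Suc i)) * ennreal (2 ^ Suc (Suc i)) = ennreal (1 / M)"
    using M by (subst ennreal_mult[symmetric]) auto
  then have "ennreal (1 / M / 2 ^ Suc (Suc i)) * (\<integral>\<^sup>+z. h z \<partial>unif_dyadic (Suc i)) = ennreal (1 / M) * (\<integral>\<^sup>+z. g z \<partial>lborel)"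
    unfolding gi by (simp only: mult.assoc[symmetric])
  also have "(\<integral>\<^sup>+z. g z \<partial>lborel) = ennreal s * (\<integral>\<^sup>+p. g (s + - s * p) \<partial>lborel)"
    using s nn_integral_real_affine[OF g, of "- s" s] by simp
  also have "ennreal (1 / M) * (ennreal s * (\<integral>\<^sup>+p. g (s + - s * p) \<partial>lborel))
      = ennreal (1 / M * s) * (\<integral>\<^sup>+p. g (s + - s * p) \<partial>lborel)"
    using M s by (subst ennreal_mult) (auto simp: mult.assoc)
  also have "\<dots> \<le> ennreal 1 * (\<integral>\<^sup>+p. g (s + - s * p) \<partial>lborel)"
    using s M by (intro mult_right_mono ennreal_leI) auto
  also have "\<dots> \<le> (\<integral>\<^sup>+p. indicator {0<..<1} p * f (E(i := p * s, Suc i := (1 - p) * s)) \<partial>lborel)"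
    unfolding ennreal_1 mult_1
  proof (intro nn_integral_mono)
    fix p :: real
    show "g (s + - s * p) \<le> indicator {0<..<1} p * f (E(i := p * s, Suc i := (1 - p) * s))"
    proof (cases "s + - s * p \<in> dyadic (Suc i)")
      case True
      have "s + - s * p > 0" using dyadic_pos[OF True] .
      then have "s * p < s * 1" by simp
      then have p1: "p < 1" using s by simp
      have "s + - s * p \<le> (1 / 2) ^ Suc i" using True by (simp add: dyadic_def)
      then have "s * p > 0" using s by simp
      then have p0: "p > 0" using s by (simp add: zero_less_mult_iff)
      have "h (s + - s * p) \<le> f (E(i := s - (s + - s * p), Suc i := s + - s * p))"
        using le[OF True] by (simp add: s_def)
      also have "s - (s + - s * p) = p * s" by simp
      also have "s + - s * p = (1 - p) * s" by (simp add: algebra_simps)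
      finally have "h ((1 - p) * s) \<le> f (E(i := p * s, Suc i := (1 - p) * s))" .
      moreover have "(1 - p) * s = s + - s * p" by (simp add: algebra_simps)
      then have "g (s + - s * p) = h ((1 - p) * s)" using True by (simp add: g_def)
      moreover have "indicator {0<..<1} p = (1 :: ennreal)" using p0 p1 by simp
      ultimately show ?thesis by (simp only: mult_1)
    qed (simp add: g_def)
  qed
  also have "\<dots> = exchange_op i f E" by (simp add: exchange_op_def nn_integral_unif01 s_def)
  finally show ?thesis .
qed

text \<open>Induction step: \<open>m\<close> jumps set the sites below \<open>k\<close>, one
  exchange between \<open>k - 1\<close> and \<open>k\<close> sets site \<open>k\<close>, and
  \<open>m\<close> further jumps set the sites below \<open>k\<close> again, since the exchange has
  spoilt site \<open>k - 1\<close>. The number of jumps is quantified before \<delta> and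
  \<open>M\<close> because the same power of \<open>Q\<close> must serve all sublevel sets.\<close>

lemma minorization_below:
  assumes "k \<le> N"
  shows "\<exists>m. (k \<noteq> 0 \<longrightarrow> m \<noteq> 0) \<and> (\<forall>\<delta>>0. \<forall>M. \<exists>\<epsilon>>0. \<forall>f\<in>borel_measurable S. \<forall>x\<in>space S.
    (\<forall>i<N. \<delta> \<le> x i \<and> x i \<le> M) \<longrightarrow> ennreal \<epsilon> * refresh_below k f x \<le> (Q ^^ m) f x)"
  using assms
proof (induction k)
  case 0
  show ?case by (rule exI[of _ 0], intro conjI allI impI exI[of _ 1]) auto
next
  case (Suc k)
  show ?case
  proof (cases k)
    case 0
    have "\<exists>\<epsilon>>0. \<forall>f\<in>borel_measurable S. \<forall>x\<in>space S.
        (\<forall>i<N. \<delta> \<le> x i \<and> x i \<le> M) \<longrightarrow> ennreal \<epsilon> * refresh_below (Suc k) f x \<le> (Q ^^ 1) f x"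
      if \<delta>: "\<delta> > 0" for \<delta> M
    proof -
      define r where "r = min K (sqrt (min TL \<delta>))"
      define M' where "M' = max M 1"
      define a where "a = exp (- 2 / TL) / TL / (M' + 2) / 2"
      have r: "r > 0" using K TL \<delta> by (simp add: r_def)
      have a: "a > 0" using TL by (auto simp: a_def M'_def intro!: divide_pos_pos)
      have "ennreal (r / L * a) * refresh_below (Suc k) f x \<le> (Q ^^ 1) f x"
        if f: "f \<in> borel_measurable S" and x: "x \<in> space S" and box: "\<forall>i<N. \<delta> \<le> x i \<and> x i \<le> M" for f x
      proof -
        have x0: "\<delta> \<le> x 0" "x 0 \<le> M'" using box N by (auto simp: M'_def)
        have "r \<le> edge_rate 0 x"
          using x0 by (auto simp: r_def edge_rate_def rate_def intro: min.coboundedI2)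
        then have "ennreal (r / L) * edge_op 0 f x \<le> Q f x"
          using r by (intro Q_ge_edge[OF x f]) auto
        moreover have "ennreal a * refresh_op 0 f x \<le> edge_op 0 f x"
          unfolding a_def using bath_op_ge_refresh[OF x x0(2) f] by (simp add: edge_op_def)
        then have "ennreal (r / L) * (ennreal a * refresh_op 0 f x) \<le> ennreal (r / L) * edge_op 0 f x"
          by (rule mult_left_mono) simp
        moreover have "ennreal (r / L * a) * refresh_op 0 f x = ennreal (r / L) * (ennreal a * refresh_op 0 f x)"
          using r L_pos a by (subst ennreal_mult) (auto simp: mult.assoc)
        ultimately show ?thesis by (simp add: 0)
      qed
      moreover have "r / L * a > 0" using r L_pos a by simp
      ultimately show ?thesis by blast
    qed
    then show ?thesis by (intro exI[of _ 1] conjI impI) (simp, blast)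
  next
    case (Suc i)
    have kN: "k < N" "Suc i < N" using Suc.prems Suc by auto
    from Suc.IH[OF less_imp_le[OF kN(1)]] obtain m where "\<forall>\<delta>>0. \<forall>M. \<exists>\<epsilon>>0. \<forall>f\<in>borel_measurable S. \<forall>x\<in>space S.
      (\<forall>i<N. \<delta> \<le> x i \<and> x i \<le> M) \<longrightarrow> ennreal \<epsilon> * refresh_below k f x \<le> (Q ^^ m) f x"
      by (elim exE conjE)
    note m = this[rule_format]
    interpret Qm: markov_operator S "Q ^^ m" by (rule Q.markov_operator_power)
    interpret T: markov_operator S "refresh_below k" using kN by (intro markov_operator_refresh_below) auto
    have "\<exists>\<epsilon>>0. \<forall>f\<in>borel_measurable S. \<forall>x\<in>space S.
        (\<forall>i<N. \<delta> \<le> x i \<and> x i \<le> M) \<longrightarrow> ennreal \<epsilon> * refresh_below (Suc k) f x \<le> (Q ^^ (m + 1 + m)) f x"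
      if \<delta>: "\<delta> > 0" for \<delta> M
    proof -
      \<comment> \<open>The lower bound valid after the first round, since a freshly set site is at
        least \<open>(1 / 2) ^ Suc N\<close>. The following exchange may add two energies, hence the
        upper bound \<open>2 * M'\<close> for the second round.\<close>
      define \<delta>' where "\<delta>' = min \<delta> ((1 / 2) ^ Suc N)"
      define M' where "M' = max M 1"
      have \<delta>': "\<delta>' > 0" using \<delta> by (simp add: \<delta>'_def)
      have M': "M' \<ge> 1" "M \<le> M'" by (auto simp: M'_def)
      obtain e1 where e1: "e1 > 0" "\<And>f x. \<lbrakk>f \<in> borel_measurable S; x \<in> space S; \<forall>i<N. \<delta> \<le> x i \<and> x i \<le> M\<rbrakk>
          \<Longrightarrow> ennreal e1 * refresh_below k f x \<le> (Q ^^ m) f x"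
        using m[OF \<delta>, of M] by blast
      obtain e2 where e2: "e2 > 0" "\<And>f x. \<lbrakk>f \<in> borel_measurable S; x \<in> space S; \<forall>i<N. \<delta>' \<le> x i \<and> x i \<le> 2 * M'\<rbrakk>
          \<Longrightarrow> ennreal e2 * refresh_below k f x \<le> (Q ^^ m) f x"
        using m[OF \<delta>', of "2 * M'"] by blast
      define r where "r = min K (sqrt \<delta>')"
      have r: "r > 0" using K \<delta>' by (simp add: r_def)
      define a where "a = 1 / (2 * M') / 2 ^ Suc k"
      have a: "a > 0" using M' by (simp add: a_def)
      define c where "c = r / L * (a * e2)"
      have c: "c > 0" using r L_pos a e2 by (simp add: c_def)
      have "ennreal c = ennreal (r / L) * ennreal (a * e2)"
        unfolding c_def using r L_pos a e2 by (intro ennreal_mult) auto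
      also have "ennreal (a * e2) = ennreal a * ennreal e2"
        using a e2 by (intro ennreal_mult) auto
      finally have cc: "ennreal c = ennreal (r / L) * (ennreal a * ennreal e2)" .
      have dy: "z \<in> dyadic j \<Longrightarrow> j \<le> N \<Longrightarrow> \<delta>' \<le> z" for z j
      proof -
        assume z: "z \<in> dyadic j" "j \<le> N"
        have "(1 / 2 :: real) ^ Suc N \<le> (1 / 2) ^ Suc j" using z by (intro power_decreasing) auto
        moreover have "(1 / 2) ^ Suc j \<le> z" using z by (simp add: dyadic_def)
        moreover have "\<delta>' \<le> (1 / 2) ^ Suc N" by (simp add: \<delta>'_def)
        ultimately show "\<delta>' \<le> z" by linarith
      qed
      have "ennreal (e1 * c) * refresh_below (Suc k) f x \<le> (Q ^^ (m + 1 + m)) f x"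
        if f [measurable]: "f \<in> borel_measurable S" and x: "x \<in> space S" and box: "\<forall>i<N. \<delta> \<le> x i \<and> x i \<le> M" for f x
      proof -
        let ?g = "Q ((Q ^^ m) f)"
        have key: "ennreal c * refresh_below (Suc k) f x \<le> ?g y"
          if y: "y \<in> space S" "\<And>j. j < k \<Longrightarrow> y j \<in> dyadic j" "\<And>j. j \<ge> k \<Longrightarrow> y j = x j" for y
        proof -
          have ybox: "\<delta>' \<le> y j \<and> y j \<le> M'" if j: "j < N" for j
          proof (cases "j < k")
            case True
            then show ?thesis using dy[OF y(2)[OF True]] dyadic_le_1[OF y(2)[OF True]] j M' by auto
          next
            case False
            then show ?thesis using y(3)[of j] box j M' by (auto simp: \<delta>'_def)
          qed
          have yi: "y i \<in> dyadic i" using y(2)[of i] Suc by simp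
          define h where "h z = ennreal e2 * refresh_below k f (x(k := z))" for z
          have hm: "(\<lambda>z. refresh_below k f (x(k := z))) \<in> borel_measurable (unif_dyadic k)"
            using measurable_compose[OF measurable_refresh[OF x kN(1)] T.measurable_op[OF f]] .
          have h1: "h z \<le> (Q ^^ m) f (y(i := y i + y (Suc i) - z, Suc i := z))" if z: "z \<in> dyadic (Suc i)" for z
          proof -
            let ?y = "y(i := y i + y (Suc i) - z, Suc i := z)"
            \<comment> \<open>The order of the dyadic intervals: site \<open>i\<close> can give away
              \<open>z\<close> out of its own energy, so after the exchange it keeps at least
              \<open>y (Suc i)\<close>.\<close>
            have zz: "z \<le> y i" using z yi by (auto simp: dyadic_def)
            have "\<delta>' \<le> y (Suc i)" "y i \<le> M'" "y (Suc i) \<le> M'" using ybox kN by auto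
            then have n1: "\<delta>' \<le> y i + y (Suc i) - z" "y i + y (Suc i) - z \<le> 2 * M'"
              using zz dyadic_pos[OF z] by auto
            have sp: "?y \<in> space S"
              using y(1) kN dyadic_pos[OF z] n1 \<delta>' by (intro state_upd) auto
            have "\<forall>j<N. \<delta>' \<le> ?y j \<and> ?y j \<le> 2 * M'"
            proof (intro allI impI)
              fix j assume j: "j < N"
              show "\<delta>' \<le> ?y j \<and> ?y j \<le> 2 * M'"
                using ybox[OF j] n1 dy[OF z] kN dyadic_le_1[OF z] M' by (auto simp: fun_upd_def)
            qed
            then have "ennreal e2 * refresh_below k f ?y \<le> (Q ^^ m) f ?y" by (rule e2(2)[OF f sp])
            \<comment> \<open>The second round overwrites what the exchange left at site
              \<open>i\<close>; from \<open>k\<close> on the two states agree, so only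
              \<open>x\<close> and \<open>z\<close> matter.\<close>
            moreover have "refresh_below k f ?y = refresh_below k f (x(k := z))"
            proof (rule refresh_below_cong[OF sp state_upd[OF x kN(1) dyadic_pos[OF z]]])
              show "?y j = (x(k := z)) j" if "j \<ge> k" for j
                using that y(3)[OF that] Suc by auto
            qed (use kN in simp)
            ultimately show ?thesis by (simp add: h_def)
          qed
          have "ennreal a * (\<integral>\<^sup>+z. h z \<partial>unif_dyadic k) \<le> exchange_op i ((Q ^^ m) f) y"
            unfolding a_def Suc
          proof (rule exchange_op_ge[OF y(1) kN(2)])
            show "(1 / 2) ^ Suc i \<le> y i" using yi by (simp add: dyadic_def)
            show "y i + y (Suc i) \<le> 2 * M'" using ybox[of i] ybox[of "Suc i"] kN by auto
            show "h \<in> borel_measurable (unif_dyadic (Suc i))"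
              unfolding h_def[abs_def] using hm Suc by simp
          qed (rule h1)
          also have "exchange_op i ((Q ^^ m) f) y = edge_op (Suc i) ((Q ^^ m) f) y"
            using kN by (simp add: edge_op_def)
          finally have "ennreal (r / L) * (ennreal a * (\<integral>\<^sup>+z. h z \<partial>unif_dyadic k))
              \<le> ennreal (r / L) * edge_op (Suc i) ((Q ^^ m) f) y" by (intro mult_left_mono) auto
          also have "\<dots> \<le> ?g y"
          proof (rule Q_ge_edge[OF y(1)])
            have "\<delta>' \<le> min (y i) (y (Suc i))" using ybox[of i] ybox[of "Suc i"] kN by simp
            then have "r \<le> rate K (y i) (y (Suc i))"
              unfolding r_def rate_def by (intro min.mono real_sqrt_le_mono) auto
            then show "r \<le> edge_rate (Suc i) y" using kN by (simp add: edge_rate_def)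
          qed (use kN r Qm.measurable_op[OF f] in auto)
          also have "(\<integral>\<^sup>+z. h z \<partial>unif_dyadic k) = ennreal e2 * refresh_below (Suc k) f x"
            unfolding h_def refresh_below.simps refresh_op_def by (rule nn_integral_cmult[OF hm])
          also have "ennreal (r / L) * (ennreal a * (ennreal e2 * refresh_below (Suc k) f x)) = ennreal c * refresh_below (Suc k) f x"
            by (simp only: cc mult.assoc)
          finally show ?thesis .
        qed
        have "ennreal c * refresh_below (Suc k) f x = refresh_below k (\<lambda>_. ennreal c * refresh_below (Suc k) f x) x"
          using T.op_const[OF x] by simp
        also have "\<dots> \<le> refresh_below k ?g x"
          using key x kN by (intro refresh_below_mono[where N = N]) auto
        finally have "ennreal e1 * (ennreal c * refresh_below (Suc k) f x) \<le> ennreal e1 * refresh_below k ?g x"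
          by (rule mult_left_mono) simp
        also have "\<dots> \<le> (Q ^^ m) ?g x"
          using box x Qm.measurable_op[OF f] by (intro e1(2)) auto
        also have "(Q ^^ m) ?g x = (Q ^^ (m + 1 + m)) f x"
          unfolding funpow_add One_nat_def funpow.simps comp_apply by simp
        finally have "ennreal e1 * (ennreal c * refresh_below (Suc k) f x) \<le> (Q ^^ (m + 1 + m)) f x" .
        moreover have "ennreal (e1 * c) = ennreal e1 * ennreal c"
          using e1 c by (intro ennreal_mult) auto
        ultimately show ?thesis by (simp only: mult.assoc)
      qed
      moreover have "e1 * c > 0" using e1 c by simp
      ultimately show ?thesis by blast
    qed
    then show ?thesis by (intro exI[of _ "m + 1 + m"] conjI impI) (simp, blast)
  qed
qed

text \<open>On a box in which all energies are bounded above and away from 0, the law with every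
  site refreshed is a common component. The exponent is written as \<open>Suc m\<close> and
  \<open>e\<close> is capped at 1/2 to meet the hypotheses of the contraction theorem.\<close>

lemma minorization:
  "\<exists>m. \<forall>\<delta>>0. \<forall>M. \<exists>e T. 0 < e \<and> e < 1 \<and> markov_operator S T \<and>
      (\<forall>f\<in>borel_measurable S. \<forall>x\<in>space S. \<forall>y\<in>space S. T f x = T f y) \<and>
      (\<forall>f\<in>borel_measurable S. \<forall>x\<in>space S. (\<forall>i<N. \<delta> \<le> x i \<and> x i \<le> M) \<longrightarrow> ennreal e * T f x \<le> (Q ^^ Suc m) f x)"
proof -
  obtain m' where "m' \<noteq> 0" and m': "\<And>\<delta> M. \<delta> > 0 \<Longrightarrow> \<exists>\<epsilon>>0. \<forall>f\<in>borel_measurable S. \<forall>x\<in>space S.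
      (\<forall>i<N. \<delta> \<le> x i \<and> x i \<le> M) \<longrightarrow> ennreal \<epsilon> * refresh_below N f x \<le> (Q ^^ m') f x"
    using minorization_below[of N] N by auto
  then obtain m where m: "m' = Suc m" by (cases m') auto
  have const: "refresh_below N f x = refresh_below N f y" if "x \<in> space S" "y \<in> space S" for f x y
    using that by (intro refresh_below_cong) (auto simp: space_state_space PiE_iff extensional_def)
  have "\<exists>e T. 0 < e \<and> e < 1 \<and> markov_operator S T \<and>
      (\<forall>f\<in>borel_measurable S. \<forall>x\<in>space S. \<forall>y\<in>space S. T f x = T f y) \<and>
      (\<forall>f\<in>borel_measurable S. \<forall>x\<in>space S. (\<forall>i<N. \<delta> \<le> x i \<and> x i \<le> M) \<longrightarrow> ennreal e * T f x \<le> (Q ^^ Suc m) f x)"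
    if d: "\<delta> > 0" for \<delta> M
  proof -
    obtain \<epsilon> where \<epsilon>: "\<epsilon> > 0" "\<And>f x. \<lbrakk>f \<in> borel_measurable S; x \<in> space S; \<forall>i<N. \<delta> \<le> x i \<and> x i \<le> M\<rbrakk>
        \<Longrightarrow> ennreal \<epsilon> * refresh_below N f x \<le> (Q ^^ Suc m) f x"
      using m'[OF d, of M] unfolding m by blast
    define e where "e = min \<epsilon> (1 / 2)"
    have e: "0 < e" "e < 1" "e \<le> \<epsilon>" using \<epsilon>(1) by (auto simp: e_def)
    have "ennreal e * refresh_below N f x \<le> (Q ^^ Suc m) f x"
      if "f \<in> borel_measurable S" "x \<in> space S" "\<forall>i<N. \<delta> \<le> x i \<and> x i \<le> M" for f x
    proof -
      have "ennreal e * refresh_below N f x \<le> ennreal \<epsilon> * refresh_below N f x"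
        using e by (intro mult_right_mono ennreal_leI) auto
      also have "\<dots> \<le> (Q ^^ Suc m) f x" by (rule \<epsilon>(2)[OF that])
      finally show ?thesis .
    qed
    moreover have "markov_operator S (refresh_below N)" by (rule markov_operator_refresh_below) simp
    moreover have "\<forall>f\<in>borel_measurable S. \<forall>x\<in>space S. \<forall>y\<in>space S. refresh_below N f x = refresh_below N f y"
      using const by blast
    ultimately show ?thesis using e by blast
  qed
  then show ?thesis by blast
qed

end

subsection \<open>Poissonization\<close>

text \<open>The second series is an index shift by two:
  \<open>w n / ((n + 1) * (n + 2)) = w (n + 2) / a\<^sup>2\<close>.\<close>

lemma poisson_weights:
  fixes a :: real
  assumes "a > 0"
  defines "w \<equiv> \<lambda>n. exp (- a) * a ^ n / fact n"
  shows "w sums 1" "(\<lambda>n. w n / (real (n + 1) * real (n + 2))) sums ((1 - w 0 - w 1) / a\<^sup>2)"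
    "\<And>n. w n \<ge> 0"
proof -
  have "(\<lambda>n. exp (- a) * (a ^ n /\<^sub>R fact n)) sums (exp (- a) * exp a)"
    by (intro sums_mult exp_converges)
  moreover have "exp (- a) * exp a = 1" by (simp flip: exp_add)
  moreover have "(\<lambda>n. exp (- a) * (a ^ n /\<^sub>R fact n)) = w"
    by (auto simp: w_def fun_eq_iff field_simps)
  ultimately show 1: "w sums 1" by simp
  then have "(\<lambda>n. w (n + 2)) sums (1 - (\<Sum>i<2. w i))" by (rule sums_split_initial_segment)
  then have "(\<lambda>n. w (n + 2) / a\<^sup>2) sums ((1 - (\<Sum>i<2. w i)) / a\<^sup>2)" by (rule sums_divide)
  moreover have "w (n + 2) / a\<^sup>2 = w n / (real (n + 1) * real (n + 2))" for n
  proof -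
    have f: "fact (n + 2) = real (n + 1) * real (n + 2) * fact n" by (simp add: algebra_simps)
    have p: "a ^ (n + 2) = a ^ n * a\<^sup>2" by (rule power_add)
    have "x * (y * z) / (v * u) / z = x * y / u / v" if "z \<noteq> 0" for x y z u v :: real
      using that by simp
    from this[of "a\<^sup>2" "exp (- a)" "a ^ n" "real (n + 1) * real (n + 2)" "fact n"]
    show ?thesis unfolding w_def f p using assms(1) by simp
  qed
  ultimately show "(\<lambda>n. w n / (real (n + 1) * real (n + 2))) sums ((1 - w 0 - w 1) / a\<^sup>2)"
    by (simp add: numeral_2_eq_2 diff_diff_add)
  show "w n \<ge> 0" for n using assms(1) by (simp add: w_def)
qed

text \<open>By Young's inequality (n + 1) powr -\<beta> is at most a powr -\<beta> + a powr (2 -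
  \<beta>) * (n + 1) powr -2, and the inverse square is at most 2 / ((n + 1) * (n + 2)), whose
  Poisson mean is at most 2 / a^2. The two contributions add up to the factor 3.\<close>

lemma poisson_inverse_moment:
  fixes a \<beta> :: real
  assumes a: "a > 0" and \<beta>: "0 < \<beta>" "\<beta> < 2"
  shows "(\<Sum>n. ennreal (exp (- a) * a ^ n / fact n) * ennreal (1 / (real n + 1) powr \<beta>)) \<le> ennreal (3 * a powr - \<beta>)"
proof -
  define w where "w n = exp (- a) * a ^ n / fact n" for n
  have w: "w sums 1" "(\<lambda>n. w n / (real (n + 1) * real (n + 2))) sums ((1 - w 0 - w 1) / a\<^sup>2)" "\<And>n. w n \<ge> 0"
    using poisson_weights[OF a] unfolding w_def by auto
  define u where "u n = a powr - \<beta> * w n + 2 * a powr (2 - \<beta>) * (w n / (real (n + 1) * real (n + 2)))" for n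
  have pt: "w n * (1 / (real n + 1) powr \<beta>) \<le> u n" for n
  proof -
    define x where "x = 1 / (real n + 1)\<^sup>2"
    have x: "x > 0" by (simp add: x_def)
    have "(a\<^sup>2 * x) powr (\<beta> / 2) * 1 powr (1 - \<beta> / 2) \<le> \<beta> / 2 * (a\<^sup>2 * x) + (1 - \<beta> / 2) * 1"
      using a x \<beta> by (intro Youngs_inequality_0) auto
    also have "\<dots> \<le> 1 * (a\<^sup>2 * x) + 1 * 1" using a x \<beta> by (intro add_mono mult_right_mono) auto
    finally have "(a\<^sup>2 * x) powr (\<beta> / 2) \<le> a\<^sup>2 * x + 1" by simp
    moreover have "(a\<^sup>2 * x) powr (\<beta> / 2) = a powr \<beta> * (1 / (real n + 1) powr \<beta>)"
    proof -
      have "a\<^sup>2 * x = (a / (real n + 1)) powr 2"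
        using a by (simp add: x_def powr_numeral power_divide)
      then have "(a\<^sup>2 * x) powr (\<beta> / 2) = (a / (real n + 1)) powr \<beta>"
        by (simp only: powr_powr) simp
      then show ?thesis using a by (simp add: powr_divide)
    qed
    ultimately have "a powr - \<beta> * (a powr \<beta> * (1 / (real n + 1) powr \<beta>)) \<le> a powr - \<beta> * (a\<^sup>2 * x + 1)"
      by (intro mult_left_mono) auto
    moreover have "a powr - \<beta> * (a powr \<beta> * (1 / (real n + 1) powr \<beta>)) = 1 / (real n + 1) powr \<beta>"
      using a by (simp add: powr_minus)
    moreover have "a powr - \<beta> * (a\<^sup>2 * x + 1) = a powr - \<beta> + a powr (2 - \<beta>) * x"
      using a by (simp add: powr_diff powr_minus powr_numeral field_simps)
    moreover have "x \<le> 2 / (real (n + 1) * real (n + 2))"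
    proof -
      have "real (n + 1) * real (n + 2) \<le> real (n + 1) * (2 * real (n + 1))" by (intro mult_left_mono) auto
      then have "2 / (real (n + 1) * (2 * real (n + 1))) \<le> 2 / (real (n + 1) * real (n + 2))"
        by (intro divide_left_mono) auto
      moreover have "1 / y\<^sup>2 = 2 / (y * (2 * y))" for y :: real by (simp add: power2_eq_square)
      then have "x = 2 / (real (n + 1) * (2 * real (n + 1)))"
        unfolding x_def by (simp only: of_nat_add of_nat_1)
      ultimately show ?thesis by simp
    qed
    then have "a powr (2 - \<beta>) * x \<le> a powr (2 - \<beta>) * (2 / (real (n + 1) * real (n + 2)))"
      by (intro mult_left_mono) auto
    ultimately have "1 / (real n + 1) powr \<beta> \<le> a powr - \<beta> + a powr (2 - \<beta>) * (2 / (real (n + 1) * real (n + 2)))"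
      by linarith
    then have "w n * (1 / (real n + 1) powr \<beta>) \<le> w n * (a powr - \<beta> + a powr (2 - \<beta>) * (2 / (real (n + 1) * real (n + 2))))"
      using w(3) by (rule mult_left_mono)
    also have "\<dots> = u n" by (simp add: u_def distrib_left mult_ac)
    finally show ?thesis .
  qed
  have us: "u sums (a powr - \<beta> * 1 + 2 * a powr (2 - \<beta>) * ((1 - w 0 - w 1) / a\<^sup>2))"
    unfolding u_def by (intro sums_add sums_mult w)
  have un: "u n \<ge> 0" for n using w(3)[of n] by (auto simp: u_def intro!: add_nonneg_nonneg mult_nonneg_nonneg)
  have "(\<Sum>n. ennreal (w n) * ennreal (1 / (real n + 1) powr \<beta>)) \<le> (\<Sum>n. ennreal (u n))"
  proof (rule suminf_le)
    show "ennreal (w n) * ennreal (1 / (real n + 1) powr \<beta>) \<le> ennreal (u n)" for n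
      using pt[of n] w(3)[of n] by (subst ennreal_mult[symmetric]) (auto intro: ennreal_leI)
  qed auto
  also have "\<dots> = ennreal (\<Sum>n. u n)"
    using us un by (intro suminf_ennreal2) (auto simp: sums_iff)
  also have "(\<Sum>n. u n) = a powr - \<beta> * 1 + 2 * a powr (2 - \<beta>) * ((1 - w 0 - w 1) / a\<^sup>2)"
    using us by (simp add: sums_iff)
  also have "\<dots> \<le> 3 * a powr - \<beta>"
  proof -
    have "(1 - w 0 - w 1) / a\<^sup>2 \<le> 1 / a\<^sup>2" using w(3)[of 0] w(3)[of 1] by (intro divide_right_mono) auto
    then have "2 * a powr (2 - \<beta>) * ((1 - w 0 - w 1) / a\<^sup>2) \<le> 2 * a powr (2 - \<beta>) * (1 / a\<^sup>2)"
      by (intro mult_left_mono) auto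
    also have "\<dots> = 2 * a powr - \<beta>"
      using a by (simp add: powr_diff powr_minus powr_numeral field_simps)
    finally show ?thesis by simp
  qed
  finally show ?thesis by (simp add: w_def ennreal_leI)
qed

section \<open>From the jump chain to the process and the total variation norm\<close>

context lyapunov
begin

text \<open>These are the terms with \<open>m = 1\<close>: there \<open>a_coef N 1 = 1\<close>, and
  for \<eta> = 1 - \<beta>/2 the exponent is exactly -\<beta>/2. This determines the choice of
  \<eta>.\<close>

lemma V_fun_ge:
  assumes E: "E \<in> space S"
  shows "(\<Sum>i<N. E i powr - (\<beta> / 2)) \<le> V_fun N (1 - \<beta> / 2) E"
proof -
  let ?f = "\<lambda>m. \<Sum>i\<in>{0..N-m}. (\<Sum>j<m. E (i + j)) powr (a_coef N m * (1 - \<beta> / 2) - 1)"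
  have "?f 1 \<le> (\<Sum>m\<in>{1..N}. ?f m)"
    using N by (intro member_le_sum) (auto intro!: sum_nonneg)
  moreover have "{0..N-1} = {..<N}" using N by auto
  then have "?f 1 = (\<Sum>i<N. E i powr - (\<beta> / 2))"
    by (simp add: a_coef_def)
  ultimately show ?thesis by (simp add: V_fun_def)
qed

lemma trans_kernel_measurable:
  assumes "A \<in> sets S"
  shows "(\<lambda>E. trans_kernel N K TL TR t E A) \<in> borel_measurable S"
proof -
  have [measurable]: "(Q ^^ n) (indicator A) \<in> borel_measurable S" for n
    using assms by (intro markov_operator.measurable_op[OF Q.markov_operator_power]) auto
  show ?thesis unfolding trans_kernel_def Let_def by measurable
qed

lemma trans_kernel_le_1:
  assumes A: "A \<in> sets S" and E: "E \<in> space S" and t: "t > 0"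
  shows "trans_kernel N K TL TR t E A \<le> 1"
proof -
  define w where "w n = exp (- (L * t)) * (L * t) ^ n / fact n" for n
  have w: "w sums 1" "\<And>n. w n \<ge> 0"
    using poisson_weights[of "L * t"] L_pos t unfolding w_def by auto
  have "trans_kernel N K TL TR t E A \<le> (\<Sum>n. ennreal (w n) * 1)"
    unfolding trans_kernel_def Let_def L_def[symmetric] w_def minus_mult_left[symmetric]
    using A E by (intro suminf_le mult_left_mono markov_operator.op_le_one[OF Q.markov_operator_power])
      (auto simp: indicator_def)
  also have "\<dots> = ennreal (\<Sum>n. w n)" using w by (simp, intro suminf_ennreal2) (auto simp: sums_iff)
  also have "\<dots> = 1" using w by (simp add: sums_iff)
  finally show ?thesis .
qed

lemma trans_kernel_contraction:
  "\<exists>V D. 0 < D \<and> V \<in> borel_measurable S \<and>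
    (\<forall>E\<in>space S. 1 \<le> V E \<and> V E \<le> D * (1 + (W_fun N E + V_fun N (1 - \<beta> / 2) E))) \<and>
    (\<forall>A\<in>sets S. \<forall>t>0. \<forall>x\<in>space S. \<forall>y\<in>space S.
      trans_kernel N K TL TR t x A \<le> trans_kernel N K TL TR t y A
        + ennreal (D * t powr - \<beta>) * ennreal (V x) + ennreal (D * t powr - \<beta>) * ennreal (V y))"
proof -
  obtain V c b C where c: "0 < c" "0 \<le> b" "0 \<le> C" and Vm: "V \<in> borel_measurable S"
    and V: "\<And>E. E \<in> space S \<Longrightarrow> 1 \<le> V E"
    "\<And>E. E \<in> space S \<Longrightarrow> V E \<le> C * (1 + (\<Sum>i<N. E i) + (\<Sum>i<N. E i powr - (\<beta> / 2)))"
    "\<And>E. E \<in> space S \<Longrightarrow> Q (\<lambda>E. ennreal (V E)) E + ennreal (c * V E powr \<kappa>) \<le> ennreal (V E + b)"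
    and level: "\<And>R. \<exists>\<delta> M. 0 < \<delta> \<and> (\<forall>E\<in>space S. V E \<le> R \<longrightarrow> (\<forall>i<N. \<delta> \<le> E i \<and> E i \<le> M))"
    using lyapunov_function by blast
  obtain m where m: "\<And>\<delta> M. \<delta> > 0 \<Longrightarrow> \<exists>e T. 0 < e \<and> e < 1 \<and> markov_operator S T \<and>
      (\<forall>f\<in>borel_measurable S. \<forall>x\<in>space S. \<forall>y\<in>space S. T f x = T f y) \<and>
      (\<forall>f\<in>borel_measurable S. \<forall>x\<in>space S. (\<forall>i<N. \<delta> \<le> x i \<and> x i \<le> M) \<longrightarrow> ennreal e * T f x \<le> (Q ^^ Suc m) f x)"
    using minorization by blast
  have "\<exists>C>0. \<forall>f\<in>borel_measurable S. (\<forall>x\<in>space S. f x \<le> 1) \<longrightarrow>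
      (\<forall>n. \<forall>x\<in>space S. \<forall>y\<in>space S.
        (Q ^^ n) f x \<le> (Q ^^ n) f y + ennreal (C * (V x + V y) / (real n + 1) powr \<beta>))"
  proof (rule Q.polynomial_contraction_of_power[OF Vm _ c(1,2) V(1)])
    show "\<beta> > 1" using \<beta> by simp
    show "Q (\<lambda>E. ennreal (V E)) E + ennreal (c * V E powr (1 - 1 / \<beta>)) \<le> ennreal (V E + b)" if "E \<in> space S" for E
      using V(3)[OF that] by (simp add: \<kappa>_def)
    fix R
    obtain \<delta> M where d: "0 < \<delta>" and box: "\<And>E. E \<in> space S \<Longrightarrow> V E \<le> R \<Longrightarrow> \<forall>i<N. \<delta> \<le> E i \<and> E i \<le> M"
      using level[of R] by blast
    from m[OF d, of M] obtain e T where e: "0 < e" "e < 1" "markov_operator S T"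
      "\<forall>f\<in>borel_measurable S. \<forall>x\<in>space S. \<forall>y\<in>space S. T f x = T f y"
      and mi: "\<forall>f\<in>borel_measurable S. \<forall>x\<in>space S. (\<forall>i<N. \<delta> \<le> x i \<and> x i \<le> M) \<longrightarrow> ennreal e * T f x \<le> (Q ^^ Suc m) f x"
      by (elim exE conjE)
    have "\<forall>f\<in>borel_measurable S. \<forall>x\<in>space S. V x \<le> R \<longrightarrow> ennreal e * T f x \<le> (Q ^^ Suc m) f x"
    proof (intro ballI impI)
      fix f :: "(nat \<Rightarrow> real) \<Rightarrow> ennreal" and x assume fx: "f \<in> borel_measurable S" "x \<in> space S" "V x \<le> R"
      show "ennreal e * T f x \<le> (Q ^^ Suc m) f x"
        using bspec[OF bspec[OF mi fx(1)] fx(2)] box[OF fx(2,3)] by (rule mp)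
    qed
    with e show "\<exists>e T. 0 < e \<and> e < 1 \<and> markov_operator S T \<and>
      (\<forall>f\<in>borel_measurable S. \<forall>x\<in>space S. \<forall>y\<in>space S. T f x = T f y) \<and>
      (\<forall>f\<in>borel_measurable S. \<forall>x\<in>space S. V x \<le> R \<longrightarrow> ennreal e * T f x \<le> (Q ^^ Suc m) f x)"
      by (intro exI conjI)
  qed
  then obtain C1 where C1: "C1 > 0" and contr': "\<forall>f\<in>borel_measurable S. (\<forall>x\<in>space S. f x \<le> 1) \<longrightarrow>
      (\<forall>n. \<forall>x\<in>space S. \<forall>y\<in>space S.
        (Q ^^ n) f x \<le> (Q ^^ n) f y + ennreal (C1 * (V x + V y) / (real n + 1) powr \<beta>))"
    by (elim exE conjE)
  have contr: "(Q ^^ n) f x \<le> (Q ^^ n) f y + ennreal (C1 * (V x + V y) / (real n + 1) powr \<beta>)"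
    if "f \<in> borel_measurable S" "\<And>x. x \<in> space S \<Longrightarrow> f x \<le> 1" "x \<in> space S" "y \<in> space S"
    for f :: "(nat \<Rightarrow> real) \<Rightarrow> ennreal" and n x y
    using bspec[OF contr' that(1)] that(2-4) by simp
  \<comment> \<open>One constant for two purposes: it dominates \<open>V\<close> by the integrable
    function of the hypothesis and contains the factor of the decay; \<open>C + 1\<close> makes it
    positive.\<close>
  define D where "D = max (C + 1) (3 * C1 * L powr - \<beta>)"
  have D: "D > 0" "D \<ge> C" "D \<ge> 3 * C1 * L powr - \<beta>" using c by (auto simp: D_def)
  have "trans_kernel N K TL TR t x A \<le> trans_kernel N K TL TR t y A
        + ennreal (D * t powr - \<beta>) * ennreal (V x) + ennreal (D * t powr - \<beta>) * ennreal (V y)"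
    if A: "A \<in> sets S" and t: "t > 0" and xy: "x \<in> space S" "y \<in> space S" for A t x y
  proof -
    define w where "w n = exp (- (L * t)) * (L * t) ^ n / fact n" for n
    have Lt: "L * t > 0" using L_pos t by simp
    have vv: "V x \<ge> 1" "V y \<ge> 1" using V(1) xy by auto
    have tk: "trans_kernel N K TL TR t z A = (\<Sum>n. ennreal (w n) * (Q ^^ n) (indicator A) z)" for z
      unfolding trans_kernel_def Let_def L_def[symmetric] w_def by simp
    define v where "v = C1 * (V x + V y)"
    have v: "v \<ge> 0" using C1 vv by (simp add: v_def)
    have "trans_kernel N K TL TR t x A
        \<le> (\<Sum>n. ennreal (w n) * (Q ^^ n) (indicator A) y + ennreal v * (ennreal (w n) * ennreal (1 / (real n + 1) powr \<beta>)))"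
      unfolding tk
    proof (rule suminf_le)
      fix n
      have "(Q ^^ n) (indicator A) x \<le> (Q ^^ n) (indicator A) y + ennreal (v / (real n + 1) powr \<beta>)"
        unfolding v_def using A xy by (intro contr) (auto simp: indicator_def)
      also have "ennreal (v / (real n + 1) powr \<beta>) = ennreal v * ennreal (1 / (real n + 1) powr \<beta>)"
        using v by (subst ennreal_mult[symmetric]) auto
      finally have "ennreal (w n) * (Q ^^ n) (indicator A) x
          \<le> ennreal (w n) * ((Q ^^ n) (indicator A) y + ennreal v * ennreal (1 / (real n + 1) powr \<beta>))"
        by (rule mult_left_mono) simp
      then show "ennreal (w n) * (Q ^^ n) (indicator A) x
          \<le> ennreal (w n) * (Q ^^ n) (indicator A) y + ennreal v * (ennreal (w n) * ennreal (1 / (real n + 1) powr \<beta>))"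
        by (simp add: distrib_left mult_ac)
    qed auto
    also have "\<dots> = trans_kernel N K TL TR t y A
       + ennreal v * (\<Sum>n. ennreal (w n) * ennreal (1 / (real n + 1) powr \<beta>))"
      unfolding tk by (subst suminf_add[symmetric]) (auto simp: ennreal_suminf_cmult)
    also have "\<dots> \<le> trans_kernel N K TL TR t y A + ennreal v * ennreal (3 * (L * t) powr - \<beta>)"
      unfolding w_def using \<beta> by (intro add_left_mono mult_left_mono poisson_inverse_moment[OF Lt]) auto
    also have "ennreal v * ennreal (3 * (L * t) powr - \<beta>) \<le> ennreal (D * t powr - \<beta>) * ennreal (V x) + ennreal (D * t powr - \<beta>) * ennreal (V y)"
    proof -
      have "v * (3 * (L * t) powr - \<beta>) = (3 * C1 * L powr - \<beta>) * (t powr - \<beta> * (V x + V y))"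
        using L_pos t by (simp add: v_def powr_mult mult_ac)
      also have "\<dots> \<le> D * (t powr - \<beta> * (V x + V y))"
        using D vv by (intro mult_right_mono) auto
      also have "\<dots> = D * t powr - \<beta> * V x + D * t powr - \<beta> * V y" by (simp add: algebra_simps)
      finally have "ennreal (v * (3 * (L * t) powr - \<beta>)) \<le> ennreal (D * t powr - \<beta> * V x + D * t powr - \<beta> * V y)"
        by (rule ennreal_leI)
      moreover have "ennreal (D * t powr - \<beta> * V x + D * t powr - \<beta> * V y)
          = ennreal (D * t powr - \<beta>) * ennreal (V x) + ennreal (D * t powr - \<beta>) * ennreal (V y)"
      proof -
        have nn: "0 \<le> D * t powr - \<beta>" "0 \<le> V x" "0 \<le> V y" using D(1) vv by auto
        show ?thesis
          unfolding ennreal_mult[OF nn(1,2), symmetric] ennreal_mult[OF nn(1,3), symmetric]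
          by (intro ennreal_plus mult_nonneg_nonneg nn)
      qed
      moreover have "ennreal v * ennreal (3 * (L * t) powr - \<beta>) = ennreal (v * (3 * (L * t) powr - \<beta>))"
        using v by (intro ennreal_mult[symmetric]) auto
      ultimately show ?thesis by metis
    qed
    finally show ?thesis by (simp add: add.assoc add_left_mono)
  qed
  moreover have "V E \<le> D * (1 + (W_fun N E + V_fun N (1 - \<beta> / 2) E))" if E: "E \<in> space S" for E
  proof -
    have "(\<Sum>i<N. E i) \<ge> 0"
      by (rule sum_nonneg) (auto intro: less_imp_le state_pos[OF E])
    moreover have "(\<Sum>i<N. E i powr - (\<beta> / 2)) \<ge> 0"
      by (rule sum_nonneg) auto
    ultimately have nn: "0 \<le> 1 + (\<Sum>i<N. E i) + (\<Sum>i<N. E i powr - (\<beta> / 2))" by linarith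
    have "C * (1 + (\<Sum>i<N. E i) + (\<Sum>i<N. E i powr - (\<beta> / 2))) \<le> D * (1 + (W_fun N E + V_fun N (1 - \<beta> / 2) E))"
    proof (rule mult_mono)
      show "C \<le> D" "0 \<le> D" using D by auto
      show "1 + (\<Sum>i<N. E i) + (\<Sum>i<N. E i powr - (\<beta> / 2)) \<le> 1 + (W_fun N E + V_fun N (1 - \<beta> / 2) E)"
        using V_fun_ge[OF E] unfolding W_fun_def by linarith
      show "0 \<le> 1 + (\<Sum>i<N. E i) + (\<Sum>i<N. E i powr - (\<beta> / 2))" by (rule nn)
    qed
    with V(2)[OF E] show ?thesis by linarith
  qed
  ultimately show ?thesis using V(1) Vm D(1) by (intro exI[of _ V] exI[of _ D] conjI allI ballI impI) blast+
qed

text \<open>The same integration in one variable at a time as for a single step of the chain, now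
  against the two initial laws.\<close>

lemma nn_integral_contraction:
  assumes \<mu>: "prob_space \<mu>" "sets \<mu> = sets S" and \<nu>: "prob_space \<nu>" "sets \<nu> = sets S"
    and [measurable]: "g \<in> borel_measurable S" "V \<in> borel_measurable S"
    and le: "\<And>x y. \<lbrakk>x \<in> space S; y \<in> space S\<rbrakk> \<Longrightarrow> g x \<le> g y + d * V x + d * V y"
  shows "(\<integral>\<^sup>+x. g x \<partial>\<mu>) \<le> (\<integral>\<^sup>+x. g x \<partial>\<nu>) + d * ((\<integral>\<^sup>+x. V x \<partial>\<mu>) + (\<integral>\<^sup>+x. V x \<partial>\<nu>))"
proof -
  interpret \<mu>: prob_space \<mu> by fact
  interpret \<nu>: prob_space \<nu> by fact
  note [measurable_cong] = \<mu>(2) \<nu>(2)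
  note sp = sets_eq_imp_space_eq[OF \<mu>(2)] sets_eq_imp_space_eq[OF \<nu>(2)]
  have 1: "(\<integral>\<^sup>+x. g x \<partial>\<mu>) \<le> (g y + d * V y) + d * (\<integral>\<^sup>+x. V x \<partial>\<mu>)" if y: "y \<in> space S" for y
  proof -
    have "(\<integral>\<^sup>+x. g x \<partial>\<mu>) \<le> (\<integral>\<^sup>+x. (g y + d * V y) + d * V x \<partial>\<mu>)"
    proof (rule nn_integral_mono)
      fix x assume "x \<in> space \<mu>"
      then have "g x \<le> g y + d * V x + d * V y" unfolding sp using y by (rule le)
      then show "g x \<le> (g y + d * V y) + d * V x" by (simp only: add_ac)
    qed
    also have "\<dots> = (\<integral>\<^sup>+x. (g y + d * V y) \<partial>\<mu>) + (\<integral>\<^sup>+x. d * V x \<partial>\<mu>)"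
      by (rule nn_integral_add) measurable
    also have "\<dots> = (g y + d * V y) + d * (\<integral>\<^sup>+x. V x \<partial>\<mu>)"
      by (simp add: nn_integral_cmult \<mu>.emeasure_space_1)
    finally show ?thesis .
  qed
  have "(\<integral>\<^sup>+x. g x \<partial>\<mu>) = (\<integral>\<^sup>+y. (\<integral>\<^sup>+x. g x \<partial>\<mu>) \<partial>\<nu>)" by (simp add: \<nu>.emeasure_space_1)
  also have "\<dots> \<le> (\<integral>\<^sup>+y. (g y + d * V y) + d * (\<integral>\<^sup>+x. V x \<partial>\<mu>) \<partial>\<nu>)"
    by (rule nn_integral_mono) (use 1 in \<open>simp only: sp\<close>)
  also have "\<dots> = (\<integral>\<^sup>+y. (g y + d * V y) \<partial>\<nu>) + (\<integral>\<^sup>+y. d * (\<integral>\<^sup>+x. V x \<partial>\<mu>) \<partial>\<nu>)"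
    by (rule nn_integral_add) measurable
  also have "\<dots> = ((\<integral>\<^sup>+y. g y \<partial>\<nu>) + (\<integral>\<^sup>+y. d * V y \<partial>\<nu>)) + d * (\<integral>\<^sup>+x. V x \<partial>\<mu>)"
    by (subst nn_integral_add) (measurable, simp add: \<nu>.emeasure_space_1)
  also have "(\<integral>\<^sup>+y. d * V y \<partial>\<nu>) = d * (\<integral>\<^sup>+y. V y \<partial>\<nu>)"
    by (rule nn_integral_cmult) measurable
  finally show ?thesis by (simp only: distrib_left add_ac)
qed

lemma evolve_contraction:
  assumes "\<mu> \<in> M_eta N (1 - \<beta> / 2)" "\<nu> \<in> M_eta N (1 - \<beta> / 2)"
  shows "\<exists>C\<ge>0. \<forall>t>0. \<forall>A\<in>sets S.
     \<bar>evolve N K TL TR \<mu> t A - evolve N K TL TR \<nu> t A\<bar> \<le> C * t powr - \<beta>"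
proof -
  obtain V D where D: "0 < D" and [measurable]: "V \<in> borel_measurable S"
    and V': "\<forall>E\<in>space S. 1 \<le> V E \<and> V E \<le> D * (1 + (W_fun N E + V_fun N (1 - \<beta> / 2) E))"
    and tk: "\<forall>A\<in>sets S. \<forall>t>0. \<forall>x\<in>space S. \<forall>y\<in>space S.
      trans_kernel N K TL TR t x A \<le> trans_kernel N K TL TR t y A
        + ennreal (D * t powr - \<beta>) * ennreal (V x) + ennreal (D * t powr - \<beta>) * ennreal (V y)"
    using trans_kernel_contraction by (elim exE conjE)
  have V: "V E \<le> D * (1 + (W_fun N E + V_fun N (1 - \<beta> / 2) E))" if "E \<in> space S" for E
    using bspec[OF V' that] by (rule conjunct2)
  have fin: "(\<integral>\<^sup>+E. ennreal (V E) \<partial>\<mu>) < \<infinity>" if \<mu>: "\<mu> \<in> M_eta N (1 - \<beta> / 2)" for \<mu>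
  proof -
    interpret prob_space \<mu> using \<mu> by (simp add: M_eta_def)
    have s: "sets \<mu> = sets S" and i: "(\<integral>\<^sup>+ E. ennreal (W_fun N E + V_fun N (1 - \<beta> / 2) E) \<partial>\<mu>) < \<infinity>"
      using \<mu> by (auto simp: M_eta_def)
    have sp: "space \<mu> = space S" using s by (rule sets_eq_imp_space_eq)
    have "(\<lambda>E. ennreal (W_fun N E + V_fun N (1 - \<beta> / 2) E)) \<in> borel_measurable S"
      unfolding W_fun_def V_fun_def
      by (intro measurable_compose[OF _ measurable_ennreal] borel_measurable_add borel_measurable_sum
          powr_real_measurable measurable_site borel_measurable_const) auto
    then have [measurable]: "(\<lambda>E. ennreal (W_fun N E + V_fun N (1 - \<beta> / 2) E)) \<in> borel_measurable \<mu>"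
      by (simp only: measurable_cong_sets[OF s refl])
    have [measurable_cong]: "sets \<mu> = sets S" by (rule s)
    have "(\<integral>\<^sup>+E. ennreal (V E) \<partial>\<mu>) \<le> (\<integral>\<^sup>+E. ennreal D * (1 + ennreal (W_fun N E + V_fun N (1 - \<beta> / 2) E)) \<partial>\<mu>)"
    proof (rule nn_integral_mono)
      fix E assume "E \<in> space \<mu>"
      then have E: "E \<in> space S" by (simp add: sp)
      have "W_fun N E \<ge> 0" unfolding W_fun_def
        by (rule sum_nonneg) (auto intro: less_imp_le state_pos[OF E])
      moreover have "V_fun N (1 - \<beta> / 2) E \<ge> 0" unfolding V_fun_def by (auto intro!: sum_nonneg)
      ultimately have nn: "W_fun N E + V_fun N (1 - \<beta> / 2) E \<ge> 0" by simp
      have "ennreal (V E) \<le> ennreal (D * (1 + (W_fun N E + V_fun N (1 - \<beta> / 2) E)))"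
        by (rule ennreal_leI[OF V[OF E]])
      also have "\<dots> = ennreal D * (ennreal 1 + ennreal (W_fun N E + V_fun N (1 - \<beta> / 2) E))"
        using D nn by (subst ennreal_mult, simp, simp, subst ennreal_plus) auto
      finally show "ennreal (V E) \<le> ennreal D * (1 + ennreal (W_fun N E + V_fun N (1 - \<beta> / 2) E))" by simp
    qed
    also have "\<dots> = ennreal D * (1 + (\<integral>\<^sup>+ E. ennreal (W_fun N E + V_fun N (1 - \<beta> / 2) E) \<partial>\<mu>))"
      by (simp add: nn_integral_cmult nn_integral_add emeasure_space_1)
    also have "\<dots> < \<infinity>" using i by (simp add: ennreal_mult_less_top less_top)
    finally show ?thesis .
  qed
  have main: "\<exists>C\<ge>0. \<forall>t>0. \<forall>A\<in>sets S. \<bar>evolve N K TL TR \<mu> t A - evolve N K TL TR \<nu> t A\<bar> \<le> C * t powr - \<beta>"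
    if \<mu>: "\<mu> \<in> M_eta N (1 - \<beta> / 2)" and \<nu>: "\<nu> \<in> M_eta N (1 - \<beta> / 2)" for \<mu> \<nu>
  proof -
    obtain a where a: "(\<integral>\<^sup>+E. ennreal (V E) \<partial>\<mu>) = ennreal a" "a \<ge> 0"
      using fin[OF \<mu>] by (cases "\<integral>\<^sup>+E. ennreal (V E) \<partial>\<mu>") auto
    obtain b where b: "(\<integral>\<^sup>+E. ennreal (V E) \<partial>\<nu>) = ennreal b" "b \<ge> 0"
      using fin[OF \<nu>] by (cases "\<integral>\<^sup>+E. ennreal (V E) \<partial>\<nu>") auto
    \<comment> \<open>Stated for arbitrary measures and bounds so that it can be used in both
      directions, which yields the absolute value.\<close>
    have one: "evolve N K TL TR \<mu> t A \<le> evolve N K TL TR \<nu> t A + D * t powr - \<beta> * (a + b)"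
      if \<mu>: "\<mu> \<in> M_eta N (1 - \<beta> / 2)" and \<nu>: "\<nu> \<in> M_eta N (1 - \<beta> / 2)"
        and a: "(\<integral>\<^sup>+E. ennreal (V E) \<partial>\<mu>) = ennreal a" "a \<ge> 0"
        and b: "(\<integral>\<^sup>+E. ennreal (V E) \<partial>\<nu>) = ennreal b" "b \<ge> 0"
        and t: "t > 0" and A: "A \<in> sets S" for \<mu> \<nu> a b t A
    proof -
      let ?g = "\<lambda>E. trans_kernel N K TL TR t E A"
      have p: "prob_space \<mu>" "sets \<mu> = sets S" "prob_space \<nu>" "sets \<nu> = sets S"
        using \<mu> \<nu> by (auto simp: M_eta_def)
      have le1: "(\<integral>\<^sup>+E. ?g E \<partial>M) \<le> 1" if "prob_space M" "sets M = sets S" for M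
      proof -
        interpret prob_space M by fact
        have "(\<integral>\<^sup>+E. ?g E \<partial>M) \<le> (\<integral>\<^sup>+E. 1 \<partial>M)"
          using sets_eq_imp_space_eq[OF that(2)] trans_kernel_le_1[OF A _ t] by (intro nn_integral_mono) auto
        then show ?thesis by (simp add: emeasure_space_1)
      qed
      have fin: "(\<integral>\<^sup>+E. ?g E \<partial>M) = ennreal (evolve N K TL TR M t A)" if "prob_space M" "sets M = sets S" for M
        unfolding evolve_def using le1[OF that] by (auto simp: ennreal_enn2real_if top_unique)
      have "(\<integral>\<^sup>+E. ?g E \<partial>\<mu>) \<le> (\<integral>\<^sup>+E. ?g E \<partial>\<nu>) + ennreal (D * t powr - \<beta>) *
         ((\<integral>\<^sup>+E. ennreal (V E) \<partial>\<mu>) + (\<integral>\<^sup>+E. ennreal (V E) \<partial>\<nu>))"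
      proof (rule nn_integral_contraction[OF p])
        show "?g \<in> borel_measurable S" by (rule trans_kernel_measurable[OF A])
        show "?g x \<le> ?g y + ennreal (D * t powr - \<beta>) * ennreal (V x) + ennreal (D * t powr - \<beta>) * ennreal (V y)"
          if "x \<in> space S" "y \<in> space S" for x y
          using bspec[OF tk A] t that by simp
      qed measurable
      also have "ennreal (D * t powr - \<beta>) * ((\<integral>\<^sup>+E. ennreal (V E) \<partial>\<mu>) + (\<integral>\<^sup>+E. ennreal (V E) \<partial>\<nu>))
          = ennreal (D * t powr - \<beta> * (a + b))"
        unfolding a b using D a b by (simp add: ennreal_mult ennreal_plus)
      finally have "ennreal (evolve N K TL TR \<mu> t A) \<le> ennreal (evolve N K TL TR \<nu> t A) + ennreal (D * t powr - \<beta> * (a + b))"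
        using fin p by simp
      also have "\<dots> = ennreal (evolve N K TL TR \<nu> t A + D * t powr - \<beta> * (a + b))"
        using D a b by (intro ennreal_plus[symmetric]) (auto simp: evolve_def)
      finally show ?thesis
        using D a b by (subst (asm) ennreal_le_iff) (auto simp: evolve_def intro!: add_nonneg_nonneg)
    qed
    have "\<bar>evolve N K TL TR \<mu> t A - evolve N K TL TR \<nu> t A\<bar> \<le> D * (a + b) * t powr - \<beta>"
      if "t > 0" "A \<in> sets S" for t A
      using one[OF \<mu> \<nu> a b that] one[OF \<nu> \<mu> b a that] by (simp add: abs_le_iff mult_ac add.commute)
    then show ?thesis using D a b by (intro exI[of _ "D * (a + b)"]) auto
  qed
  show ?thesis by (rule main[OF assms])
qed

text \<open>An event and its complement each contribute \<open>C * t powr - \<beta>\<close>, whence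
  a factor 2. The uniformity in the event also bounds the set over which the real supremum is
  taken.\<close>

lemma tv_norm_contraction:
  assumes "\<mu> \<in> M_eta N (1 - \<beta> / 2)" "\<nu> \<in> M_eta N (1 - \<beta> / 2)"
  shows "\<exists>C\<ge>0. \<forall>t>0. 0 \<le> tv_norm S (evolve N K TL TR \<mu> t) (evolve N K TL TR \<nu> t)
    \<and> tv_norm S (evolve N K TL TR \<mu> t) (evolve N K TL TR \<nu> t) \<le> C * t powr - \<beta>"
proof -
  obtain C where C: "C \<ge> 0" and le': "\<forall>t>0. \<forall>A\<in>sets S.
      \<bar>evolve N K TL TR \<mu> t A - evolve N K TL TR \<nu> t A\<bar> \<le> C * t powr - \<beta>"
    using evolve_contraction[OF assms] by (elim exE conjE)
  have le: "\<bar>evolve N K TL TR \<mu> t A - evolve N K TL TR \<nu> t A\<bar> \<le> C * t powr - \<beta>"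
    if "t > 0" "A \<in> sets S" for t A
    using le' that by simp
  have "0 \<le> tv_norm S (evolve N K TL TR \<mu> t) (evolve N K TL TR \<nu> t)
    \<and> tv_norm S (evolve N K TL TR \<mu> t) (evolve N K TL TR \<nu> t) \<le> 2 * C * t powr - \<beta>" if t: "t > 0" for t
  proof -
    let ?h = "\<lambda>A. \<bar>(evolve N K TL TR \<mu> t A - evolve N K TL TR \<nu> t A)
      - (evolve N K TL TR \<mu> t (space S - A) - evolve N K TL TR \<nu> t (space S - A))\<bar>"
    have h: "?h A \<le> 2 * C * t powr - \<beta>" if A: "A \<in> sets S" for A
      using le[OF t A] le[OF t sets.compl_sets[OF A]] by linarith
    have ne: "sets S \<noteq> {}" by auto
    have bdd: "bdd_above (?h ` sets S)" using h by (intro bdd_aboveI2) auto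
    have "0 \<le> ?h {}" by simp
    also have "?h {} \<le> (SUP A\<in>sets S. ?h A)" by (rule cSUP_upper[OF _ bdd]) simp
    finally have "0 \<le> (SUP A\<in>sets S. ?h A)" .
    moreover have "(SUP A\<in>sets S. ?h A) \<le> 2 * C * t powr - \<beta>"
      using h by (intro cSUP_least ne) auto
    ultimately show ?thesis by (simp add: tv_norm_def)
  qed
  then show ?thesis using C by (intro exI[of _ "2 * C"]) auto
qed

end

theorem theorem1:
  fixes N :: nat and TL TR :: real
  assumes "N \<ge> 1" and "TL > 0" and "TR > 0"
  shows "\<exists>K0. \<forall>K\<ge>K0. \<forall>\<gamma>>0. \<exists>\<eta>>0. \<forall>\<mu>\<in>M_eta N \<eta>. \<forall>\<nu>\<in>M_eta N \<eta>.
    ((\<lambda>t. t powr (2 - \<gamma>) *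
        tv_norm (state_space N) (evolve N K TL TR \<mu> t) (evolve N K TL TR \<nu> t))
      \<longlongrightarrow> 0) at_top"
\<comment> \<open>The threshold \<open>K0 = 1\<close> serves for all temperatures, as the estimates
  compare \<open>K\<close> with 1 only.\<close>
proof (rule exI[of _ 1], intro allI impI)
  fix K \<gamma> :: real
  assume K: "1 \<le> K" and \<gamma>: "0 < \<gamma>"
  \<comment> \<open>Strictly between 2 - \<gamma> and 2, and at least 3/2.\<close>
  define \<beta> where "\<beta> = 2 - min \<gamma> 1 / 2"
  have b: "3 / 2 \<le> \<beta>" "\<beta> < 2" and neg: "2 - \<gamma> - \<beta> < 0" using \<gamma> by (auto simp: \<beta>_def min_def)
  interpret lyapunov N K TL TR \<beta>
    by unfold_locales (use assms K b in auto)
  show "\<exists>\<eta>>0. \<forall>\<mu>\<in>M_eta N \<eta>. \<forall>\<nu>\<in>M_eta N \<eta>. ((\<lambda>t. t powr (2 - \<gamma>) *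
        tv_norm (state_space N) (evolve N K TL TR \<mu> t) (evolve N K TL TR \<nu> t)) \<longlongrightarrow> 0) at_top"
  proof (intro exI[of _ "1 - \<beta> / 2"] conjI ballI)
    show "1 - \<beta> / 2 > 0" using b by simp
    fix \<mu> \<nu> assume M: "\<mu> \<in> M_eta N (1 - \<beta> / 2)" "\<nu> \<in> M_eta N (1 - \<beta> / 2)"
    obtain C where C: "C \<ge> 0" and tv': "\<forall>t>0. 0 \<le> tv_norm S (evolve N K TL TR \<mu> t) (evolve N K TL TR \<nu> t)
      \<and> tv_norm S (evolve N K TL TR \<mu> t) (evolve N K TL TR \<nu> t) \<le> C * t powr - \<beta>"
      using tv_norm_contraction[OF M] by (elim exE conjE)
    have tv: "0 \<le> tv_norm S (evolve N K TL TR \<mu> t) (evolve N K TL TR \<nu> t)"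
      "tv_norm S (evolve N K TL TR \<mu> t) (evolve N K TL TR \<nu> t) \<le> C * t powr - \<beta>" if "t > 0" for t
      using tv' that by simp_all
    have "((\<lambda>t. C * t powr (2 - \<gamma> - \<beta>)) \<longlongrightarrow> C * 0) at_top"
      using neg by (intro tendsto_mult tendsto_const tendsto_neg_powr filterlim_ident)
    then have lim: "((\<lambda>t. C * t powr (2 - \<gamma> - \<beta>)) \<longlongrightarrow> 0) at_top" by simp
    show "((\<lambda>t. t powr (2 - \<gamma>) * tv_norm S (evolve N K TL TR \<mu> t) (evolve N K TL TR \<nu> t)) \<longlongrightarrow> 0) at_top"
    proof (rule tendsto_sandwich[OF _ _ tendsto_const lim])
      show "\<forall>\<^sub>F t in at_top. 0 \<le> t powr (2 - \<gamma>) * tv_norm S (evolve N K TL TR \<mu> t) (evolve N K TL TR \<nu> t)"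
        using eventually_gt_at_top[of 0] by eventually_elim (use tv in auto)
      show "\<forall>\<^sub>F t in at_top. t powr (2 - \<gamma>) * tv_norm S (evolve N K TL TR \<mu> t) (evolve N K TL TR \<nu> t) \<le> C * t powr (2 - \<gamma> - \<beta>)"
        using eventually_gt_at_top[of 0]
      proof eventually_elim
        case (elim t)
        have "t powr (2 - \<gamma>) * tv_norm S (evolve N K TL TR \<mu> t) (evolve N K TL TR \<nu> t) \<le> t powr (2 - \<gamma>) * (C * t powr - \<beta>)"
          using tv(2)[OF elim] by (intro mult_left_mono) auto
        also have "\<dots> = C * t powr (2 - \<gamma> - \<beta>)"
          using elim by (simp add: powr_add[symmetric] mult.left_commute)
        finally show ?case .
      qed
    qed
  qed
qed

end
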